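(* Let $\Gamma$ be a coalgebra over a field $k$ and let $M$ be a quasifinitely copresented right $\Gamma$-comodule that is finite-dimensional, indecomposable and not injective. Let $\mathcal{L}$ be the direct system (ordered by inclusion) of finite-dimensional subcoalgebras $\Lambda$ of $\Gamma$ containing $\operatorname{cf}(M)$. Then $$\varinjlim_{\Lambda\in\mathcal{L}}\operatorname{Tr}_{\Lambda}M=\operatorname{Tr}M .$$
   Context: $\mathrm{D}=\operatorname{Hom}_k(-,k)$. $\operatorname{cf}(M)\subseteq\Gamma$ is the coefficient space of $M$ (the smallest subspace $V\subseteq\Gamma$ with $\rho(M)\subseteq M\otimes V$, $\rho$ the coaction). A comodule $M$ is quasifinite if $\operatorname{Hom}(F,M)$ (comodule maps) is finite-dimensional for every finite-dimensional comodule $F$; it is quasifinitely copresented if there is an exact sequence $0\to M\to I_0\to I_1$ (a quasifinite injective copresentation) with $I_0,I_1$ quasifinite injective comodules. For a quasifinite right $\Gamma$-comodule $M$, $M^{*}=h_{-\Gamma}(M,\Gamma)=\varinjlim_{\Lambda}\mathrm{D}\operatorname{Hom}_{-\Gamma}(\Lambda,M)$ (the limit over finite-dimensional subcoalgebras $\Lambda\subseteq\Gamma$; $h_{-\Gamma}$ is the cohom functor), a left $\Gamma$-comodule via the left comodule structures of the $\Lambda$; $*$ is contravariant. The transpose $\operatorname{Tr}M$ of a quasifinitely copresented right $\Gamma$-comodule $M$ is the left $\Gamma$-comodule defined by exactness of $0\to\operatorname{Tr}M\to I_1^{*}\to I_0^{*}$, where $0\to M\to I_0\to I_1$ is a minimal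 quasifinite injective copresentation of $M$; the paper's convention is that any quasifinite injective copresentation may be used in this definition, i.e. the minimality requirement may be omitted. For a finite-dimensional subcoalgebra $\Lambda\subseteq\Gamma$ and a right $\Lambda$-comodule $M$, $\operatorname{Tr}_{\Lambda}M$ is the transpose formed in the same way over the coalgebra $\Lambda$. The connecting maps of the direct system $(\operatorname{Tr}_\Lambda M)_\Lambda$ are the inclusions $\Lambda\Box\operatorname{Tr}M\subseteq\Lambda'\Box\operatorname{Tr}M$ for $\Lambda\subseteq\Lambda'$, under the identifications $\operatorname{Tr}_{\Lambda}M\cong\Lambda\Box\operatorname{Tr}M$, where $\Box$ is the cotensor product over $\Gamma$. *)

theory Defs
  imports Complex_Main "HOL-Library.Function_Algebras"
begin

section \<open>Vector spaces and linear maps\<close>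

text \<open>
  A vector space over the field \<open>'k\<close> is a subspace (the carrier) of a type carrying the library
  structure of a vector space. Maps between spaces are only required to behave on carriers.
\<close>

record ('k, 'a) space =
  carrier :: "'a set"
  smul :: "'k \<Rightarrow> 'a \<Rightarrow> 'a"

definition vspace :: "('k::field, 'a::ab_group_add, 'r) space_scheme \<Rightarrow> bool" where
  "vspace X \<longleftrightarrow> vector_space (smul X) \<and> module.subspace (smul X) (carrier X)"

definition findim :: "('k::field, 'a::ab_group_add, 'r) space_scheme \<Rightarrow> bool" where
  "findim X \<longleftrightarrow> (\<exists>B. finite B \<and> module.span (smul X) B = carrier X)"

definition lin_on ::
  "('k::field, 'a::ab_group_add, 'r) space_scheme \<Rightarrow> ('k, 'b::ab_group_add, 's) space_scheme
    \<Rightarrow> ('a \<Rightarrow> 'b) \<Rightarrow> bool" where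
  "lin_on X Y f \<longleftrightarrow> (\<forall>x\<in>carrier X. f x \<in> carrier Y)
     \<and> (\<forall>x\<in>carrier X. \<forall>y\<in>carrier X. f (x + y) = f x + f y)
     \<and> (\<forall>a. \<forall>x\<in>carrier X. f (smul X a x) = smul Y a (f x))"

abbreviation kspace :: "('k::field, 'k) space" where
  "kspace \<equiv> \<lparr>carrier = UNIV, smul = (*)\<rparr>"

definition pw :: "('k \<Rightarrow> 'b \<Rightarrow> 'b) \<Rightarrow> 'k \<Rightarrow> ('a \<Rightarrow> 'b) \<Rightarrow> 'a \<Rightarrow> 'b" where
  "pw s a f = (\<lambda>x. s a (f x))"

text \<open>
  Spaces of maps defined on a carrier \<open>S\<close> are realised by functions vanishing outside \<open>S\<close>,
  i.e.\ by functions with \<open>res S f = f\<close>.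
\<close>

definition res :: "'a set \<Rightarrow> ('a \<Rightarrow> 'b::zero) \<Rightarrow> 'a \<Rightarrow> 'b" where
  "res S f = (\<lambda>x. if x \<in> S then f x else 0)"

definition Dual ::
  "('k::field, 'a::ab_group_add, 'r) space_scheme \<Rightarrow> ('k, 'a \<Rightarrow> 'k) space" where
  "Dual X = \<lparr>carrier = {a. lin_on X kspace a \<and> res (carrier X) a = a}, smul = pw (*)\<rparr>"


section \<open>Tensor products\<close>

text \<open>
  Over a field, \<open>X \<otimes> Y\<close> embeds into the dual of the space of bilinear forms; \<open>x \<otimes> y\<close> is
  the functional sending a bilinear form \<open>b\<close> to \<open>b x y\<close>. The forms are taken
  on the ambient types: every bilinear form on the carriers extends. So for subspaces
  \<open>X' \<subseteq> X\<close> and \<open>Y' \<subseteq> Y\<close> the space \<open>X' \<otimes> Y'\<close> is literally a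
  subset of \<open>X \<otimes> Y\<close>. The universal property is lemma \<open>tlift_sum\<close> below.
\<close>

type_synonym ('a, 'b, 'k) tensor = "('a \<Rightarrow> 'b \<Rightarrow> 'k) \<Rightarrow> 'k"

definition bilinear_form ::
  "('k::field \<Rightarrow> 'a::ab_group_add \<Rightarrow> 'a) \<Rightarrow> ('k \<Rightarrow> 'b::ab_group_add \<Rightarrow> 'b)
    \<Rightarrow> ('a \<Rightarrow> 'b \<Rightarrow> 'k) \<Rightarrow> bool" where
  "bilinear_form s t b \<longleftrightarrow>
     (\<forall>x. Vector_Spaces.linear t (*) (b x)) \<and> (\<forall>y. Vector_Spaces.linear s (*) (\<lambda>x. b x y))"

definition tens ::
  "('k::field, 'a::ab_group_add, 'r) space_scheme \<Rightarrow> ('k, 'b::ab_group_add, 's) space_scheme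
    \<Rightarrow> 'a \<Rightarrow> 'b \<Rightarrow> ('a, 'b, 'k) tensor" where
  "tens X Y x y = (\<lambda>b. if bilinear_form (smul X) (smul Y) b then b x y else 0)"

definition tensor ::
  "('k::field, 'a::ab_group_add, 'r) space_scheme \<Rightarrow> ('k, 'b::ab_group_add, 's) space_scheme
    \<Rightarrow> ('k, ('a, 'b, 'k) tensor) space" where
  "tensor X Y =
     \<lparr>carrier = module.span (pw (*)) {tens X Y x y | x y. x \<in> carrier X \<and> y \<in> carrier Y},
      smul = pw (*)\<rparr>"

text \<open>
  \<open>tlift X Y B\<close> is the linear map on \<open>X \<otimes> Y\<close> induced by a bilinear map \<open>B\<close>,
  evaluated on a representation as a sum of pure tensors.
\<close>

definition tlift ::
  "('k::field, 'a::ab_group_add, 'r) space_scheme \<Rightarrow> ('k, 'b::ab_group_add, 's) space_scheme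
    \<Rightarrow> ('a \<Rightarrow> 'b \<Rightarrow> 'z::ab_group_add) \<Rightarrow> ('a, 'b, 'k) tensor \<Rightarrow> 'z" where
  "tlift X Y B t =
     (let ps = (SOME ps. set ps \<subseteq> carrier X \<times> carrier Y \<and> (\<Sum>(x, y)\<leftarrow>ps. tens X Y x y) = t)
      in \<Sum>(x, y)\<leftarrow>ps. B x y)"

lemma vspaceD:
  assumes "vspace X"
  shows "vector_space (smul X)" "module (smul X)" "module.subspace (smul X) (carrier X)"
proof -
  show v: "vector_space (smul X)" and "module.subspace (smul X) (carrier X)"
    using assms by (auto simp: vspace_def)
  show "module (smul X)"
    using v by (simp add: module_iff_vector_space)
qed

lemma functional_on_subspace:
  fixes s :: "'k::field \<Rightarrow> 'z::ab_group_add \<Rightarrow> 'z"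
  assumes s: "vector_space s" and R: "module.subspace s R" and z: "z \<notin> R"
  obtains h where "Vector_Spaces.linear s (*) h" "\<And>r. r \<in> R \<Longrightarrow> h r = 0" "h z = 1"
proof -
  interpret s: vector_space s by fact
  interpret k: vector_space "(*) :: 'k \<Rightarrow> 'k \<Rightarrow> 'k"
    by unfold_locales (auto simp: algebra_simps)
  interpret p: vector_space_pair s "(*) :: 'k \<Rightarrow> 'k \<Rightarrow> 'k" by unfold_locales
  obtain B where B: "B \<subseteq> R" "s.independent B" "R \<subseteq> s.span B"
    by (rule s.maximal_independent_subset)
  have RB: "s.span B = R"
    using B R by (simp add: antisym s.span_minimal)
  then have "s.independent (insert z B)"
    using B z by (simp add: s.independent_insert)
  then obtain h where h: "Vector_Spaces.linear s (*) h"
      "\<forall>x\<in>insert z B. h x = (if x = z then 1 else 0)"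
    using p.linear_independent_extend[of "insert z B" "\<lambda>x. if x = z then 1 else 0"] by blast
  have "z \<notin> B" using B z by blast
  then have "h b = 0" if "b \<in> B" for b
    using h that by auto
  then have "h r = 0" if "r \<in> R" for r
    using p.linear_eq_0_on_span[OF h(1), of B r] that RB by auto
  moreover have "h z = 1" using h by simp
  ultimately show thesis using h that by blast
qed

lemma projection_on_subspace:
  fixes s :: "'k::field \<Rightarrow> 'z::ab_group_add \<Rightarrow> 'z"
  assumes s: "vector_space s" and R: "module.subspace s R"
  obtains p where "Vector_Spaces.linear s s p" "\<And>z. p z \<in> R" "\<And>r. r \<in> R \<Longrightarrow> p r = r"
proof -
  interpret s: vector_space s by fact
  interpret p: vector_space_pair s s by unfold_locales
  have "\<exists>g. g ` UNIV \<subseteq> R \<and> Vector_Spaces.linear s s g \<and> (\<forall>v\<in>R. g (id v) = v)"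
    by (rule p.linear_exists_left_inverse_on) (use R s.linear_id in \<open>auto simp: id_def\<close>)
  then show thesis using that by auto
qed

lemma tlift_sum:
  fixes X :: "('k::field, 'a::ab_group_add, 'r) space_scheme"
    and Y :: "('k, 'b::ab_group_add, 's) space_scheme"
    and Z :: "('k, 'z::ab_group_add, 't) space_scheme"
  assumes X: "vspace X" and Y: "vspace Y" and Z: "vspace Z"
    and B1: "\<And>x. x \<in> carrier X \<Longrightarrow> lin_on Y Z (B x)"
    and B2: "\<And>y. y \<in> carrier Y \<Longrightarrow> lin_on X Z (\<lambda>x. B x y)"
    and ps: "set ps \<subseteq> carrier X \<times> carrier Y"
  shows "tlift X Y B (\<Sum>(x, y)\<leftarrow>ps. tens X Y x y) = (\<Sum>(x, y)\<leftarrow>ps. B x y)"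
proof -
  interpret x: vector_space "smul X" using X by (simp add: vspaceD)
  interpret y: vector_space "smul Y" using Y by (simp add: vspaceD)
  interpret z: vector_space "smul Z" using Z by (simp add: vspaceD)
  define qs where "qs = (SOME qs. set qs \<subseteq> carrier X \<times> carrier Y
    \<and> (\<Sum>(x, y)\<leftarrow>qs. tens X Y x y) = (\<Sum>(x, y)\<leftarrow>ps. tens X Y x y))"
  have qs: "set qs \<subseteq> carrier X \<times> carrier Y"
      "(\<Sum>(x, y)\<leftarrow>qs. tens X Y x y) = (\<Sum>(x, y)\<leftarrow>ps. tens X Y x y)"
    unfolding atomize_conj qs_def by (rule someI[of _ ps]) (use ps in simp)
  obtain p where p: "Vector_Spaces.linear (smul X) (smul X) p" "\<And>z. p z \<in> carrier X"
      "\<And>r. r \<in> carrier X \<Longrightarrow> p r = r"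
    using projection_on_subspace[OF vspaceD(1,3)[OF X]] by metis
  obtain q where q: "Vector_Spaces.linear (smul Y) (smul Y) q" "\<And>z. q z \<in> carrier Y"
      "\<And>r. r \<in> carrier Y \<Longrightarrow> q r = r"
    using projection_on_subspace[OF vspaceD(1,3)[OF Y]] by metis
  have "(\<Sum>(x, y)\<leftarrow>qs. B x y) = (\<Sum>(x, y)\<leftarrow>ps. B x y)"
  proof (rule ccontr)
    assume ne: "(\<Sum>(x, y)\<leftarrow>qs. B x y) \<noteq> (\<Sum>(x, y)\<leftarrow>ps. B x y)"
    define d where "d = (\<Sum>(x, y)\<leftarrow>qs. B x y) - (\<Sum>(x, y)\<leftarrow>ps. B x y)"
    have "d \<notin> {0}" using ne by (simp add: d_def)
    moreover have "z.subspace {0}" by simp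
    ultimately obtain h where h: "Vector_Spaces.linear (smul Z) (*) h" "h d = 1"
      using functional_on_subspace[OF z.vector_space_axioms] by metis
    note hl = h(1)[unfolded Vector_Spaces.linear_iff] and pl = p(1)[unfolded Vector_Spaces.linear_iff]
      and ql = q(1)[unfolded Vector_Spaces.linear_iff]
    have h_add: "h (u + v) = h u + h v" for u v
      using hl by blast
    have h0: "h 0 = 0"
      using h_add[of 0 0] by (metis add_0_right add_left_cancel)
    define b where "b = (\<lambda>x y. h (B (p x) (q y)))"
    have k: "vector_space ((*) :: 'k \<Rightarrow> 'k \<Rightarrow> 'k)"
      by unfold_locales (auto simp: algebra_simps)
    have "Vector_Spaces.linear (smul Y) (*) (b x)" for x
      unfolding Vector_Spaces.linear_iff using B1[OF p(2)[of x]] q(2) k hl ql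
      by (simp add: b_def lin_on_def)
    moreover have "Vector_Spaces.linear (smul X) (*) (\<lambda>x. b x y)" for y
      unfolding Vector_Spaces.linear_iff using B2[OF q(2)[of y]] p(2) k hl pl
      by (simp add: b_def lin_on_def)
    ultimately have b: "bilinear_form (smul X) (smul Y) b"
      by (simp add: bilinear_form_def)
    have ev: "(\<Sum>(x, y)\<leftarrow>rs. tens X Y x y) b = h (\<Sum>(x, y)\<leftarrow>rs. B x y)"
      if "set rs \<subseteq> carrier X \<times> carrier Y" for rs
      using that by (induction rs) (auto simp: tens_def b[unfolded b_def] h_add h0 b_def p(3) q(3))
    have "h (\<Sum>(x, y)\<leftarrow>qs. B x y) = h (\<Sum>(x, y)\<leftarrow>ps. B x y)"
      using ev[OF ps] ev[OF qs(1)] qs(2) by simp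
    moreover have "h (\<Sum>(x, y)\<leftarrow>qs. B x y) = h d + h (\<Sum>(x, y)\<leftarrow>ps. B x y)"
      by (simp add: d_def flip: h_add)
    ultimately show False using h(2) by simp
  qed
  then show ?thesis
    unfolding tlift_def qs_def[symmetric] Let_def by simp
qed


section \<open>Coalgebras and comodules\<close>

record ('k, 'c) coalg = "('k, 'c) space" +
  comult :: "'c \<Rightarrow> ('c \<Rightarrow> 'c \<Rightarrow> 'k) \<Rightarrow> 'k"
  counit :: "'c \<Rightarrow> 'k"

record ('k, 'c, 'm) rcomod = "('k, 'm) space" +
  rcoact :: "'m \<Rightarrow> ('m \<Rightarrow> 'c \<Rightarrow> 'k) \<Rightarrow> 'k"

record ('k, 'c, 'm) lcomod = "('k, 'm) space" +
  lcoact :: "'m \<Rightarrow> ('c \<Rightarrow> 'm \<Rightarrow> 'k) \<Rightarrow> 'k"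

text \<open>
  Both sides of coassociativity are compared in \<open>C \<otimes> (C \<otimes> C)\<close>, resp.\
  \<open>M \<otimes> (C \<otimes> C)\<close> and \<open>C \<otimes> (C \<otimes> M)\<close>.
\<close>

definition coalgebra :: "('k::field, 'c::ab_group_add) coalg \<Rightarrow> bool" where
  "coalgebra C \<longleftrightarrow> vspace C \<and> lin_on C (tensor C C) (comult C) \<and> lin_on C kspace (counit C)
     \<and> (\<forall>c\<in>carrier C.
          tlift C C (\<lambda>u v. tens C (tensor C C) u (comult C v)) (comult C c)
        = tlift C C (\<lambda>u v. tlift C C (\<lambda>u1 u2. tens C (tensor C C) u1 (tens C C u2 v)) (comult C u))
            (comult C c))
     \<and> (\<forall>c\<in>carrier C. tlift C C (\<lambda>u v. smul C (counit C u) v) (comult C c) = c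
                    \<and> tlift C C (\<lambda>u v. smul C (counit C v) u) (comult C c) = c)"

definition right_comodule ::
  "('k::field, 'c::ab_group_add) coalg \<Rightarrow> ('k, 'c, 'm::ab_group_add) rcomod \<Rightarrow> bool" where
  "right_comodule C M \<longleftrightarrow> vspace M \<and> lin_on M (tensor M C) (rcoact M)
     \<and> (\<forall>x\<in>carrier M.
          tlift M C (\<lambda>y c. tens M (tensor C C) y (comult C c)) (rcoact M x)
        = tlift M C (\<lambda>y c. tlift M C (\<lambda>y1 c1. tens M (tensor C C) y1 (tens C C c1 c)) (rcoact M y))
            (rcoact M x))
     \<and> (\<forall>x\<in>carrier M. tlift M C (\<lambda>y c. smul M (counit C c) y) (rcoact M x) = x)"

definition left_comodule ::
  "('k::field, 'c::ab_group_add) coalg \<Rightarrow> ('k, 'c, 'm::ab_group_add) lcomod \<Rightarrow> bool" where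
  "left_comodule C M \<longleftrightarrow> vspace M \<and> lin_on M (tensor C M) (lcoact M)
     \<and> (\<forall>x\<in>carrier M.
          tlift C M (\<lambda>c y. tens C (tensor C M) c (lcoact M y)) (lcoact M x)
        = tlift C M (\<lambda>c y. tlift C C (\<lambda>c1 c2. tens C (tensor C M) c1 (tens C M c2 y)) (comult C c))
            (lcoact M x))
     \<and> (\<forall>x\<in>carrier M. tlift C M (\<lambda>c y. smul M (counit C c) y) (lcoact M x) = x)"

definition rcomod_hom ::
  "('k::field, 'c::ab_group_add) coalg \<Rightarrow> ('k, 'c, 'm::ab_group_add) rcomod
    \<Rightarrow> ('k, 'c, 'n::ab_group_add) rcomod \<Rightarrow> ('m \<Rightarrow> 'n) \<Rightarrow> bool" where
  "rcomod_hom C M N f \<longleftrightarrow> lin_on M N f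
     \<and> (\<forall>x\<in>carrier M. rcoact N (f x) = tlift M C (\<lambda>y c. tens N C (f y) c) (rcoact M x))"

definition lcomod_hom ::
  "('k::field, 'c::ab_group_add) coalg \<Rightarrow> ('k, 'c, 'm::ab_group_add) lcomod
    \<Rightarrow> ('k, 'c, 'n::ab_group_add) lcomod \<Rightarrow> ('m \<Rightarrow> 'n) \<Rightarrow> bool" where
  "lcomod_hom C M N f \<longleftrightarrow> lin_on M N f
     \<and> (\<forall>x\<in>carrier M. lcoact N (f x) = tlift C M (\<lambda>c y. tens C N c (f y)) (lcoact M x))"

definition lcomod_iso ::
  "('k::field, 'c::ab_group_add) coalg \<Rightarrow> ('k, 'c, 'm::ab_group_add) lcomod
    \<Rightarrow> ('k, 'c, 'n::ab_group_add) lcomod \<Rightarrow> ('m \<Rightarrow> 'n) \<Rightarrow> bool" where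
  "lcomod_iso C M N f \<longleftrightarrow> left_comodule C M \<and> left_comodule C N
     \<and> lcomod_hom C M N f \<and> bij_betw f (carrier M) (carrier N)"

definition Hom ::
  "('k::field, 'c::ab_group_add) coalg \<Rightarrow> ('k, 'c, 'm::ab_group_add) rcomod
    \<Rightarrow> ('k, 'c, 'n::ab_group_add) rcomod \<Rightarrow> ('k, 'm \<Rightarrow> 'n) space" where
  "Hom C M N = \<lparr>carrier = {f. rcomod_hom C M N f \<and> res (carrier M) f = f}, smul = pw (smul N)\<rparr>"


subsection \<open>Subcoalgebras and subcomodules\<close>

text \<open>
  A subcoalgebra is given by its carrier \<open>L\<close>; \<open>sub C L\<close> is the subspace (and coalgebra)
  \<open>L\<close>. A comodule over \<open>sub C L\<close> is the same record as a comodule over \<open>C\<close> whose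
  coaction happens to take values in \<open>M \<otimes> L\<close>.
\<close>

abbreviation sub :: "('k, 'a, 'r) space_scheme \<Rightarrow> 'a set \<Rightarrow> ('k, 'a, 'r) space_scheme" where
  "sub X V \<equiv> X\<lparr>carrier := V\<rparr>"

definition fd_subcoalgebras :: "('k::field, 'c::ab_group_add) coalg \<Rightarrow> 'c set set" where
  "fd_subcoalgebras C = {L. L \<subseteq> carrier C \<and> module.subspace (smul C) L
     \<and> (\<forall>c\<in>L. comult C c \<in> carrier (tensor (sub C L) (sub C L))) \<and> findim (sub C L)}"

definition cf :: "('k::field, 'c::ab_group_add) coalg \<Rightarrow> ('k, 'c, 'm::ab_group_add) rcomod
    \<Rightarrow> 'c set" where
  "cf C M = \<Inter> {V. V \<subseteq> carrier C \<and> module.subspace (smul C) V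
     \<and> (\<forall>x\<in>carrier M. rcoact M x \<in> carrier (tensor M (sub C V)))}"

definition subcomodule ::
  "('k::field, 'c::ab_group_add) coalg \<Rightarrow> ('k, 'c, 'm::ab_group_add) rcomod \<Rightarrow> 'm set \<Rightarrow> bool" where
  "subcomodule C M N \<longleftrightarrow> N \<subseteq> carrier M \<and> module.subspace (smul M) N
     \<and> (\<forall>x\<in>N. rcoact M x \<in> carrier (tensor (sub M N) C))"

definition indecomposable ::
  "('k::field, 'c::ab_group_add) coalg \<Rightarrow> ('k, 'c, 'm::ab_group_add) rcomod \<Rightarrow> bool" where
  "indecomposable C M \<longleftrightarrow> carrier M \<noteq> {0}
     \<and> (\<forall>N1 N2. subcomodule C M N1 \<and> subcomodule C M N2 \<and> N1 \<inter> N2 = {0}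
          \<and> {x + y | x y. x \<in> N1 \<and> y \<in> N2} = carrier M \<longrightarrow> N1 = {0} \<or> N2 = {0})"

text \<open>
  Finite-dimensional comodules are tested on the type \<open>nat \<Rightarrow> 'k\<close>, which contains an
  isomorphic copy of each of them.
\<close>

definition quasifinite ::
  "('k::field, 'c::ab_group_add) coalg \<Rightarrow> ('k, 'c, 'm::ab_group_add) rcomod \<Rightarrow> bool" where
  "quasifinite C M \<longleftrightarrow>
     (\<forall>F :: ('k, 'c, nat \<Rightarrow> 'k) rcomod. right_comodule C F \<and> findim F \<longrightarrow> findim (Hom C F M))"

text \<open>
  HOL cannot quantify over all comodules at once, since their types vary. The test comodules
  \<open>N\<close>, \<open>N'\<close> range over the type of \<open>I \<otimes> C\<close>. This loses nothing: the coaction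
  embeds \<open>I\<close> into the cofree comodule \<open>I \<otimes> C\<close>, and extending the inverse of this
  embedding exhibits \<open>I\<close> as a direct summand of \<open>I \<otimes> C\<close>, so that \<open>I\<close> has the
  extension property for comodules over every type.
\<close>

definition injective_comodule ::
  "('k::field, 'c::ab_group_add) coalg \<Rightarrow> ('k, 'c, 'm::ab_group_add) rcomod \<Rightarrow> bool" where
  "injective_comodule C I \<longleftrightarrow> right_comodule C I
     \<and> (\<forall>(N :: ('k, 'c, ('m, 'c, 'k) tensor) rcomod) (N' :: ('k, 'c, ('m, 'c, 'k) tensor) rcomod) u f.
          right_comodule C N \<and> right_comodule C N'
          \<and> rcomod_hom C N N' u \<and> inj_on u (carrier N) \<and> rcomod_hom C N I f
          \<longrightarrow> (\<exists>g. rcomod_hom C N' I g \<and> (\<forall>x\<in>carrier N. g (u x) = f x)))"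

definition qf_inj_copresentation ::
  "('k::field, 'c::ab_group_add) coalg \<Rightarrow> ('k, 'c, 'm::ab_group_add) rcomod \<Rightarrow> ('m \<Rightarrow> 'i)
    \<Rightarrow> ('k, 'c, 'i::ab_group_add) rcomod \<Rightarrow> ('i \<Rightarrow> 'j)
    \<Rightarrow> ('k, 'c, 'j::ab_group_add) rcomod \<Rightarrow> bool" where
  "qf_inj_copresentation C M e I0 d I1 \<longleftrightarrow> right_comodule C M
     \<and> quasifinite C I0 \<and> injective_comodule C I0 \<and> quasifinite C I1 \<and> injective_comodule C I1
     \<and> rcomod_hom C M I0 e \<and> rcomod_hom C I0 I1 d
     \<and> inj_on e (carrier M) \<and> e ` carrier M = {x \<in> carrier I0. d x = 0}"


section \<open>Direct limits\<close>

text \<open>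
  A direct system over the directed set \<open>D\<close> has objects \<open>X i\<close> and maps \<open>t i j\<close>
  for \<open>i \<le> j\<close>. Its limit is realised inside the dual of the space of compatible families
  \<open>F\<close> of functionals on the \<open>X i\<close> (again an embedding, since the scalars form a field);
  \<open>lim_in D X t i x\<close> is the class of \<open>x \<in> X i\<close>. That this is the usual direct limit
  is lemma \<open>lim_in_eq_iff\<close> below: every element is a class, and two classes agree iff their
  representatives become equal at some later stage.
\<close>

definition direct_system ::
  "('k::field, 'c::ab_group_add) coalg \<Rightarrow> 'i::order set
    \<Rightarrow> ('i \<Rightarrow> ('k, 'c, 'x::ab_group_add) lcomod) \<Rightarrow> ('i \<Rightarrow> 'i \<Rightarrow> 'x \<Rightarrow> 'x) \<Rightarrow> bool" where
  "direct_system C D X t \<longleftrightarrow> D \<noteq> {} \<and> (\<forall>i\<in>D. \<forall>j\<in>D. \<exists>k\<in>D. i \<le> k \<and> j \<le> k)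
     \<and> (\<forall>i\<in>D. left_comodule C (X i))
     \<and> (\<forall>i\<in>D. \<forall>j\<in>D. i \<le> j \<longrightarrow> lcomod_hom C (X i) (X j) (t i j))
     \<and> (\<forall>i\<in>D. \<forall>x\<in>carrier (X i). t i i x = x)
     \<and> (\<forall>i\<in>D. \<forall>j\<in>D. \<forall>k\<in>D. \<forall>x\<in>carrier (X i). i \<le> j \<longrightarrow> j \<le> k \<longrightarrow> t j k (t i j x) = t i k x)"

definition compatible ::
  "'i::order set \<Rightarrow> ('i \<Rightarrow> ('k::field, 'c::ab_group_add, 'x::ab_group_add) lcomod)
    \<Rightarrow> ('i \<Rightarrow> 'i \<Rightarrow> 'x \<Rightarrow> 'x) \<Rightarrow> ('i \<Rightarrow> 'x \<Rightarrow> 'k) \<Rightarrow> bool" where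
  "compatible D X t F \<longleftrightarrow> (\<forall>i\<in>D. lin_on (X i) kspace (F i))
     \<and> (\<forall>i\<in>D. \<forall>j\<in>D. \<forall>x\<in>carrier (X i). i \<le> j \<longrightarrow> F j (t i j x) = F i x)"

definition lim_in ::
  "'i::order set \<Rightarrow> ('i \<Rightarrow> ('k::field, 'c::ab_group_add, 'x::ab_group_add) lcomod)
    \<Rightarrow> ('i \<Rightarrow> 'i \<Rightarrow> 'x \<Rightarrow> 'x) \<Rightarrow> 'i \<Rightarrow> 'x \<Rightarrow> ('i \<Rightarrow> 'x \<Rightarrow> 'k) \<Rightarrow> 'k" where
  "lim_in D X t i x = (\<lambda>F. if compatible D X t F then F i x else 0)"

definition lim_space ::
  "'i::order set \<Rightarrow> ('i \<Rightarrow> ('k::field, 'c::ab_group_add, 'x::ab_group_add) lcomod)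
    \<Rightarrow> ('i \<Rightarrow> 'i \<Rightarrow> 'x \<Rightarrow> 'x) \<Rightarrow> ('k, ('i \<Rightarrow> 'x \<Rightarrow> 'k) \<Rightarrow> 'k) space" where
  "lim_space D X t =
     \<lparr>carrier = {lim_in D X t i x | i x. i \<in> D \<and> x \<in> carrier (X i)}, smul = pw (*)\<rparr>"

definition lim_lift ::
  "'i::order set \<Rightarrow> ('i \<Rightarrow> ('k::field, 'c::ab_group_add, 'x::ab_group_add) lcomod)
    \<Rightarrow> ('i \<Rightarrow> 'i \<Rightarrow> 'x \<Rightarrow> 'x) \<Rightarrow> ('i \<Rightarrow> 'x \<Rightarrow> 'z) \<Rightarrow> (('i \<Rightarrow> 'x \<Rightarrow> 'k) \<Rightarrow> 'k) \<Rightarrow> 'z" where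
  "lim_lift D X t g y =
     (THE z. \<exists>i\<in>D. \<exists>x\<in>carrier (X i). y = lim_in D X t i x \<and> z = g i x)"

definition dirlim ::
  "('k::field, 'c::ab_group_add) coalg \<Rightarrow> 'i::order set
    \<Rightarrow> ('i \<Rightarrow> ('k, 'c, 'x::ab_group_add) lcomod) \<Rightarrow> ('i \<Rightarrow> 'i \<Rightarrow> 'x \<Rightarrow> 'x)
    \<Rightarrow> ('k, 'c, ('i \<Rightarrow> 'x \<Rightarrow> 'k) \<Rightarrow> 'k) lcomod" where
  "dirlim C D X t =
     \<lparr>carrier = carrier (lim_space D X t), smul = smul (lim_space D X t),
      lcoact = lim_lift D X t (\<lambda>i x.
        tlift C (X i) (\<lambda>c z. tens C (lim_space D X t) c (lim_in D X t i z)) (lcoact (X i) x))\<rparr>"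

lemma vector_space_fun:
  assumes "\<And>i. vector_space (s i)"
  shows "vector_space (\<lambda>a g i. s i a (g i))"
proof -
  interpret vector_space "s i" for i by fact
  show ?thesis
    by unfold_locales (auto simp: fun_eq_iff scale_right_distrib scale_left_distrib)
qed

lemma lim_in_eq_iff:
  fixes X :: "'i::order \<Rightarrow> ('k::field, 'c::ab_group_add, 'x::ab_group_add) lcomod"
  assumes sys: "direct_system C D X t"
    and i: "i \<in> D" "x \<in> carrier (X i)" and j: "j \<in> D" "y \<in> carrier (X j)"
  shows "lim_in D X t i x = lim_in D X t j y \<longleftrightarrow> (\<exists>k\<in>D. i \<le> k \<and> j \<le> k \<and> t i k x = t j k y)"
proof
  assume "\<exists>k\<in>D. i \<le> k \<and> j \<le> k \<and> t i k x = t j k y"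
  then obtain k where k: "k \<in> D" "i \<le> k" "j \<le> k" "t i k x = t j k y" by blast
  then have "F i x = F j y" if "compatible D X t F" for F
    using that i j unfolding compatible_def by metis
  then show "lim_in D X t i x = lim_in D X t j y"
    by (auto simp: lim_in_def)
next
  assume eq: "lim_in D X t i x = lim_in D X t j y"
  have vs: "vspace (X k)" if "k \<in> D" for k
    using sys that by (auto simp: direct_system_def left_comodule_def)
  have lin: "lin_on (X k) (X l) (t k l)" if "k \<in> D" "l \<in> D" "k \<le> l" for k l
    using sys that by (auto simp: direct_system_def lcomod_hom_def)
  have t_id: "t k k z = z" if "k \<in> D" "z \<in> carrier (X k)" for k z
    using sys that by (auto simp: direct_system_def)
  have t_comp: "t l m (t k l z) = t k m z"
    if "k \<in> D" "l \<in> D" "m \<in> D" "z \<in> carrier (X k)" "k \<le> l" "l \<le> m" for k l m z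
    using sys that by (auto simp: direct_system_def)
  have dir: "\<exists>m\<in>D. k \<le> m \<and> l \<le> m" if "k \<in> D" "l \<in> D" for k l
    using sys that by (auto simp: direct_system_def)
  define s where "s = (\<lambda>k. smul (X (if k \<in> D then k else i)))"
  define S where "S = (\<lambda>a (g :: 'i \<Rightarrow> 'x) k. s k a (g k))"
  have sv: "vector_space (s k)" for k
    using vs i by (auto simp: s_def vspaceD)
  have SD: "S a g k = smul (X k) a (g k)" if "k \<in> D" for a g k
    using that by (simp add: S_def s_def)
  interpret S: vector_space S
    unfolding S_def by (rule vector_space_fun) (rule sv)
  interpret sk: vector_space "s k" for k by (rule sv)
  have sub: "0 \<in> carrier (X k)"
      "z \<in> carrier (X k) \<Longrightarrow> w \<in> carrier (X k) \<Longrightarrow> z + w \<in> carrier (X k)"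
      "z \<in> carrier (X k) \<Longrightarrow> smul (X k) a z \<in> carrier (X k)" if "k \<in> D" for k z w a
    using vspaceD(3)[OF vs[OF that]] vspaceD(2)[OF vs[OF that]]
    by (auto simp: module.subspace_def)
  have t0: "t k l 0 = 0" if "k \<in> D" "l \<in> D" "k \<le> l" for k l
  proof -
    have "t k l (0 + 0) = t k l 0 + t k l 0"
      using lin[OF that] sub(1)[OF that(1)] unfolding lin_on_def by blast
    then show ?thesis by simp
  qed
  \<comment> \<open>the relations: finite families that sum to zero at some stage\<close>
  define P where "P = (\<lambda>g A m. finite A \<and> A \<subseteq> D \<and> m \<in> D \<and> (\<forall>k\<in>A. k \<le> m \<and> g k \<in> carrier (X k))
    \<and> (\<forall>k. k \<notin> A \<longrightarrow> g k = 0) \<and> (\<Sum>k\<in>A. t k m (g k)) = 0)"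
  define R where "R = {g. \<exists>A m. P g A m}"
  have P_mono: "P g A' m'" if P: "P g A m" and A': "finite A'" "A \<subseteq> A'" "A' \<subseteq> D"
    "m' \<in> D" "m \<le> m'" "\<forall>k\<in>A'. k \<le> m'" for g A m A' m'
  proof -
    have gk: "g k \<in> carrier (X k)" if "k \<in> A'" for k
      using P A' that sub(1)[of k] by (cases "k \<in> A") (auto simp: P_def)
    have m: "m \<in> D" using P by (simp add: P_def)
    have "(\<Sum>k\<in>A'. t k m' (g k)) = (\<Sum>k\<in>A. t k m' (g k))"
      using A' P by (intro sum.mono_neutral_right) (auto simp: P_def subset_iff intro!: t0)
    also have "\<dots> = (\<Sum>k\<in>A. t m m' (t k m (g k)))"
      using A' P by (intro sum.cong) (auto simp: P_def subset_iff t_comp)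
    also have "\<dots> = t m m' (\<Sum>k\<in>A. t k m (g k))"
    proof -
      have A: "finite A" "\<forall>k\<in>A. t k m (g k) \<in> carrier (X m)"
        using P lin unfolding P_def lin_on_def by (auto simp: subset_iff)
      then have "(\<Sum>k\<in>A. t m m' (t k m (g k))) = t m m' (\<Sum>k\<in>A. t k m (g k))
          \<and> (\<Sum>k\<in>A. t k m (g k)) \<in> carrier (X m)"
        using lin[of m m'] m A'
        by (induction A rule: finite_induct) (auto simp: sub t0 lin_on_def)
      then show ?thesis by simp
    qed
    also have "\<dots> = 0" using P A' m by (simp add: P_def t0)
    finally show ?thesis
      using gk P A' by (auto simp: P_def subset_iff)
  qed
  have RS: "S.subspace R"
    unfolding S.subspace_def
  proof (intro conjI ballI allI)
    show "0 \<in> R" using i by (auto simp: R_def P_def intro!: exI[of _ "{}"])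
  next
    fix g g' assume "g \<in> R" "g' \<in> R"
    then obtain A m A' m' where P: "P g A m" "P g' A' m'" by (auto simp: R_def)
    then obtain n where n: "n \<in> D" "m \<le> n" "m' \<le> n"
      using dir[of m m'] by (auto simp: P_def)
    have fin: "finite (A \<union> A')" "A \<union> A' \<subseteq> D" "\<forall>k\<in>A \<union> A'. k \<le> n"
      using P n by (auto simp: P_def)
    then have 1: "P g (A \<union> A') n" and 2: "P g' (A \<union> A') n"
      using P_mono[OF P(1), of "A \<union> A'" n] P_mono[OF P(2), of "A \<union> A'" n] n by auto
    have "(\<Sum>k\<in>A \<union> A'. t k n (g k + g' k)) = (\<Sum>k\<in>A \<union> A'. t k n (g k) + t k n (g' k))"
      using 1 2 lin n fin unfolding P_def lin_on_def
      by (intro sum.cong) (auto simp: subset_iff)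
    also have "\<dots> = 0"
      using 1 2 by (simp add: P_def sum.distrib)
    finally have "P (g + g') (A \<union> A') n"
      using 1 2 sub by (auto simp: P_def)
    then show "g + g' \<in> R" by (auto simp: R_def)
  next
    fix a g assume "g \<in> R"
    then obtain A m where P: "P g A m" by (auto simp: R_def)
    have "(\<Sum>k\<in>A. t k m (S a g k)) = (\<Sum>k\<in>A. s m a (t k m (g k)))"
    proof (rule sum.cong)
      fix k assume k: "k \<in> A"
      then have k': "k \<in> D" "m \<in> D" "k \<le> m" "g k \<in> carrier (X k)"
        using P by (auto simp: P_def)
      then have "t k m (smul (X k) a (g k)) = smul (X m) a (t k m (g k))"
        using lin[of k m] unfolding lin_on_def by blast
      then show "t k m (S a g k) = s m a (t k m (g k))"
        using k' by (simp add: SD s_def)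
    qed simp
    also have "\<dots> = s m a (\<Sum>k\<in>A. t k m (g k))"
      by (simp add: sk.scale_sum_right)
    also have "\<dots> = 0" using P by (simp add: P_def)
    finally have sum0: "(\<Sum>k\<in>A. t k m (S a g k)) = 0" .
    have mem: "S a g k \<in> carrier (X k)" if "k \<in> A" for k
      using P that SD[of k a g] sub(3)[of k "g k" a] by (auto simp: P_def)
    have out: "S a g k = 0" if "k \<notin> A" for k
      using P that by (simp add: P_def S_def)
    have "P (S a g) A m"
      unfolding P_def using P sum0 mem out by (simp add: P_def)
    then show "S a g \<in> R" by (auto simp: R_def)
  qed
  define e where "e = (\<lambda>(k :: 'i) (z :: 'x) l. if l = k then z else 0)"
  have e_rel: "e k z - e l (t k l z) \<in> R" if "k \<in> D" "l \<in> D" "k \<le> l" "z \<in> carrier (X k)" for k l z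
  proof (cases "k = l")
    case True
    then show ?thesis
      using t_id[of k z] that S.subspace_0[OF RS] by simp
  next
    case False
    have tz: "t k l z \<in> carrier (X l)"
      using lin[OF that(1-3)] that(4) by (simp add: lin_on_def)
    have m: "- t k l z = smul (X l) (- 1) (t k l z)"
      using sk.scale_minus_left[of l 1 "t k l z"] sk.scale_one[of l "t k l z"] that by (simp add: s_def)
    have "- t k l z \<in> carrier (X l)"
      unfolding m by (rule sub(3)[OF that(2) tz])
    then have "P (e k z - e l (t k l z)) {k, l} l"
      using that False by (auto simp: P_def e_def t_id)
    then show ?thesis by (auto simp: R_def)
  qed
  have e_add: "e k (z + w) = e k z + e k w" for k z w
    by (auto simp: e_def fun_eq_iff)
  have e_scale: "e k (smul (X k) a z) = S a (e k z)" if "k \<in> D" for k a z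
  proof
    fix l
    show "e k (smul (X k) a z) l = S a (e k z) l"
      using that SD[of k a "e k z"] by (cases "l = k") (simp_all add: e_def S_def)
  qed
  obtain k where k: "k \<in> D" "i \<le> k" "j \<le> k" using dir i j by blast
  show "\<exists>k\<in>D. i \<le> k \<and> j \<le> k \<and> t i k x = t j k y"
  proof (cases "e i x - e j y \<in> R")
    case True
    then obtain A m where P: "P (e i x - e j y) A m" by (auto simp: R_def)
    then obtain n where n: "n \<in> D" "m \<le> n" "k \<le> n"
      using dir[of m k] k by (auto simp: P_def)
    have nn: "i \<le> n" "j \<le> n" using n k by (meson order_trans)+
    have "\<forall>l\<in>A. l \<le> n" using P n unfolding P_def by (meson order_trans)
    then have P': "P (e i x - e j y) (A \<union> {i, j}) n"
      using P_mono[OF P, of "A \<union> {i, j}" n] P n nn i j by (auto simp: P_def)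
    let ?g = "e i x - e j y"
    have A: "finite (A \<union> {i, j})" using P by (simp add: P_def)
    have AD: "l \<in> D" "l \<le> n" if "l \<in> A \<union> {i, j}" for l
      using P' that by (auto simp: P_def)
    have "t i n x = t j n y"
    proof (cases "i = j")
      case True
      have "(\<Sum>l\<in>A \<union> {i, j}. t l n (?g l)) = (\<Sum>l\<in>{i}. t l n (?g l))"
        using A AD n True by (intro sum.mono_neutral_right) (auto simp: e_def intro!: t0)
      then have z: "t i n (x - y) = 0"
        using P' True by (simp add: P_def e_def)
      have "x - y \<in> carrier (X i)"
        using P' True by (auto simp: P_def e_def)
      then have "t i n ((x - y) + y) = t i n (x - y) + t i n y"
        using lin[OF i(1) n(1) nn(1)] j True unfolding lin_on_def by blast
      then show ?thesis using z True by simp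
    next
      case False
      have "(\<Sum>l\<in>A \<union> {i, j}. t l n (?g l)) = (\<Sum>l\<in>{i, j}. t l n (?g l))"
        using A AD n by (intro sum.mono_neutral_right) (auto simp: e_def intro!: t0)
      then have z: "t i n x + t j n (- y) = 0"
        using P' False by (simp add: P_def e_def)
      have "- y \<in> carrier (X j)"
        using P' False by (auto simp: P_def e_def)
      then have "t j n (- y + y) = t j n (- y) + t j n y"
        using lin[OF j(1) n(1) nn(2)] j unfolding lin_on_def by blast
      then have "t j n (- y) + t j n y = 0"
        using t0[OF j(1) n(1) nn(2)] by simp
      then show ?thesis using z by (metis add.commute add_left_imp_eq)
    qed
    then show ?thesis using n nn by blast
  next
    case False
    obtain h where h: "Vector_Spaces.linear S (*) h" "\<And>r. r \<in> R \<Longrightarrow> h r = 0"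
        "h (e i x - e j y) = 1"
      using functional_on_subspace[OF S.vector_space_axioms RS False] by metis
    interpret h: Vector_Spaces.linear S "(*)" h by fact
    define F where "F = (\<lambda>k z. h (e k z))"
    have "compatible D X t F"
      unfolding compatible_def
    proof (intro conjI ballI impI)
      fix k assume "k \<in> D"
      then show "lin_on (X k) kspace (F k)"
        by (auto simp: lin_on_def F_def e_add e_scale h.add h.scale)
    next
      fix k l z assume "k \<in> D" "l \<in> D" "z \<in> carrier (X k)" "k \<le> l"
      then have "h (e k z - e l (t k l z)) = 0" using e_rel h(2) by blast
      then show "F l (t k l z) = F k z" by (simp add: F_def h.diff)
    qed
    then have "F i x = F j y"
      using fun_cong[OF eq, of F] by (simp add: lim_in_def)
    then show ?thesis using h(3) by (simp add: F_def h.diff)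
  qed
qed


section \<open>The functor \<open>*\<close> and the transpose\<close>

text \<open>\<open>DHom C M L\<close> is \<open>D Hom(L, M)\<close> for a finite-dimensional subcoalgebra \<open>L\<close> of \<open>C\<close>.\<close>

definition regular :: "('k::field, 'c::ab_group_add) coalg \<Rightarrow> 'c set \<Rightarrow> ('k, 'c, 'c) rcomod" where
  "regular C L = \<lparr>carrier = L, smul = smul C, rcoact = comult C\<rparr>"

text \<open>
  The left coaction of \<open>L\<close> on itself makes \<open>Hom(L, M)\<close> a left module over the dual
  algebra of \<open>L\<close> by \<open>(a f) x = \<Sum> a(x1) f(x2)\<close>, hence \<open>D Hom(L, M)\<close> a right module
  by \<open>(p a) f = p (a f)\<close>. As \<open>L\<close> is finite-dimensional, this is the same as a left
  comodule: the coaction sends \<open>p\<close> to the unique \<open>\<Sum> c \<otimes> q\<close> in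
  \<open>L \<otimes> D Hom(L, M)\<close> with \<open>\<Sum> a(c) q = p a\<close> for all \<open>a\<close>.
\<close>

definition act ::
  "('k::field, 'c::ab_group_add) coalg \<Rightarrow> ('k, 'c, 'm::ab_group_add) rcomod \<Rightarrow> 'c set
    \<Rightarrow> ('c \<Rightarrow> 'k) \<Rightarrow> ('c \<Rightarrow> 'm) \<Rightarrow> 'c \<Rightarrow> 'm" where
  "act C M L a f =
     res L (\<lambda>x. tlift (sub C L) (sub C L) (\<lambda>u v. smul M (a u) (f v)) (comult C x))"

definition DHom ::
  "('k::field, 'c::ab_group_add) coalg \<Rightarrow> ('k, 'c, 'm::ab_group_add) rcomod \<Rightarrow> 'c set
    \<Rightarrow> ('k, 'c, ('c \<Rightarrow> 'm) \<Rightarrow> 'k) lcomod" where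
  "DHom C M L =
     (let H = Hom C (regular C L) M; V = Dual H
      in \<lparr>carrier = carrier V, smul = smul V,
          lcoact = (\<lambda>p. THE w. w \<in> carrier (tensor (sub C L) V)
            \<and> (\<forall>a\<in>carrier (Dual (sub C L)).
                 tlift (sub C L) V (\<lambda>c q. smul V (a c) q) w
               = res (carrier H) (\<lambda>f. p (act C M L a f))))\<rparr>)"

definition DHom_trans ::
  "('k::field, 'c::ab_group_add) coalg \<Rightarrow> ('k, 'c, 'm::ab_group_add) rcomod \<Rightarrow> 'c set \<Rightarrow> 'c set
    \<Rightarrow> (('c \<Rightarrow> 'm) \<Rightarrow> 'k) \<Rightarrow> ('c \<Rightarrow> 'm) \<Rightarrow> 'k" where
  "DHom_trans C M L L' p = res (carrier (Hom C (regular C L') M)) (\<lambda>f. p (res L f))"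

definition star ::
  "('k::field, 'c::ab_group_add) coalg \<Rightarrow> ('k, 'c, 'm::ab_group_add) rcomod
    \<Rightarrow> ('k, 'c, ('c set \<Rightarrow> (('c \<Rightarrow> 'm) \<Rightarrow> 'k) \<Rightarrow> 'k) \<Rightarrow> 'k) lcomod" where
  "star C M = dirlim C (fd_subcoalgebras C) (DHom C M) (DHom_trans C M)"

definition star_map ::
  "('k::field, 'c::ab_group_add) coalg \<Rightarrow> ('k, 'c, 'm::ab_group_add) rcomod
    \<Rightarrow> ('k, 'c, 'n::ab_group_add) rcomod \<Rightarrow> ('m \<Rightarrow> 'n)
    \<Rightarrow> (('c set \<Rightarrow> (('c \<Rightarrow> 'n) \<Rightarrow> 'k) \<Rightarrow> 'k) \<Rightarrow> 'k) \<Rightarrow> ('c set \<Rightarrow> (('c \<Rightarrow> 'm) \<Rightarrow> 'k) \<Rightarrow> 'k) \<Rightarrow> 'k" where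
  "star_map C M N f = lim_lift (fd_subcoalgebras C) (DHom C N) (DHom_trans C N)
     (\<lambda>L p. lim_in (fd_subcoalgebras C) (DHom C M) (DHom_trans C M) L
        (res (carrier (Hom C (regular C L) M)) (\<lambda>g. p (res L (f \<circ> g)))))"

text \<open>
  The copresentation used is not required to be minimal, so the transpose depends on it
  (up to injective direct summands) and takes it as an argument.
\<close>

definition Tr ::
  "('k::field, 'c::ab_group_add) coalg \<Rightarrow> ('k, 'c, 'i::ab_group_add) rcomod \<Rightarrow> ('i \<Rightarrow> 'j)
    \<Rightarrow> ('k, 'c, 'j::ab_group_add) rcomod
    \<Rightarrow> ('k, 'c, ('c set \<Rightarrow> (('c \<Rightarrow> 'j) \<Rightarrow> 'k) \<Rightarrow> 'k) \<Rightarrow> 'k) lcomod" where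
  "Tr C I0 d I1 = sub (star C I1) {y \<in> carrier (star C I1). star_map C I0 I1 d y = 0}"


section \<open>Restriction to a subcoalgebra\<close>

text \<open>
  The largest subcomodule of \<open>M\<close> that is a comodule over \<open>L\<close> (a copy of the cotensor
  product of \<open>M\<close> with \<open>L\<close>).
\<close>

definition rpart ::
  "('k::field, 'c::ab_group_add) coalg \<Rightarrow> 'c set \<Rightarrow> ('k, 'c, 'm::ab_group_add) rcomod
    \<Rightarrow> ('k, 'c, 'm) rcomod" where
  "rpart C L M = sub M {x \<in> carrier M. rcoact M x \<in> carrier (tensor M (sub C L))}"

text \<open>The cotensor product over \<open>C\<close> of \<open>L\<close> with a left comodule \<open>T\<close>, inside \<open>L \<otimes> T\<close>.\<close>

definition cotensor ::
  "('k::field, 'c::ab_group_add) coalg \<Rightarrow> 'c set \<Rightarrow> ('k, 'c, 't::ab_group_add) lcomod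
    \<Rightarrow> ('k, 'c, ('c, 't, 'k) tensor) lcomod" where
  "cotensor C L T =
     \<lparr>carrier = {w \<in> carrier (tensor (sub C L) T).
          tlift (sub C L) T
            (\<lambda>c y. tlift C C (\<lambda>c1 c2. tens C (tensor C T) c1 (tens C T c2 y)) (comult C c)) w
        = tlift (sub C L) T (\<lambda>c y. tens C (tensor C T) c (lcoact T y)) w},
      smul = pw (*),
      lcoact = tlift (sub C L) T
        (\<lambda>c y. tlift C C (\<lambda>c1 c2. tens C (tensor C T) c1 (tens C T c2 y)) (comult C c))\<rparr>"

text \<open>The canonical map from the cotensor product to \<open>T\<close> (counit on the left factor).\<close>

definition cotensor_to ::
  "('k::field, 'c::ab_group_add) coalg \<Rightarrow> 'c set \<Rightarrow> ('k, 'c, 't::ab_group_add) lcomod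
    \<Rightarrow> ('c, 't, 'k) tensor \<Rightarrow> 't" where
  "cotensor_to C L T = tlift (sub C L) T (\<lambda>c y. smul T (counit C c) y)"

definition subcoalgebras_over ::
  "('k::field, 'c::ab_group_add) coalg \<Rightarrow> ('k, 'c, 'm::ab_group_add) rcomod \<Rightarrow> 'c set set" where
  "subcoalgebras_over C M = {L \<in> fd_subcoalgebras C. cf C M \<subseteq> L}"

text \<open>
  Given identifications \<open>phi L\<close> of comodules \<open>X L\<close> with the cotensor products of
  \<open>L\<close> and \<open>T\<close>, the maps \<open>X L \<rightarrow> X L'\<close> corresponding to the inclusions.
\<close>

definition connecting ::
  "('c set \<Rightarrow> ('k, 'c, 'x) lcomod) \<Rightarrow> ('c set \<Rightarrow> 'x \<Rightarrow> 'y) \<Rightarrow> 'c set \<Rightarrow> 'c set \<Rightarrow> 'x \<Rightarrow> 'x" where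
  "connecting X phi L L' x = inv_into (carrier (X L')) (phi L') (phi L x)"

end

theory Submission
  imports Defs
begin

text \<open>
  Comodules are handled as rational modules over the dual algebra: tensors are separated by slicing
  with functionals, and the coaction of \<open>x\<close> lies in \<open>L \<otimes> T\<close> iff all functionals that vanish on \<open>L\<close>
  annihilate \<open>x\<close>. An injective \<open>I\<close> is a retract of the cofree comodule \<open>I \<otimes> \<Gamma>\<close>; hence
  homomorphisms \<open>\<Lambda> \<rightarrow> I\<close> extend to larger subcoalgebras \<open>\<Lambda>'\<close>, and the homomorphisms \<open>\<Lambda>' \<rightarrow> I\<close>
  that vanish on \<open>\<Lambda>\<close> are spanned by \<open>a f\<close> with \<open>a\<close> vanishing on \<open>\<Lambda>\<close>. Dually, \<open>D Hom(\<Lambda>, I)\<close>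
  embeds into \<open>I*\<close> with image the largest \<open>\<Lambda>\<close>-subcomodule. Taking kernels of \<open>d\<close>, the transpose over
  \<open>\<Lambda>\<close> is the largest \<open>\<Lambda>\<close>-subcomodule of the transpose over \<open>\<Gamma>\<close>, which the coaction identifies with
  the cotensor product. By the fundamental theorem of coalgebras these subcomodules exhaust the transpose.
\<close>

section \<open>Linear algebra on carriers\<close>

text \<open>
  Tensors are functions: with these simp rules \<open>0\<close> and \<open>v + w\<close> turn into abstractions, which
  the rules for linear maps on tensors no longer match.
\<close>

declare zero_fun_apply [simp del] plus_fun_apply [simp del]

text \<open>The obstacle is that the comodule laws are equations in triple tensor products, written
  with nested lifts of bilinear maps. Read through slices, they become identities between linear
  maps, and the hit actions a(c1) c2 and c1 a(c2) on the coalgebra are the only computation left.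
  The facts about homomorphisms into an injective I come from one formula. Let b run through a basis
  of \<Lambda> with coordinates c_b, let f : \<Lambda> \<rightarrow> I be a homomorphism and r the
  retraction. Applying r to \<rho>(f x) = \<Sum> f(b) \<otimes> c_b(x1) x2 gives f x = \<Sum> r(f(b)
  \<otimes> c_b(x1) x2). Each summand makes sense on any larger \<Lambda>', whence the extension. On
  \<Lambda>', with a basis adapted to \<Lambda>, a map vanishing on \<Lambda> keeps only summands
  whose coordinate vanishes on \<Lambda>. Injectivity of I0 matters as well as that of I1: it lets
  the kernel of I1* \<rightarrow> I0* be computed at a single stage. The transpose over \<Lambda> is
  comparable with that stage because \<Lambda> is the largest of its own subcoalgebras and because a
  homomorphism from a \<Lambda>-comodule to I lands in the largest \<Lambda>-subcomodule of
  I.\<close>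

abbreviation functional :: "('k::field, 'a::ab_group_add, 'r) space_scheme \<Rightarrow> ('a \<Rightarrow> 'k) \<Rightarrow> bool" where
  "functional X a \<equiv> lin_on X kspace a"

lemma vspace_closed:
  assumes "vspace X"
  shows "0 \<in> carrier X"
    "x \<in> carrier X \<Longrightarrow> y \<in> carrier X \<Longrightarrow> x + y \<in> carrier X"
    "x \<in> carrier X \<Longrightarrow> y \<in> carrier X \<Longrightarrow> x - y \<in> carrier X"
    "x \<in> carrier X \<Longrightarrow> smul X a x \<in> carrier X"
    "(\<And>i. i \<in> A \<Longrightarrow> f i \<in> carrier X) \<Longrightarrow> sum f A \<in> carrier X"
  using module.subspace_0[OF vspaceD(2,3)[OF assms]] module.subspace_add[OF vspaceD(2,3)[OF assms]]
    module.subspace_diff[OF vspaceD(2,3)[OF assms]] module.subspace_scale[OF vspaceD(2,3)[OF assms]]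
    module.subspace_sum[OF vspaceD(2,3)[OF assms]]
  by blast+

lemma vspace_smul:
  assumes "vspace X"
  shows "smul X a (x + y) = smul X a x + smul X a y"
    "smul X (a + b) x = smul X a x + smul X b x"
    "smul X a (smul X b x) = smul X (a * b) x"
    "smul X 1 x = x" "smul X 0 x = 0" "smul X a 0 = 0"
    "smul X a (sum f A) = (\<Sum>i\<in>A. smul X a (f i))"
proof -
  interpret vector_space "smul X" using assms by (rule vspaceD)
  show "smul X a (x + y) = smul X a x + smul X a y"
    "smul X (a + b) x = smul X a x + smul X b x"
    "smul X a (smul X b x) = smul X (a * b) x"
    "smul X 1 x = x" "smul X 0 x = 0" "smul X a 0 = 0"
    "smul X a (sum f A) = (\<Sum>i\<in>A. smul X a (f i))"
    by (simp_all add: scale_right_distrib scale_left_distrib scale_sum_right)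
qed

lemma subspaceI:
  assumes "vspace X" "0 \<in> V" "\<And>x y. x \<in> V \<Longrightarrow> y \<in> V \<Longrightarrow> x + y \<in> V"
    "\<And>a x. x \<in> V \<Longrightarrow> smul X a x \<in> V"
  shows "module.subspace (smul X) V"
  using assms by (simp add: module.subspace_def[OF vspaceD(2)[OF assms(1)]])

lemma vspace_kspace [simp]: "vspace (kspace :: ('k::field, 'k) space)"
proof -
  interpret vector_space "(*) :: 'k \<Rightarrow> 'k \<Rightarrow> 'k"
    by unfold_locales (auto simp: algebra_simps)
  show ?thesis by (simp add: vspace_def vector_space_axioms)
qed

lemma vspace_sub: "vspace X \<Longrightarrow> module.subspace (smul X) V \<Longrightarrow> vspace (sub X V)"
  by (simp add: vspace_def)

lemma lin_onD:
  assumes "lin_on X Y f"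
  shows "x \<in> carrier X \<Longrightarrow> f x \<in> carrier Y"
    "x \<in> carrier X \<Longrightarrow> y \<in> carrier X \<Longrightarrow> f (x + y) = f x + f y"
    "x \<in> carrier X \<Longrightarrow> f (smul X a x) = smul Y a (f x)"
  using assms by (auto simp: lin_on_def)

lemma lin_onI:
  assumes "\<And>x. x \<in> carrier X \<Longrightarrow> f x \<in> carrier Y"
    "\<And>x y. x \<in> carrier X \<Longrightarrow> y \<in> carrier X \<Longrightarrow> f (x + y) = f x + f y"
    "\<And>a x. x \<in> carrier X \<Longrightarrow> f (smul X a x) = smul Y a (f x)"
  shows "lin_on X Y f"
  using assms by (auto simp: lin_on_def)

lemma lin_on_zero: "vspace X \<Longrightarrow> lin_on X Y f \<Longrightarrow> f 0 = 0"
  by (metis lin_onD(2) vspace_closed(1) add_cancel_right_right)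

lemma lin_on_diff:
  assumes "vspace X" "lin_on X Y f" "x \<in> carrier X" "y \<in> carrier X"
  shows "f (x - y) = f x - f y"
  using lin_onD(2)[OF assms(2), of "x - y" y] vspace_closed(3)[OF assms(1,3,4)] assms(4) by simp

lemma lin_on_sum:
  assumes "vspace X" "lin_on X Y f" "\<And>i. i \<in> A \<Longrightarrow> g i \<in> carrier X"
  shows "f (\<Sum>i\<in>A. g i) = (\<Sum>i\<in>A. f (g i))"
  using assms(3)
  by (induction A rule: infinite_finite_induct)
    (auto simp: lin_on_zero[OF assms(1,2)] lin_onD(2)[OF assms(2)] vspace_closed[OF assms(1)])

lemma lin_on_comp: "lin_on X Y f \<Longrightarrow> lin_on Y Z g \<Longrightarrow> lin_on X Z (\<lambda>x. g (f x))"
  by (simp add: lin_on_def)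

lemma lin_on_cong:
  assumes "vspace X" "lin_on X Y f" "\<And>x. x \<in> carrier X \<Longrightarrow> f x = g x"
  shows "lin_on X Y g"
  using lin_onD[OF assms(2)] vspace_closed[OF assms(1)] by (intro lin_onI) (simp_all flip: assms(3))

lemma lin_on_mono:
  assumes "lin_on X Y f" "carrier X' \<subseteq> carrier X" "smul X' = smul X" "smul Y' = smul Y"
    "\<And>x. x \<in> carrier X' \<Longrightarrow> f x \<in> carrier Y'"
  shows "lin_on X' Y' f"
  using assms by (auto simp: lin_on_def subset_iff)

text \<open>Precompose with a projection onto \<open>V\<close>. This is how functionals on a
  subcoalgebra become functionals on the whole coalgebra.\<close>

lemma lin_on_extend:
  assumes X: "vspace X" and V: "module.subspace (smul X) V" and f: "lin_on (sub X V) Z f"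
  obtains f' where "lin_on X Z f'" "\<And>x. x \<in> V \<Longrightarrow> f' x = f x"
proof -
  obtain p where p: "Vector_Spaces.linear (smul X) (smul X) p" "\<And>z. p z \<in> V" "\<And>r. r \<in> V \<Longrightarrow> p r = r"
    using projection_on_subspace[OF vspaceD(1)[OF X] V] by metis
  have "lin_on X (sub X V) p"
    using p(1,2) by (auto simp: lin_on_def Vector_Spaces.linear_iff)
  from lin_on_comp[OF this f] show thesis using p(3) by (intro that[of "\<lambda>x. f (p x)"]) auto
qed

lemma functional_separates:
  assumes X: "vspace X" and "x \<in> carrier X" "y \<in> carrier X" "\<And>a. functional X a \<Longrightarrow> a x = a y"
  shows "x = y"
proof (rule ccontr)
  assume "x \<noteq> y"
  interpret vector_space "smul X" using X by (rule vspaceD)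
  have "subspace {0}" by simp
  moreover have "x - y \<notin> {0}" using \<open>x \<noteq> y\<close> by simp
  ultimately obtain h where h: "Vector_Spaces.linear (smul X) (*) h" "h (x - y) = 1"
    using functional_on_subspace[OF vector_space_axioms] by metis
  have "functional X h" using h(1) by (auto simp: lin_on_def Vector_Spaces.linear_iff)
  then show False using assms(4)[of h] lin_on_diff[OF X _ assms(2,3), of kspace h] h(2) by simp
qed

text \<open>A basis of \<open>V\<close> is an independent set in the span of \<open>B\<close>, hence
  no larger than \<open>B\<close>. The set \<open>B\<close> may lie outside \<open>V\<close>, which
  is the situation in the fundamental theorem below.\<close>

lemma findim_subspace:
  assumes X: "vspace X" and V: "module.subspace (smul X) V" and B: "finite B" "V \<subseteq> module.span (smul X) B"
  shows "findim (sub X V)"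
proof -
  interpret vector_space "smul X" using X by (rule vspaceD)
  obtain B' where B': "B' \<subseteq> V" "independent B'" "V \<subseteq> span B'"
    by (rule maximal_independent_subset)
  have "finite B'"
    using independent_span_bound[OF B(1) B'(2)] B'(1) B(2) by blast
  moreover have "span B' = V" using B' V by (simp add: antisym span_minimal)
  ultimately show ?thesis by (auto simp: findim_def)
qed

text \<open>\<open>B\<close> extends a basis of \<open>V\<close>, so a vector of \<open>V\<close>
  has no coordinate at the remaining elements of \<open>B\<close>. This dichotomy separates tensors
  over a subspace from the others, and later a subcoalgebra from a larger one.\<close>

lemma adapted_basis:
  assumes X: "vspace X" and V: "module.subspace (smul X) V" "V \<subseteq> carrier X"
  obtains B c where "B \<subseteq> carrier X" "\<And>b. b \<in> B \<Longrightarrow> functional X (c b)"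
    "\<And>x. x \<in> carrier X \<Longrightarrow> finite {b \<in> B. c b x \<noteq> 0}"
    "\<And>x. x \<in> carrier X \<Longrightarrow> x = (\<Sum>b\<in>{b \<in> B. c b x \<noteq> 0}. smul X (c b x) b)"
    "\<And>b. b \<in> B \<Longrightarrow> b \<in> V \<or> (\<forall>x\<in>V. c b x = 0)"
    "findim X \<Longrightarrow> finite B"
proof -
  interpret vector_space "smul X" using X by (rule vspaceD)
  obtain B' where B': "B' \<subseteq> V" "independent B'" "V \<subseteq> span B'"
    by (rule maximal_independent_subset)
  obtain B where B: "B' \<subseteq> B" "B \<subseteq> carrier X" "independent B" "carrier X \<subseteq> span B"
    using maximal_independent_subset_extend[of B' "carrier X"] B'(1,2) V(2) by blast
  define c where "c = (\<lambda>b x. representation B x b)"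
  have S: "{b \<in> B. c b x \<noteq> 0} = {b. representation B x b \<noteq> 0}" for x
    using representation_ne_zero[of B x] by (auto simp: c_def)
  show thesis
  proof (rule that[of B c])
    show "B \<subseteq> carrier X" by fact
    show "functional X (c b)" for b
      using B(3,4) by (auto simp: lin_on_def c_def representation_add representation_scale subset_iff)
    show "finite {b \<in> B. c b x \<noteq> 0}" for x
      unfolding S by (rule finite_representation)
    show "x = (\<Sum>b\<in>{b \<in> B. c b x \<noteq> 0}. smul X (c b x) b)" if "x \<in> carrier X" for x
      unfolding S unfolding c_def using B(3,4) that by (subst sum_nonzero_representation_eq) auto
    show "b \<in> V \<or> (\<forall>x\<in>V. c b x = 0)" if "b \<in> B" for b
    proof (cases "b \<in> B'")
      case False
      have "c b x = 0" if "x \<in> V" for x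
        using representation_extend[OF B(3) _ B(1), of x] B'(3) that False
          representation_ne_zero[of B' x b] unfolding c_def by (metis subsetD)
      then show ?thesis by blast
    qed (use B' in blast)
    show "finite B" if "findim X"
      using that independent_span_bound[of _ B] B(2,3) by (auto simp: findim_def)
  qed
qed


section \<open>Tensor products and slices\<close>

lemma vector_space_pw: "vector_space s \<Longrightarrow> vector_space (pw s)"
  using vector_space_fun[of "\<lambda>_. s"] by (simp add: pw_def[abs_def])

lemma vspace_pwI:
  assumes "vector_space s" "0 \<in> V" "\<And>x y. x \<in> V \<Longrightarrow> y \<in> V \<Longrightarrow> x + y \<in> V"
    "\<And>a x. x \<in> V \<Longrightarrow> pw s a x \<in> V"
  shows "vspace \<lparr>carrier = V, smul = pw s\<rparr>"
proof -
  interpret vector_space "pw s" using assms(1) by (rule vector_space_pw)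
  show ?thesis using assms(2-) by (simp add: vspace_def vector_space_axioms subspace_def)
qed

lemma tensor_smul [simp]: "smul (tensor X Y) = pw (*)"
  by (simp add: tensor_def)

lemma vspace_tensor [simp]:
  fixes X :: "('k::field, 'a::ab_group_add, 'r) space_scheme"
    and Y :: "('k, 'b::ab_group_add, 's) space_scheme"
  shows "vspace (tensor X Y)"
proof -
  interpret vector_space "pw (*) :: 'k \<Rightarrow> ('a, 'b, 'k) tensor \<Rightarrow> _"
    by (rule vector_space_pw) (use vspaceD(1)[OF vspace_kspace] in simp)
  show ?thesis by (simp add: vspace_def tensor_def vector_space_axioms)
qed

lemma tens_add:
  "tens X Y (x + x') y = tens X Y x y + tens X Y x' y"
  "tens X Y x (y + y') = tens X Y x y + tens X Y x y'"
  by (auto simp: tens_def fun_eq_iff bilinear_form_def Vector_Spaces.linear_iff plus_fun_apply)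

lemma tens_smul:
  "tens X Y (smul X a x) y = pw (*) a (tens X Y x y)"
  "tens X Y x (smul Y a y) = pw (*) a (tens X Y x y)"
  by (auto simp: tens_def pw_def fun_eq_iff bilinear_form_def Vector_Spaces.linear_iff)

lemma tens_cong: "smul X = smul X' \<Longrightarrow> smul Y = smul Y' \<Longrightarrow> tens X Y = tens X' Y'"
  by (intro ext) (simp add: tens_def)

lemma tens_sub [simp]: "tens (sub X V) Y = tens X Y" "tens X (sub Y W) = tens X Y"
  by (auto intro!: tens_cong)

lemma tens_in:
  fixes X :: "('k::field, 'a::ab_group_add, 'r) space_scheme"
    and Y :: "('k, 'b::ab_group_add, 's) space_scheme"
  shows "x \<in> carrier X \<Longrightarrow> y \<in> carrier Y \<Longrightarrow> tens X Y x y \<in> carrier (tensor X Y)"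
proof -
  assume "x \<in> carrier X" "y \<in> carrier Y"
  moreover have "module (pw (*) :: 'k \<Rightarrow> ('a, 'b, 'k) tensor \<Rightarrow> _)"
    using vspaceD(2)[OF vspace_tensor[of X Y]] by simp
  ultimately show ?thesis by (auto simp: tensor_def intro!: module.span_base)
qed

text \<open>A scalar factor is absorbed into the left entry of a pure tensor, which is why there is
  no case for scalar multiples.\<close>

lemma tensor_induct [consumes 2, case_names tens zero add]:
  fixes X :: "('k::field, 'a::ab_group_add, 'r) space_scheme"
    and Y :: "('k, 'b::ab_group_add, 's) space_scheme"
  assumes w: "w \<in> carrier (tensor X Y)" and X: "vspace X"
    and "\<And>x y. x \<in> carrier X \<Longrightarrow> y \<in> carrier Y \<Longrightarrow> P (tens X Y x y)"
    and "P 0"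
    and "\<And>v w. v \<in> carrier (tensor X Y) \<Longrightarrow> w \<in> carrier (tensor X Y) \<Longrightarrow> P v \<Longrightarrow> P w \<Longrightarrow> P (v + w)"
  shows "P w"
proof -
  interpret vector_space "pw (*) :: 'k \<Rightarrow> ('a, 'b, 'k) tensor \<Rightarrow> _"
    using vspaceD(1)[OF vspace_tensor[of X Y]] by simp
  have "w \<in> span {tens X Y x y | x y. x \<in> carrier X \<and> y \<in> carrier Y}"
    using w by (simp add: tensor_def)
  then have "w \<in> carrier (tensor X Y) \<and> P w"
  proof (induction rule: span_induct_alt)
    case base
    then show ?case using assms(4) vspace_closed(1)[OF vspace_tensor] by blast
  next
    case (step c v w)
    then obtain x y where "v = tens X Y x y" "x \<in> carrier X" "y \<in> carrier Y" by blast
    then have "pw (*) c v = tens X Y (smul X c x) y" "smul X c x \<in> carrier X"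
      by (simp_all add: tens_smul vspace_closed[OF X])
    then show ?case
      using step(2) assms(3,5) \<open>y \<in> carrier Y\<close>
      by (metis tens_in vspace_closed(2)[OF vspace_tensor[of X Y]])
  qed
  then show ?thesis ..
qed

lemma tensor_mono:
  fixes X :: "('k::field, 'a::ab_group_add, 'r) space_scheme"
    and Y :: "('k, 'b::ab_group_add, 's) space_scheme"
  assumes "w \<in> carrier (tensor X Y)" "carrier X \<subseteq> carrier X'" "carrier Y \<subseteq> carrier Y'"
    "smul X = smul X'" "smul Y = smul Y'"
  shows "w \<in> carrier (tensor X' Y')"
proof -
  interpret module "pw (*) :: 'k \<Rightarrow> ('a, 'b, 'k) tensor \<Rightarrow> _"
    using vspaceD(2)[OF vspace_tensor[of X Y]] by simp
  have "{tens X Y x y | x y. x \<in> carrier X \<and> y \<in> carrier Y}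
      \<subseteq> {tens X' Y' x y | x y. x \<in> carrier X' \<and> y \<in> carrier Y'}"
    using assms(2-3) unfolding tens_cong[OF assms(4,5)] by blast
  from span_mono[OF this] show ?thesis using assms(1) by (auto simp: tensor_def)
qed

lemma tensor_cong:
  "carrier X = carrier X' \<Longrightarrow> carrier Y = carrier Y' \<Longrightarrow> smul X = smul X' \<Longrightarrow> smul Y = smul Y'
    \<Longrightarrow> tensor X Y = tensor X' Y'"
  by (simp add: tensor_def tens_cong[of X X' Y Y'])

text \<open>Bundles the hypotheses of \<open>tlift_sum\<close>, so that a single fact accompanies
  each use of \<open>tlift\<close>.\<close>

definition bilin :: "('k::field, 'a::ab_group_add, 'r) space_scheme \<Rightarrow> ('k, 'b::ab_group_add, 's) space_scheme
    \<Rightarrow> ('k, 'z::ab_group_add, 't) space_scheme \<Rightarrow> ('a \<Rightarrow> 'b \<Rightarrow> 'z) \<Rightarrow> bool" where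
  "bilin X Y Z B \<longleftrightarrow> vspace X \<and> vspace Y \<and> vspace Z
    \<and> (\<forall>x\<in>carrier X. lin_on Y Z (B x)) \<and> (\<forall>y\<in>carrier Y. lin_on X Z (\<lambda>x. B x y))"

lemma bilinI:
  assumes "vspace X" "vspace Y" "vspace Z" "\<And>x. x \<in> carrier X \<Longrightarrow> lin_on Y Z (B x)"
    "\<And>y. y \<in> carrier Y \<Longrightarrow> lin_on X Z (\<lambda>x. B x y)"
  shows "bilin X Y Z B"
  using assms by (simp add: bilin_def)

lemma bilinD:
  assumes "bilin X Y Z B"
  shows "vspace X" "vspace Y" "vspace Z" "x \<in> carrier X \<Longrightarrow> lin_on Y Z (B x)"
    "y \<in> carrier Y \<Longrightarrow> lin_on X Z (\<lambda>x. B x y)"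
  using assms by (auto simp: bilin_def)

lemma tensor_rep:
  assumes "w \<in> carrier (tensor X Y)" "vspace X"
  obtains ps where "set ps \<subseteq> carrier X \<times> carrier Y" "w = (\<Sum>(x, y)\<leftarrow>ps. tens X Y x y)"
proof -
  have "\<exists>ps. set ps \<subseteq> carrier X \<times> carrier Y \<and> w = (\<Sum>(x, y)\<leftarrow>ps. tens X Y x y)"
    using assms
  proof (induction w rule: tensor_induct)
    case (tens x y)
    then show ?case by (intro exI[of _ "[(x, y)]"]) auto
  next
    case zero
    then show ?case by (intro exI[of _ "[]"]) auto
  next
    case (add v w)
    then obtain ps qs where "set ps \<subseteq> carrier X \<times> carrier Y" "v = (\<Sum>(x, y)\<leftarrow>ps. tens X Y x y)"
      "set qs \<subseteq> carrier X \<times> carrier Y" "w = (\<Sum>(x, y)\<leftarrow>qs. tens X Y x y)" by blast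
    then show ?case by (intro exI[of _ "ps @ qs"]) auto
  qed
  then show thesis using that by blast
qed

lemma tlift_list:
  assumes "bilin X Y Z B" "set ps \<subseteq> carrier X \<times> carrier Y"
  shows "tlift X Y B (\<Sum>(x, y)\<leftarrow>ps. tens X Y x y) = (\<Sum>(x, y)\<leftarrow>ps. B x y)"
  using assms by (intro tlift_sum[where Z = Z]) (auto simp: bilin_def)

lemma tlift_tens:
  assumes "bilin X Y Z B" "x \<in> carrier X" "y \<in> carrier Y"
  shows "tlift X Y B (tens X Y x y) = B x y"
  using tlift_list[OF assms(1), of "[(x, y)]"] assms by simp

lemma tlift_add:
  assumes "bilin X Y Z B" "v \<in> carrier (tensor X Y)" "w \<in> carrier (tensor X Y)"
  shows "tlift X Y B (v + w) = tlift X Y B v + tlift X Y B w"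
proof -
  obtain ps qs where *: "set ps \<subseteq> carrier X \<times> carrier Y" "v = (\<Sum>(x, y)\<leftarrow>ps. tens X Y x y)"
      "set qs \<subseteq> carrier X \<times> carrier Y" "w = (\<Sum>(x, y)\<leftarrow>qs. tens X Y x y)"
    using assms tensor_rep bilinD(1) by metis
  then show ?thesis
    using tlift_list[OF assms(1), of "ps @ qs"] tlift_list[OF assms(1), of ps] tlift_list[OF assms(1), of qs]
    by simp
qed

lemma tlift_zero: "bilin X Y Z B \<Longrightarrow> tlift X Y B 0 = 0"
  using tlift_list[of X Y Z B "[]"] by simp

lemma tlift_lin:
  assumes B: "bilin X Y Z B"
  shows "lin_on (tensor X Y) Z (tlift X Y B)"
proof (rule lin_onI)
  note X = bilinD(1)[OF B] and Z = bilinD(3)[OF B]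
  fix w assume w: "w \<in> carrier (tensor X Y)"
  then show "tlift X Y B w \<in> carrier Z"
    using X
  proof (induction w rule: tensor_induct)
    case (tens x y)
    then show ?case by (simp add: tlift_tens[OF B] lin_onD[OF bilinD(4)[OF B]])
  next
    case zero
    then show ?case by (simp add: tlift_zero[OF B] vspace_closed[OF Z])
  next
    case (add v w)
    then show ?case by (simp add: tlift_add[OF B] vspace_closed[OF Z])
  qed
  fix a
  show "tlift X Y B (smul (tensor X Y) a w) = smul Z a (tlift X Y B w)"
    using w X
  proof (induction w rule: tensor_induct)
    case (tens x y)
    then show ?case
      using vspace_closed(4)[OF X, of x a]
      by (simp add: tlift_tens[OF B] lin_onD[OF bilinD(5)[OF B]] flip: tens_smul(1))
  next
    case zero
    then show ?case using vspace_smul(6)[OF vspace_tensor[of X Y], of a]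
      by (simp add: tlift_zero[OF B] vspace_smul[OF Z])
  next
    case (add v w)
    then show ?case
      using vspace_smul(1)[OF vspace_tensor[of X Y]] vspace_closed(4)[OF vspace_tensor[of X Y]]
      by (simp add: tlift_add[OF B] vspace_smul[OF Z])
  qed
qed (rule tlift_add[OF B])

text \<open>Sums of pure tensors exhaust the tensor product. Most identities between maps on tensor
  products below are reduced to pure tensors by this rule.\<close>

lemma tensor_lin_eqI:
  assumes "lin_on (tensor X Y) Z f" "lin_on (tensor X Y) Z g" "vspace X"
    "\<And>x y. x \<in> carrier X \<Longrightarrow> y \<in> carrier Y \<Longrightarrow> f (tens X Y x y) = g (tens X Y x y)"
    "w \<in> carrier (tensor X Y)"
  shows "f w = g w"
  using assms(5,3)
  by (induction w rule: tensor_induct)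
    (simp_all add: assms(4) lin_on_zero[OF vspace_tensor] lin_onD(2)[OF assms(1)] lin_onD(2)[OF assms(2)]
      lin_on_zero[OF vspace_tensor assms(1)] lin_on_zero[OF vspace_tensor assms(2)])

lemma bilin_cong:
  assumes "bilin X Y Z B" "\<And>x y. x \<in> carrier X \<Longrightarrow> y \<in> carrier Y \<Longrightarrow> B x y = B' x y"
  shows "bilin X Y Z B'"
  using assms(1) unfolding bilin_def
  by (auto intro: lin_on_cong[of Y Z] lin_on_cong[of X Z] simp: assms(2))

lemma bilin_comp: "bilin X Y Z B \<Longrightarrow> vspace Z' \<Longrightarrow> lin_on Z Z' g \<Longrightarrow> bilin X Y Z' (\<lambda>x y. g (B x y))"
  by (auto simp: bilin_def intro: lin_on_comp)

lemma bilin_precomp: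
  assumes "bilin X Y Z B" "vspace X'" "vspace Y'" "lin_on X' X f" "lin_on Y' Y g"
  shows "bilin X' Y' Z (\<lambda>x y. B (f x) (g y))"
  using assms unfolding bilin_def by (auto simp: lin_on_def)

lemma bilin_mono:
  assumes "bilin X Y Z B" "carrier X' \<subseteq> carrier X" "carrier Y' \<subseteq> carrier Y"
    "smul X' = smul X" "smul Y' = smul Y" "vspace X'" "vspace Y'"
  shows "bilin X' Y' Z B"
  using assms unfolding bilin_def by (auto simp: lin_on_def subset_iff)

lemma bilin_tens: "vspace X \<Longrightarrow> vspace Y \<Longrightarrow> bilin X Y (tensor X Y) (tens X Y)"
  by (auto simp: bilin_def lin_on_def tens_in tens_add tens_smul)

lemma tlift_cong:
  assumes "bilin X Y Z B" "\<And>x y. x \<in> carrier X \<Longrightarrow> y \<in> carrier Y \<Longrightarrow> B x y = B' x y"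
    "w \<in> carrier (tensor X Y)"
  shows "tlift X Y B w = tlift X Y B' w"
  by (rule tensor_lin_eqI[OF tlift_lin[OF assms(1)] tlift_lin[OF bilin_cong[OF assms(1,2)]] bilinD(1)[OF assms(1)]])
    (use assms in \<open>auto simp: tlift_tens[OF assms(1)] tlift_tens[OF bilin_cong[OF assms(1,2)]]\<close>)

lemma tlift_comp:
  assumes "bilin X Y Z B" "vspace Z'" "lin_on Z Z' g" "w \<in> carrier (tensor X Y)"
  shows "g (tlift X Y B w) = tlift X Y (\<lambda>x y. g (B x y)) w"
  by (rule tensor_lin_eqI[OF lin_on_comp[OF tlift_lin[OF assms(1)] assms(3)]
        tlift_lin[OF bilin_comp[OF assms(1-3)]] bilinD(1)[OF assms(1)]])
    (use assms in \<open>auto simp: tlift_tens[OF assms(1)] tlift_tens[OF bilin_comp[OF assms(1-3)]]\<close>)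

text \<open>The smaller tensor product is a subset of the larger one, but \<open>tlift\<close>
  chooses a representation by pure tensors of the given spaces. Independence of the representation
  makes the two choices give the same value.\<close>

lemma tlift_mono:
  assumes "bilin X Y Z B" "carrier X' \<subseteq> carrier X" "carrier Y' \<subseteq> carrier Y"
    "smul X' = smul X" "smul Y' = smul Y" "vspace X'" "vspace Y'" "w \<in> carrier (tensor X' Y')"
  shows "tlift X' Y' B w = tlift X Y B w"
proof (rule tensor_lin_eqI[OF tlift_lin[OF bilin_mono[OF assms(1-7)]] _ assms(6) _ assms(8)])
  have "carrier (tensor X' Y') \<subseteq> carrier (tensor X Y)"
    using tensor_mono[OF _ assms(2-5)] by blast
  then show "lin_on (tensor X' Y') Z (tlift X Y B)"
    using tlift_lin[OF assms(1)] by (auto simp: lin_on_def subset_iff)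
  fix x y assume *: "x \<in> carrier X'" "y \<in> carrier Y'"
  then have "x \<in> carrier X" "y \<in> carrier Y" using assms(2,3) by auto
  then show "tlift X' Y' B (tens X' Y' x y) = tlift X Y B (tens X' Y' x y)"
    using * by (simp add: tlift_tens[OF bilin_mono[OF assms(1-7)]])
      (simp add: tens_cong[OF assms(4,5)] tlift_tens[OF assms(1)])
qed

text \<open>Serves the nested lifts in the comodule laws, where the inner bilinear map carries a
  variable of the outer tensor.\<close>

lemma tlift_param_lin:
  assumes B: "\<And>p. p \<in> carrier P \<Longrightarrow> bilin X Y Z (B p)"
    and lin: "\<And>x y. x \<in> carrier X \<Longrightarrow> y \<in> carrier Y \<Longrightarrow> lin_on P Z (\<lambda>p. B p x y)"
    and w: "w \<in> carrier (tensor X Y)" and P: "vspace P" and X: "vspace X"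
  shows "lin_on P Z (\<lambda>p. tlift X Y (B p) w)"
  using w X
proof (induction w rule: tensor_induct)
  case (tens x y)
  then show ?case
    by (auto intro: lin_on_cong[OF P lin] simp: tlift_tens[OF B])
next
  case zero
  have "vspace Z" using B[OF vspace_closed(1)[OF P]] by (rule bilinD)
  then show ?case using vspace_closed[OF P] by (simp add: lin_on_def tlift_zero[OF B] vspace_closed vspace_smul)
next
  case (add v w)
  have Z: "vspace Z" using B[OF vspace_closed(1)[OF P]] by (rule bilinD)
  from add show ?case
    by (simp add: lin_on_def tlift_add[OF B] vspace_closed[OF P] vspace_closed[OF Z] vspace_smul[OF Z])
qed


section \<open>Slicing tensors with functionals\<close>

definition lslice :: "('k::field, 'a::ab_group_add, 'r) space_scheme \<Rightarrow> ('k, 'b::ab_group_add, 's) space_scheme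
    \<Rightarrow> ('a \<Rightarrow> 'k) \<Rightarrow> ('a, 'b, 'k) tensor \<Rightarrow> 'b" where
  "lslice X Y a = tlift X Y (\<lambda>x y. smul Y (a x) y)"

text \<open>The map id \<otimes> a followed by X \<otimes> k = X, as \<open>lslice\<close> is a
  \<otimes> id followed by k \<otimes> Y = Y.\<close>

definition rslice :: "('k::field, 'a::ab_group_add, 'r) space_scheme \<Rightarrow> ('k, 'b::ab_group_add, 's) space_scheme
    \<Rightarrow> ('b \<Rightarrow> 'k) \<Rightarrow> ('a, 'b, 'k) tensor \<Rightarrow> 'a" where
  "rslice X Y a = tlift X Y (\<lambda>x y. smul X (a y) x)"

lemma bilin_lslice: "vspace X \<Longrightarrow> vspace Y \<Longrightarrow> functional X a \<Longrightarrow> bilin X Y Y (\<lambda>x y. smul Y (a x) y)"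
  by (auto simp: bilin_def lin_on_def vspace_smul vspace_closed mult.commute)

lemma bilin_rslice: "vspace X \<Longrightarrow> vspace Y \<Longrightarrow> functional Y a \<Longrightarrow> bilin X Y X (\<lambda>x y. smul X (a y) x)"
  by (auto simp: bilin_def lin_on_def vspace_smul vspace_closed mult.commute)

lemma lslice_tens:
  "vspace X \<Longrightarrow> vspace Y \<Longrightarrow> functional X a \<Longrightarrow> x \<in> carrier X \<Longrightarrow> y \<in> carrier Y
    \<Longrightarrow> lslice X Y a (tens X Y x y) = smul Y (a x) y"
  by (simp add: lslice_def tlift_tens[OF bilin_lslice])

lemma rslice_tens:
  "vspace X \<Longrightarrow> vspace Y \<Longrightarrow> functional Y a \<Longrightarrow> x \<in> carrier X \<Longrightarrow> y \<in> carrier Y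
    \<Longrightarrow> rslice X Y a (tens X Y x y) = smul X (a y) x"
  by (simp add: rslice_def tlift_tens[OF bilin_rslice])

lemma lslice_lin: "vspace X \<Longrightarrow> vspace Y \<Longrightarrow> functional X a \<Longrightarrow> lin_on (tensor X Y) Y (lslice X Y a)"
  unfolding lslice_def by (rule tlift_lin[OF bilin_lslice])

lemma rslice_lin: "vspace X \<Longrightarrow> vspace Y \<Longrightarrow> functional Y a \<Longrightarrow> lin_on (tensor X Y) X (rslice X Y a)"
  unfolding rslice_def by (rule tlift_lin[OF bilin_rslice])

lemma lslice_mono:
  assumes "vspace X" "vspace Y" "functional X a" "\<And>x. x \<in> carrier X' \<Longrightarrow> a' x = a x"
    "carrier X' \<subseteq> carrier X" "carrier Y' \<subseteq> carrier Y"
    "smul X' = smul X" "smul Y' = smul Y" "vspace X'" "vspace Y'" "w \<in> carrier (tensor X' Y')"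
  shows "lslice X' Y' a' w = lslice X Y a w"
proof -
  note b = bilin_lslice[OF assms(1-3)]
  have "lslice X Y a w = tlift X' Y' (\<lambda>x y. smul Y (a x) y) w"
    unfolding lslice_def by (rule tlift_mono[OF b assms(5-11), symmetric])
  also have "\<dots> = lslice X' Y' a' w"
    unfolding lslice_def by (rule tlift_cong[OF bilin_mono[OF b assms(5-10)] _ assms(11)]) (simp add: assms)
  finally show ?thesis ..
qed

lemma rslice_mono:
  assumes "vspace X" "vspace Y" "functional Y a" "\<And>x. x \<in> carrier Y' \<Longrightarrow> a' x = a x"
    "carrier X' \<subseteq> carrier X" "carrier Y' \<subseteq> carrier Y"
    "smul X' = smul X" "smul Y' = smul Y" "vspace X'" "vspace Y'" "w \<in> carrier (tensor X' Y')"
  shows "rslice X' Y' a' w = rslice X Y a w"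
proof -
  note b = bilin_rslice[OF assms(1-3)]
  have "rslice X Y a w = tlift X' Y' (\<lambda>x y. smul X (a y) x) w"
    unfolding rslice_def by (rule tlift_mono[OF b assms(5-11), symmetric])
  also have "\<dots> = rslice X' Y' a' w"
    unfolding rslice_def by (rule tlift_cong[OF bilin_mono[OF b assms(5-10)] _ assms(11)]) (simp add: assms)
  finally show ?thesis ..
qed

text \<open>In coordinates, w = \<Sum> b \<otimes> (c_b \<otimes> id)(w). The basis may be infinite,
  so the induction carries a finite support \<open>S\<close>; the vanishing of the slices off
  \<open>S\<close> allows the supports of two summands to be enlarged to their union.\<close>

lemma tensor_expand:
  assumes w: "w \<in> carrier (tensor X Y)" and X: "vspace X" and Y: "vspace Y"
    and B: "B \<subseteq> carrier X" "\<And>b. b \<in> B \<Longrightarrow> functional X (c b)"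
    "\<And>x. x \<in> carrier X \<Longrightarrow> finite {b \<in> B. c b x \<noteq> 0}"
    "\<And>x. x \<in> carrier X \<Longrightarrow> x = (\<Sum>b\<in>{b \<in> B. c b x \<noteq> 0}. smul X (c b x) b)"
  shows "\<exists>S. finite S \<and> S \<subseteq> B \<and> (\<forall>b\<in>B - S. lslice X Y (c b) w = 0)
     \<and> w = (\<Sum>b\<in>S. tens X Y b (lslice X Y (c b) w))"
  using w X
proof (induction w rule: tensor_induct)
  case (tens x y)
  let ?S = "{b \<in> B. c b x \<noteq> 0}"
  have 1: "lslice X Y (c b) (tens X Y x y) = smul Y (c b x) y" if "b \<in> B" for b
    using that tens by (simp add: lslice_tens X Y B)
  have "tens X Y x y = tens X Y (\<Sum>b\<in>?S. smul X (c b x) b) y"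
    using B(4)[OF tens(1)] by simp
  also have "\<dots> = (\<Sum>b\<in>?S. tens X Y (smul X (c b x) b) y)"
    by (rule lin_on_sum[OF X bilinD(5)[OF bilin_tens[OF X Y] tens(2)]])
      (use B(1) in \<open>auto simp: vspace_closed[OF X] subset_iff\<close>)
  also have "\<dots> = (\<Sum>b\<in>?S. tens X Y b (lslice X Y (c b) (tens X Y x y)))"
    by (rule sum.cong) (auto simp: 1 tens_smul)
  finally have eq: "tens X Y x y = (\<Sum>b\<in>?S. tens X Y b (lslice X Y (c b) (tens X Y x y)))" .
  have "\<forall>b\<in>B - ?S. lslice X Y (c b) (tens X Y x y) = 0"
    by (simp add: 1 vspace_smul[OF Y])
  then show ?case using eq B(3)[OF tens(1)] by (intro exI[of _ ?S] conjI) simp_all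
next
  case zero
  then show ?case
    by (intro exI[of _ "{}"]) (auto simp: lin_on_zero[OF vspace_tensor lslice_lin[OF X Y B(2)]])
next
  case (add v w)
  then obtain S S' where S: "finite S" "S \<subseteq> B" "\<forall>b\<in>B - S. lslice X Y (c b) v = 0"
     "v = (\<Sum>b\<in>S. tens X Y b (lslice X Y (c b) v))"
     "finite S'" "S' \<subseteq> B" "\<forall>b\<in>B - S'. lslice X Y (c b) w = 0"
     "w = (\<Sum>b\<in>S'. tens X Y b (lslice X Y (c b) w))" by blast
  have 0: "tens X Y b 0 = 0" for b
    using tens_add(2)[of X Y b 0 0] by simp
  have a: "lslice X Y (c b) (v + w) = lslice X Y (c b) v + lslice X Y (c b) w" if "b \<in> B" for b
    using that add by (simp add: lin_onD(2)[OF lslice_lin[OF X Y B(2)]])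
  have "v = (\<Sum>b\<in>S \<union> S'. tens X Y b (lslice X Y (c b) v))"
    using S by (subst (1) S(4)) (rule sum.mono_neutral_left, auto simp: 0)
  moreover have "w = (\<Sum>b\<in>S \<union> S'. tens X Y b (lslice X Y (c b) w))"
    using S by (subst (1) S(8)) (rule sum.mono_neutral_left, auto simp: 0)
  ultimately have "v + w = (\<Sum>b\<in>S \<union> S'. tens X Y b (lslice X Y (c b) v)) + (\<Sum>b\<in>S \<union> S'. tens X Y b (lslice X Y (c b) w))"
    by metis
  also have "\<dots> = (\<Sum>b\<in>S \<union> S'. tens X Y b (lslice X Y (c b) (v + w)))"
    unfolding sum.distrib[symmetric] using S a by (intro sum.cong) (auto simp: tens_add subset_iff)
  finally show ?case
    using S a by (intro exI[of _ "S \<union> S'"]) auto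
qed

text \<open>By \<open>tensor_expand\<close> a tensor is recovered from its coordinate slices;
  applied to the difference \<open>v - w\<close>, all of whose slices vanish, this gives
  zero.\<close>

lemma lslice_eqI:
  assumes w: "v \<in> carrier (tensor X Y)" "w \<in> carrier (tensor X Y)" and X: "vspace X" and Y: "vspace Y"
    and eq: "\<And>a. functional X a \<Longrightarrow> lslice X Y a v = lslice X Y a w"
  shows "v = w"
proof -
  obtain B c where B: "B \<subseteq> carrier X" "\<And>b. b \<in> B \<Longrightarrow> functional X (c b)"
    "\<And>x. x \<in> carrier X \<Longrightarrow> finite {b \<in> B. c b x \<noteq> 0}"
    "\<And>x. x \<in> carrier X \<Longrightarrow> x = (\<Sum>b\<in>{b \<in> B. c b x \<noteq> 0}. smul X (c b x) b)"
    by (rule adapted_basis[OF X, of "carrier X"]) (use vspaceD[OF X] in blast)+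
  have vw: "v - w \<in> carrier (tensor X Y)" using w by (simp add: vspace_closed)
  then obtain S where S: "S \<subseteq> B" "v - w = (\<Sum>b\<in>S. tens X Y b (lslice X Y (c b) (v - w)))"
    using tensor_expand[OF vw X Y B] by blast
  have 0: "tens X Y b 0 = 0" for b
    using tens_add(2)[of X Y b 0 0] by simp
  have "lslice X Y a (v - w) = 0" if "functional X a" for a
    using lin_on_diff[OF vspace_tensor lslice_lin[OF X Y that] w] eq[OF that] by simp
  then have "v - w = (\<Sum>b\<in>S. 0)"
    using S(1) by (subst S(2), intro sum.cong) (auto simp: B(2) 0)
  then show ?thesis by simp
qed

text \<open>In the expansion along a basis of \<open>X\<close> the right factors are themselves
  slices of \<open>w\<close>.\<close>

lemma tensor_mem_right:
  assumes w: "w \<in> carrier (tensor X Y)" and X: "vspace X" and Y: "vspace Y"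
    and Y': "carrier Y' \<subseteq> carrier Y" "smul Y' = smul Y" "vspace Y'"
    and mem: "\<And>a. functional X a \<Longrightarrow> lslice X Y a w \<in> carrier Y'"
  shows "w \<in> carrier (tensor X Y')"
proof -
  obtain B c where B: "B \<subseteq> carrier X" "\<And>b. b \<in> B \<Longrightarrow> functional X (c b)"
    "\<And>x. x \<in> carrier X \<Longrightarrow> finite {b \<in> B. c b x \<noteq> 0}"
    "\<And>x. x \<in> carrier X \<Longrightarrow> x = (\<Sum>b\<in>{b \<in> B. c b x \<noteq> 0}. smul X (c b x) b)"
    by (rule adapted_basis[OF X, of "carrier X"]) (use vspaceD[OF X] in blast)+
  obtain S where S: "S \<subseteq> B" "w = (\<Sum>b\<in>S. tens X Y b (lslice X Y (c b) w))"
    using tensor_expand[OF w X Y B] by blast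
  have "tens X Y b (lslice X Y (c b) w) \<in> carrier (tensor X Y')" if "b \<in> S" for b
    using that S(1) B(1,2) mem tens_in[of b X "lslice X Y (c b) w" Y'] tens_cong[of X X Y Y'] Y'(2)
    by (auto simp: subset_iff)
  then show ?thesis by (subst S(2)) (rule vspace_closed(5)[OF vspace_tensor])
qed

text \<open>With a basis adapted to \<open>X'\<close>, a basis element outside \<open>X'\<close> has
  a coordinate vanishing on \<open>X'\<close>, so the hypothesis removes exactly the terms whose
  left factor is outside \<open>X'\<close>.\<close>

lemma tensor_mem_left:
  assumes w: "w \<in> carrier (tensor X Y)" and X: "vspace X" and Y: "vspace Y"
    and X': "carrier X' \<subseteq> carrier X" "smul X' = smul X" "vspace X'"
    and mem: "\<And>a. functional X a \<Longrightarrow> (\<And>x. x \<in> carrier X' \<Longrightarrow> a x = 0) \<Longrightarrow> lslice X Y a w = 0"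
  shows "w \<in> carrier (tensor X' Y)"
proof -
  obtain B c where B: "B \<subseteq> carrier X" "\<And>b. b \<in> B \<Longrightarrow> functional X (c b)"
    "\<And>x. x \<in> carrier X \<Longrightarrow> finite {b \<in> B. c b x \<noteq> 0}"
    "\<And>x. x \<in> carrier X \<Longrightarrow> x = (\<Sum>b\<in>{b \<in> B. c b x \<noteq> 0}. smul X (c b x) b)"
    "\<And>b. b \<in> B \<Longrightarrow> b \<in> carrier X' \<or> (\<forall>x\<in>carrier X'. c b x = 0)"
    by (rule adapted_basis[OF X, of "carrier X'"]) (use vspaceD[OF X'(3)] X' in \<open>simp; blast\<close>)+
  obtain S where S: "S \<subseteq> B" "w = (\<Sum>b\<in>S. tens X Y b (lslice X Y (c b) w))"
    using tensor_expand[OF w X Y B(1-4)] by blast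
  have 0: "tens X Y b 0 = 0" for b
    using tens_add(2)[of X Y b 0 0] by simp
  have "tens X Y b (lslice X Y (c b) w) \<in> carrier (tensor X' Y)" if b: "b \<in> S" for b
  proof (cases "b \<in> carrier X'")
    case True
    have "lslice X Y (c b) w \<in> carrier Y"
      using b S(1) B(2) by (intro lin_onD(1)[OF lslice_lin[OF X Y] w]) blast
    from tens_in[OF True this] show ?thesis using tens_cong[of X X' Y Y] X'(2) by simp
  next
    case False
    then have "lslice X Y (c b) w = 0" using B(2,5) b S(1) by (intro mem) auto
    then show ?thesis by (simp add: 0 vspace_closed)
  qed
  then show ?thesis by (subst S(2)) (rule vspace_closed(5)[OF vspace_tensor])
qed

text \<open>A tensor is a functional on bilinear forms; the flip evaluates it on the transposed
  form. It carries the statements about left slices over to right slices.\<close>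

definition tflip :: "('a, 'b, 'k) tensor \<Rightarrow> ('b, 'a, 'k) tensor" where
  "tflip w = (\<lambda>b. w (\<lambda>x y. b y x))"

lemma tflip_tflip [simp]: "tflip (tflip w) = w"
  by (simp add: tflip_def)

lemma tflip_tens [simp]: "tflip (tens X Y x y) = tens Y X y x"
  by (auto simp: tflip_def tens_def fun_eq_iff bilinear_form_def)

lemma tflip_add: "tflip (v + w) = tflip v + tflip w" and tflip_zero: "tflip 0 = 0"
  by (auto simp: tflip_def plus_fun_apply zero_fun_apply fun_eq_iff)

lemma tflip_in:
  assumes "w \<in> carrier (tensor X Y)" "vspace X"
  shows "tflip w \<in> carrier (tensor Y X)"
  using assms by (induction w rule: tensor_induct) (simp_all add: tens_in tflip_add tflip_zero vspace_closed)

lemma rslice_flip: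
  assumes w: "w \<in> carrier (tensor X Y)" and X: "vspace X" and Y: "vspace Y" and a: "functional Y a"
  shows "rslice X Y a w = lslice Y X a (tflip w)"
  using w X
proof (induction w rule: tensor_induct)
  case (tens x y)
  then show ?case by (simp add: X Y a rslice_tens lslice_tens)
next
  case zero
  then show ?case
    by (simp add: lin_on_zero[OF vspace_tensor rslice_lin[OF X Y a]] lin_on_zero[OF vspace_tensor lslice_lin[OF Y X a]] tflip_zero)
next
  case (add v w)
  then show ?case
    by (simp add: lin_onD(2)[OF rslice_lin[OF X Y a]] lin_onD(2)[OF lslice_lin[OF Y X a]] tflip_add tflip_in[OF _ X])
qed

lemma rslice_eqI:
  assumes w: "v \<in> carrier (tensor X Y)" "w \<in> carrier (tensor X Y)" and X: "vspace X" and Y: "vspace Y"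
    and eq: "\<And>a. functional Y a \<Longrightarrow> rslice X Y a v = rslice X Y a w"
  shows "v = w"
proof -
  have "tflip v = tflip w"
    by (rule lslice_eqI[OF tflip_in[OF w(1) X] tflip_in[OF w(2) X] Y X])
      (use eq w X Y in \<open>simp flip: rslice_flip\<close>)
  then show ?thesis by (metis tflip_tflip)
qed

lemma tensor_mem_left':
  assumes w: "w \<in> carrier (tensor X Y)" and X: "vspace X" and Y: "vspace Y"
    and X': "carrier X' \<subseteq> carrier X" "smul X' = smul X" "vspace X'"
    and mem: "\<And>a. functional Y a \<Longrightarrow> rslice X Y a w \<in> carrier X'"
  shows "w \<in> carrier (tensor X' Y)"
proof -
  have "tflip w \<in> carrier (tensor Y X')"
    by (rule tensor_mem_right[OF tflip_in[OF w X] Y X X']) (use mem w X Y in \<open>simp flip: rslice_flip\<close>)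
  from tflip_in[OF this Y] show ?thesis by simp
qed

lemma tensor_mem_right':
  assumes w: "w \<in> carrier (tensor X Y)" and X: "vspace X" and Y: "vspace Y"
    and Y': "carrier Y' \<subseteq> carrier Y" "smul Y' = smul Y" "vspace Y'"
    and mem: "\<And>a. functional Y a \<Longrightarrow> (\<And>x. x \<in> carrier Y' \<Longrightarrow> a x = 0) \<Longrightarrow> rslice X Y a w = 0"
  shows "w \<in> carrier (tensor X Y')"
proof -
  have "tflip w \<in> carrier (tensor Y' X)"
    by (rule tensor_mem_left[OF tflip_in[OF w X] Y X Y']) (use mem w X Y in \<open>simp flip: rslice_flip\<close>)
  from tflip_in[OF this Y'(3)] show ?thesis by simp
qed

section \<open>Comodules as modules over the dual algebra\<close>

text \<open>
  A left comodule is a right module over the dual algebra, \<open>x \<cdot> a = ldot C M a x\<close>, a right comodule a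
  left module, \<open>a \<cdot> x = rdot C M a x\<close>; \<open>conv\<close> is the product for which both actions are associative.
\<close>

definition precoalg :: "('k::field, 'c::ab_group_add) coalg \<Rightarrow> bool" where
  "precoalg C \<longleftrightarrow> vspace C \<and> lin_on C (tensor C C) (comult C) \<and> functional C (counit C)"

definition conv :: "('k::field, 'c::ab_group_add) coalg \<Rightarrow> ('c \<Rightarrow> 'k) \<Rightarrow> ('c \<Rightarrow> 'k) \<Rightarrow> 'c \<Rightarrow> 'k" where
  "conv C a b = (\<lambda>c. b (lslice C C a (comult C c)))"

definition ldot :: "('k::field, 'c::ab_group_add) coalg \<Rightarrow> ('k, 'c, 'm::ab_group_add) lcomod
    \<Rightarrow> ('c \<Rightarrow> 'k) \<Rightarrow> 'm \<Rightarrow> 'm" where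
  "ldot C M a x = lslice C M a (lcoact M x)"

definition rdot :: "('k::field, 'c::ab_group_add) coalg \<Rightarrow> ('k, 'c, 'm::ab_group_add) rcomod
    \<Rightarrow> ('c \<Rightarrow> 'k) \<Rightarrow> 'm \<Rightarrow> 'm" where
  "rdot C M a x = rslice M C a (rcoact M x)"

text \<open>In Sweedler notation \<open>lhit\<close> is a(c1) c2 and \<open>rhit\<close> is c1
  a(c2): the two actions of the dual algebra on \<open>C\<close> itself.\<close>

abbreviation lhit :: "('k::field, 'c::ab_group_add) coalg \<Rightarrow> ('c \<Rightarrow> 'k) \<Rightarrow> 'c \<Rightarrow> 'c" where
  "lhit C a c \<equiv> lslice C C a (comult C c)"

abbreviation rhit :: "('k::field, 'c::ab_group_add) coalg \<Rightarrow> ('c \<Rightarrow> 'k) \<Rightarrow> 'c \<Rightarrow> 'c" where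
  "rhit C a c \<equiv> rslice C C a (comult C c)"

lemma precoalgD:
  assumes "precoalg C"
  shows "vspace C" "lin_on C (tensor C C) (comult C)" "functional C (counit C)"
  using assms by (auto simp: precoalg_def)

lemma lhit_lin: "precoalg C \<Longrightarrow> functional C a \<Longrightarrow> lin_on C C (lhit C a)"
  by (rule lin_on_comp[OF precoalgD(2) lslice_lin]) (auto dest: precoalgD)

lemma rhit_lin: "precoalg C \<Longrightarrow> functional C a \<Longrightarrow> lin_on C C (rhit C a)"
  by (rule lin_on_comp[OF precoalgD(2) rslice_lin]) (auto dest: precoalgD)

lemma functional_conv: "precoalg C \<Longrightarrow> functional C a \<Longrightarrow> functional C b \<Longrightarrow> functional C (conv C a b)"
  unfolding conv_def by (rule lin_on_comp[OF lhit_lin])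

text \<open>Both sides are (a \<otimes> b)(w). This gives \<open>conv\<close> its second reading,
  through \<open>rhit\<close> instead of \<open>lhit\<close>.\<close>

lemma slice_swap:
  assumes X: "vspace X" and Y: "vspace Y" and a: "functional X a" and b: "functional Y b"
    and w: "w \<in> carrier (tensor X Y)"
  shows "b (lslice X Y a w) = a (rslice X Y b w)"
  by (rule tensor_lin_eqI[OF lin_on_comp[OF lslice_lin[OF X Y a] b] lin_on_comp[OF rslice_lin[OF X Y b] a] X _ w])
    (simp add: lslice_tens[OF X Y a] rslice_tens[OF X Y b] lin_onD(3)[OF a] lin_onD(3)[OF b] mult.commute)

lemma conv_rhit:
  assumes "precoalg C" "functional C a" "functional C b" "c \<in> carrier C"
  shows "conv C a b c = a (rhit C b c)"
  unfolding conv_def using assms precoalgD[OF assms(1)]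
  by (intro slice_swap) (auto dest: lin_onD)

lemma ldot_lin:
  "vspace C \<Longrightarrow> vspace M \<Longrightarrow> lin_on M (tensor C M) (lcoact M) \<Longrightarrow> functional C a \<Longrightarrow> lin_on M M (ldot C M a)"
  using lin_on_comp[OF _ lslice_lin, of M C M "lcoact M" a] by (simp add: ldot_def[abs_def])

lemma rdot_lin:
  "vspace C \<Longrightarrow> vspace M \<Longrightarrow> lin_on M (tensor M C) (rcoact M) \<Longrightarrow> functional C a \<Longrightarrow> lin_on M M (rdot C M a)"
  using lin_on_comp[OF _ rslice_lin, of M M C "rcoact M" a] by (simp add: rdot_def[abs_def])

text \<open>Only carriers and scalar multiplications enter the tensor constructions. One space
  occurs below as several records (\<open>C\<close>, \<open>regular C (carrier C)\<close>,
  \<open>lregular C\<close>; a dual space and \<open>DHom\<close>), and this and the next two rules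
  identify the constructions over them.\<close>

lemma tlift_space_cong:
  "carrier X = carrier X' \<Longrightarrow> carrier Y = carrier Y' \<Longrightarrow> smul X = smul X' \<Longrightarrow> smul Y = smul Y'
    \<Longrightarrow> tlift X Y = tlift X' Y'"
  by (intro ext) (simp add: tlift_def tens_cong[of X X' Y Y'])

lemma lslice_space_cong:
  "carrier X = carrier X' \<Longrightarrow> carrier Y = carrier Y' \<Longrightarrow> smul X = smul X' \<Longrightarrow> smul Y = smul Y'
    \<Longrightarrow> lslice X Y = lslice X' Y'"
  by (intro ext) (simp add: lslice_def tlift_space_cong[of X X' Y Y'])

lemma rslice_space_cong:
  "carrier X = carrier X' \<Longrightarrow> carrier Y = carrier Y' \<Longrightarrow> smul X = smul X' \<Longrightarrow> smul Y = smul Y'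
    \<Longrightarrow> rslice X Y = rslice X' Y'"
  by (intro ext) (simp add: rslice_def tlift_space_cong[of X X' Y Y'])

text \<open>Two left slices lead into the last factor, so no functional on \<open>Z\<close> is
  involved. This suits left comodules, whose coassociativity lives in C \<otimes> (C \<otimes>
  M).\<close>

lemma tens3_eqI:
  assumes "vspace X" "vspace Y" "vspace Z" "u \<in> carrier (tensor X (tensor Y Z))" "v \<in> carrier (tensor X (tensor Y Z))"
    and "\<And>a b. functional X a \<Longrightarrow> functional Y b
      \<Longrightarrow> lslice Y Z b (lslice X (tensor Y Z) a u) = lslice Y Z b (lslice X (tensor Y Z) a v)"
  shows "u = v"
  using assms by (auto intro!: lslice_eqI[of u X "tensor Y Z" v] lslice_eqI[of _ Y Z] intro: lin_onD(1)[OF lslice_lin])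

section \<open>Coassociativity read through slices\<close>

definition coact_outer :: "('k::field, 'c::ab_group_add) coalg \<Rightarrow> ('k, 'm::ab_group_add, 'r) space_scheme
    \<Rightarrow> ('m \<Rightarrow> ('c, 'm, 'k) tensor) \<Rightarrow> ('c, 'm, 'k) tensor \<Rightarrow> ('c, ('c, 'm, 'k) tensor, 'k) tensor" where
  "coact_outer C M \<rho> = tlift C M (\<lambda>c y. tens C (tensor C M) c (\<rho> y))"

text \<open>This is \<Delta> \<otimes> id, reassociated, as \<open>coact_outer\<close> is id
  \<otimes> \<rho>: the two sides of coassociativity as linear maps on all of C \<otimes> M. The
  space \<open>M\<close> is kept apart from its coaction so that \<open>C\<close> itself can take
  its place.\<close>

definition comult_outer :: "('k::field, 'c::ab_group_add) coalg \<Rightarrow> ('k, 'm::ab_group_add, 'r) space_scheme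
    \<Rightarrow> ('c, 'm, 'k) tensor \<Rightarrow> ('c, ('c, 'm, 'k) tensor, 'k) tensor" where
  "comult_outer C M = tlift C M
    (\<lambda>c y. tlift C C (\<lambda>c1 c2. tens C (tensor C M) c1 (tens C M c2 y)) (comult C c))"

context
  fixes C :: "('k::field, 'c::ab_group_add) coalg" and M :: "('k, 'm::ab_group_add, 'r) space_scheme"
  assumes C: "precoalg C" and M: "vspace M"
begin

private lemmas vC1 = precoalgD(1)[OF C]

lemma bilin_coact_outer: "lin_on M (tensor C M) \<rho> \<Longrightarrow> bilin C M (tensor C (tensor C M)) (\<lambda>c y. tens C (tensor C M) c (\<rho> y))"
  by (rule bilin_precomp[OF bilin_tens, where f = "\<lambda>x. x"]) (use vC1 M in \<open>auto simp: lin_on_def\<close>)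

lemma bilin_comult_outer_inner:
  "y \<in> carrier M \<Longrightarrow> bilin C C (tensor C (tensor C M)) (\<lambda>c1 c2. tens C (tensor C M) c1 (tens C M c2 y))"
  by (rule bilin_precomp[OF bilin_tens, where f = "\<lambda>x. x"])
    (use vC1 M bilinD(5)[OF bilin_tens[OF vC1 M], of y] in \<open>auto simp: lin_on_def\<close>)

lemma bilin_comult_outer: "bilin C M (tensor C (tensor C M))
    (\<lambda>c y. tlift C C (\<lambda>c1 c2. tens C (tensor C M) c1 (tens C M c2 y)) (comult C c))"
proof (rule bilinI[OF vC1 M vspace_tensor])
  fix c assume c: "c \<in> carrier C"
  show "lin_on M (tensor C (tensor C M))
      (\<lambda>y. tlift C C (\<lambda>c1 c2. tens C (tensor C M) c1 (tens C M c2 y)) (comult C c))"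
  proof (rule tlift_param_lin[OF bilin_comult_outer_inner _ _ M vC1])
    show "comult C c \<in> carrier (tensor C C)" using c precoalgD(2)[OF C] by (simp add: lin_onD)
    fix c1 c2 assume c: "c1 \<in> carrier C" "c2 \<in> carrier C"
    show "lin_on M (tensor C (tensor C M)) (\<lambda>y. tens C (tensor C M) c1 (tens C M c2 y))"
      using lin_on_comp[OF bilinD(4)[OF bilin_tens[OF vC1 M] c(2)] bilinD(4)[OF bilin_tens[OF vC1 vspace_tensor] c(1)]] .
  qed
next
  fix y assume "y \<in> carrier M"
  from lin_on_comp[OF precoalgD(2)[OF C] tlift_lin[OF bilin_comult_outer_inner[OF this]]]
  show "lin_on C (tensor C (tensor C M))
      (\<lambda>c. tlift C C (\<lambda>c1 c2. tens C (tensor C M) c1 (tens C M c2 y)) (comult C c))" .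
qed

lemma coact_outer_lin: "lin_on M (tensor C M) \<rho> \<Longrightarrow> lin_on (tensor C M) (tensor C (tensor C M)) (coact_outer C M \<rho>)"
  unfolding coact_outer_def by (rule tlift_lin[OF bilin_coact_outer])

lemma comult_outer_lin: "lin_on (tensor C M) (tensor C (tensor C M)) (comult_outer C M)"
  unfolding comult_outer_def by (rule tlift_lin[OF bilin_comult_outer])

lemma lslice_coact_outer:
  assumes \<rho>: "lin_on M (tensor C M) \<rho>" and a: "functional C a" and w: "w \<in> carrier (tensor C M)"
  shows "lslice C (tensor C M) a (coact_outer C M \<rho> w) = \<rho> (lslice C M a w)"
proof (rule tensor_lin_eqI[OF lin_on_comp[OF coact_outer_lin[OF \<rho>] lslice_lin[OF vC1 vspace_tensor a]]
        lin_on_comp[OF lslice_lin[OF vC1 M a] \<rho>] vC1 _ w])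
  fix c y assume "c \<in> carrier C" "y \<in> carrier M"
  then show "lslice C (tensor C M) a (coact_outer C M \<rho> (tens C M c y)) = \<rho> (lslice C M a (tens C M c y))"
    using lin_onD(1,3)[OF \<rho>]
    by (simp add: coact_outer_def tlift_tens[OF bilin_coact_outer[OF \<rho>]] lslice_tens vC1 M a)
qed

text \<open>Slicing by a turns \<Delta> \<otimes> id into the hit action of a on the left factor.
  The further map \<open>g\<close> is left open because several are used: a left slice produces the
  convolution product, a right slice the commutation of the two hit actions, and the identity the
  description of the cotensor product.\<close>

lemma slice_comult_outer:
  assumes a: "functional C a" and g: "vspace Z" "lin_on (tensor C M) Z g" and w: "w \<in> carrier (tensor C M)"
  shows "g (lslice C (tensor C M) a (comult_outer C M w)) = tlift C M (\<lambda>c y. g (tens C M (lhit C a c) y)) w"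
proof -
  have b1: "bilin C M (tensor C M) (\<lambda>c y. tens C M (lhit C a c) y)"
    by (rule bilin_precomp[OF bilin_tens[OF vC1 M] vC1 M lhit_lin[OF C a]]) (simp add: lin_on_def)
  note bl = bilin_comp[OF b1 g]
  show ?thesis
  proof (rule tensor_lin_eqI[OF lin_on_comp[OF lin_on_comp[OF comult_outer_lin lslice_lin[OF vC1 vspace_tensor a]] g(2)] _ vC1 _ w])
    show "lin_on (tensor C M) Z (tlift C M (\<lambda>c y. g (tens C M (lhit C a c) y)))"
      by (rule tlift_lin[OF bl])
    fix c y assume c: "c \<in> carrier C" and y: "y \<in> carrier M"
    have \<Delta>: "comult C c \<in> carrier (tensor C C)" using c precoalgD(2)[OF C] by (simp add: lin_onD)
    have "lslice C (tensor C M) a (comult_outer C M (tens C M c y))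
        = tlift C C (\<lambda>c1 c2. lslice C (tensor C M) a (tens C (tensor C M) c1 (tens C M c2 y))) (comult C c)"
      unfolding comult_outer_def tlift_tens[OF bilin_comult_outer c y]
      by (rule tlift_comp[OF bilin_comult_outer_inner[OF y] vspace_tensor lslice_lin[OF vC1 vspace_tensor a] \<Delta>])
    also have "\<dots> = tlift C C (\<lambda>c1 c2. tens C M (smul C (a c1) c2) y) (comult C c)"
      by (rule tlift_cong[OF bilin_comp[OF bilin_comult_outer_inner[OF y] vspace_tensor lslice_lin[OF vC1 vspace_tensor a]] _ \<Delta>])
        (use y in \<open>simp add: lslice_tens[OF vC1 vspace_tensor a] tens_in tens_smul\<close>)
    also have "\<dots> = tens C M (lhit C a c) y"
      unfolding lslice_def
      by (rule tlift_comp[OF bilin_lslice[OF vC1 vC1 a] vspace_tensor bilinD(5)[OF bilin_tens[OF vC1 M] y] \<Delta>, symmetric])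
    finally show "g (lslice C (tensor C M) a (comult_outer C M (tens C M c y))) = tlift C M (\<lambda>c y. g (tens C M (lhit C a c) y)) (tens C M c y)"
      by (simp add: tlift_tens[OF bl c y])
  qed
qed

lemma lslice_comult_outer:
  assumes a: "functional C a" and b: "functional C b" and w: "w \<in> carrier (tensor C M)"
  shows "lslice C M b (lslice C (tensor C M) a (comult_outer C M w)) = lslice C M (conv C a b) w"
proof -
  have b1: "bilin C M (tensor C M) (\<lambda>c y. tens C M (lhit C a c) y)"
    by (rule bilin_precomp[OF bilin_tens[OF vC1 M] vC1 M lhit_lin[OF C a]]) (simp add: lin_on_def)
  show ?thesis
    unfolding slice_comult_outer[OF a M lslice_lin[OF vC1 M b] w]
    unfolding lslice_def[of C M "conv C a b"]
    by (rule tlift_cong[OF bilin_comp[OF b1 M lslice_lin[OF vC1 M b]] _ w])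
      (use lin_onD(1)[OF lhit_lin[OF C a]] in \<open>simp add: lslice_tens[OF vC1 M b] conv_def\<close>)
qed

end

text \<open>Two left slices separate the triple tensors in which coassociativity is stated. Sliced
  by a and b, the side with the coaction becomes the iterated action and the side with \<Delta> the
  action of the convolution product.\<close>

lemma left_comodule_iff:
  fixes M :: "('k::field, 'c::ab_group_add, 'm::ab_group_add) lcomod"
  assumes C: "precoalg C"
  shows "left_comodule C M \<longleftrightarrow> vspace M \<and> lin_on M (tensor C M) (lcoact M)
    \<and> (\<forall>x\<in>carrier M. \<forall>a b. functional C a \<longrightarrow> functional C b
         \<longrightarrow> ldot C M b (ldot C M a x) = ldot C M (conv C a b) x)
    \<and> (\<forall>x\<in>carrier M. ldot C M (counit C) x = x)"
proof (cases "vspace M \<and> lin_on M (tensor C M) (lcoact M)")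
  case True
  then have M: "vspace M" and \<rho>: "lin_on M (tensor C M) (lcoact M)" by auto
  note vC = precoalgD(1)[OF C]
  have "coact_outer C M (lcoact M) w = comult_outer C M w
      \<longleftrightarrow> (\<forall>a b. functional C a \<longrightarrow> functional C b
         \<longrightarrow> lslice C M b (lcoact M (lslice C M a w)) = lslice C M (conv C a b) w)"
    if w: "w \<in> carrier (tensor C M)" for w
    using tens3_eqI[OF vC vC M lin_onD(1)[OF coact_outer_lin[OF C M \<rho>] w] lin_onD(1)[OF comult_outer_lin[OF C M] w]]
      lslice_coact_outer[OF C M \<rho> _ w] lslice_comult_outer[OF C M _ _ w] by metis
  then have "coact_outer C M (lcoact M) (lcoact M x) = comult_outer C M (lcoact M x)
      \<longleftrightarrow> (\<forall>a b. functional C a \<longrightarrow> functional C b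
         \<longrightarrow> ldot C M b (ldot C M a x) = ldot C M (conv C a b) x)" if "x \<in> carrier M" for x
    using lin_onD(1)[OF \<rho> that] by (simp add: ldot_def)
  then show ?thesis
    using M \<rho> unfolding left_comodule_def coact_outer_def comult_outer_def ldot_def lslice_def by auto
qed (auto simp: left_comodule_def)


text \<open>For right comodules the triple tensor product is M \<otimes> (C \<otimes> C) with
  \<open>M\<close> at the left end, so the left-handed computation does not transfer by a flip. Both
  sides of coassociativity are evaluated directly against \<mu> \<otimes> a \<otimes> b.\<close>

lemma rcomod_triple:
  fixes C :: "('k::field, 'c::ab_group_add) coalg" and M :: "('k, 'm::ab_group_add, 'r) space_scheme"
    and \<rho> :: "'m \<Rightarrow> ('m, 'c, 'k) tensor"
  defines "L \<equiv> tlift M C (\<lambda>y c. tens M (tensor C C) y (comult C c))"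
    and "R \<equiv> tlift M C (\<lambda>y c. tlift M C (\<lambda>y1 c1. tens M (tensor C C) y1 (tens C C c1 c)) (\<rho> y))"
  assumes C: "precoalg C" and M: "vspace M" and \<rho>: "lin_on M (tensor M C) \<rho>" and w: "w \<in> carrier (tensor M C)"
  shows "L w \<in> carrier (tensor M (tensor C C))" "R w \<in> carrier (tensor M (tensor C C))"
    "functional M \<mu> \<Longrightarrow> functional C a \<Longrightarrow> functional C b
      \<Longrightarrow> b (lslice C C a (lslice M (tensor C C) \<mu> (L w))) = \<mu> (rslice M C (conv C a b) w)"
    "functional M \<mu> \<Longrightarrow> functional C a \<Longrightarrow> functional C b
      \<Longrightarrow> b (lslice C C a (lslice M (tensor C C) \<mu> (R w))) = \<mu> (rslice M C a (\<rho> (rslice M C b w)))"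
proof -
  note vC = precoalgD(1)[OF C] and \<Delta> = precoalgD(2)[OF C]
  have bL: "bilin M C (tensor M (tensor C C)) (\<lambda>y c. tens M (tensor C C) y (comult C c))"
    by (rule bilin_precomp[OF bilin_tens, where f = "\<lambda>x. x"]) (use vC M \<Delta> in \<open>auto simp: lin_on_def\<close>)
  have bi: "bilin M C (tensor M (tensor C C)) (\<lambda>y1 c1. tens M (tensor C C) y1 (tens C C c1 c))"
    if "c \<in> carrier C" for c
    by (rule bilin_precomp[OF bilin_tens, where f = "\<lambda>x. x"])
      (use vC M bilinD(5)[OF bilin_tens[OF vC vC], of c] that in \<open>auto simp: lin_on_def\<close>)
  have bR: "bilin M C (tensor M (tensor C C))
      (\<lambda>y c. tlift M C (\<lambda>y1 c1. tens M (tensor C C) y1 (tens C C c1 c)) (\<rho> y))"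
  proof (rule bilinI[OF M vC vspace_tensor])
    fix y assume y: "y \<in> carrier M"
    show "lin_on C (tensor M (tensor C C)) (\<lambda>c. tlift M C (\<lambda>y1 c1. tens M (tensor C C) y1 (tens C C c1 c)) (\<rho> y))"
    proof (rule tlift_param_lin[OF bi _ _ vC M])
      show "\<rho> y \<in> carrier (tensor M C)" using y \<rho> by (simp add: lin_onD)
      fix y1 c1 assume "y1 \<in> carrier M" "c1 \<in> carrier C"
      from lin_on_comp[OF bilinD(4)[OF bilin_tens[OF vC vC] this(2)] bilinD(4)[OF bilin_tens[OF M vspace_tensor] this(1)]]
      show "lin_on C (tensor M (tensor C C)) (\<lambda>c. tens M (tensor C C) y1 (tens C C c1 c))" .
    qed
  next
    fix c assume "c \<in> carrier C"
    from lin_on_comp[OF \<rho> tlift_lin[OF bi[OF this]]]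
    show "lin_on M (tensor M (tensor C C)) (\<lambda>y. tlift M C (\<lambda>y1 c1. tens M (tensor C C) y1 (tens C C c1 c)) (\<rho> y))" .
  qed
  have L: "lin_on (tensor M C) (tensor M (tensor C C)) L" and R: "lin_on (tensor M C) (tensor M (tensor C C)) R"
    unfolding L_def R_def by (rule tlift_lin[OF bL] tlift_lin[OF bR])+
  show "L w \<in> carrier (tensor M (tensor C C))" "R w \<in> carrier (tensor M (tensor C C))"
    using lin_onD(1)[OF L w] lin_onD(1)[OF R w] by auto
  assume \<mu>: "functional M \<mu>" and a: "functional C a" and b: "functional C b"
  note lin = lin_on_comp[OF lin_on_comp[OF lslice_lin[OF M vspace_tensor \<mu>] lslice_lin[OF vC vC a]] b]
  note ab = functional_conv[OF C a b]
  show "b (lslice C C a (lslice M (tensor C C) \<mu> (L w))) = \<mu> (rslice M C (conv C a b) w)"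
  proof (rule tensor_lin_eqI[OF lin_on_comp[OF L lin] lin_on_comp[OF rslice_lin[OF M vC ab] \<mu>] M _ w])
    fix y c assume y: "y \<in> carrier M" and c: "c \<in> carrier C"
    show "b (lslice C C a (lslice M (tensor C C) \<mu> (L (tens M C y c)))) = \<mu> (rslice M C (conv C a b) (tens M C y c))"
      using y c lin_onD(1)[OF \<Delta> c] lin_onD(3)[OF lslice_lin[OF vC vC a]] lin_onD(1)[OF lslice_lin[OF vC vC a]]
      by (subst rslice_tens[OF M vC ab y c])
        (simp add: L_def tlift_tens[OF bL] lslice_tens[OF M vspace_tensor \<mu>] lin_onD(3)[OF \<mu>]
          lin_onD(3)[OF b] conv_def mult.commute)
  qed
  show "b (lslice C C a (lslice M (tensor C C) \<mu> (R w))) = \<mu> (rslice M C a (\<rho> (rslice M C b w)))"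
  proof (rule tensor_lin_eqI[OF lin_on_comp[OF R lin]
        lin_on_comp[OF rslice_lin[OF M vC b] lin_on_comp[OF \<rho> lin_on_comp[OF rslice_lin[OF M vC a] \<mu>]]] M _ w])
    fix y c assume y: "y \<in> carrier M" and c: "c \<in> carrier C"
    have \<rho>y: "\<rho> y \<in> carrier (tensor M C)" using y \<rho> by (simp add: lin_onD)
    have "b (lslice C C a (lslice M (tensor C C) \<mu> (R (tens M C y c))))
      = tlift M C (\<lambda>y1 c1. b (lslice C C a (lslice M (tensor C C) \<mu> (tens M (tensor C C) y1 (tens C C c1 c))))) (\<rho> y)"
      unfolding R_def tlift_tens[OF bR y c] by (rule tlift_comp[OF bi[OF c] vspace_kspace lin \<rho>y])
    also have "\<dots> = tlift M C (\<lambda>y1 c1. b c * \<mu> (smul M (a c1) y1)) (\<rho> y)"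
    proof (rule tlift_cong[OF bilin_comp[OF bi[OF c] vspace_kspace lin] _ \<rho>y])
      fix y1 c1 assume "y1 \<in> carrier M" "c1 \<in> carrier C"
      then show "b (lslice C C a (lslice M (tensor C C) \<mu> (tens M (tensor C C) y1 (tens C C c1 c)))) = b c * \<mu> (smul M (a c1) y1)"
        using c lin_onD(3)[OF lslice_lin[OF vC vC a]]
        by (simp add: lslice_tens[OF M vspace_tensor \<mu>] lslice_tens[OF vC vC a] tens_in lin_onD(3)[OF \<mu>] lin_onD(3)[OF b] vspace_closed[OF vC])
    qed
    also have "\<dots> = b c * \<mu> (rslice M C a (\<rho> y))"
      unfolding rslice_def
      by (rule tlift_comp[OF bilin_rslice[OF M vC a] vspace_kspace lin_on_comp[OF \<mu>] \<rho>y, symmetric])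
        (auto simp: lin_on_def algebra_simps)
    also have "\<dots> = \<mu> (rslice M C a (\<rho> (rslice M C b (tens M C y c))))"
      using y c \<rho>y lin_onD(1,3)[OF rslice_lin[OF M vC a]]
      by (simp add: rslice_tens[OF M vC b] lin_onD(3)[OF \<rho>] lin_onD(3)[OF \<mu>])
    finally show "b (lslice C C a (lslice M (tensor C C) \<mu> (R (tens M C y c)))) = \<mu> (rslice M C a (\<rho> (rslice M C b (tens M C y c))))" .
  qed
qed

text \<open>The scalars computed in \<open>rcomod_triple\<close> decide both directions: functionals
  \<mu> separate the points of \<open>M\<close>, and slices by \<mu> and a followed by a functional
  b separate the triple tensors.\<close>

lemma right_comodule_iff:
  fixes M :: "('k::field, 'c::ab_group_add, 'm::ab_group_add) rcomod"
  assumes C: "precoalg C"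
  shows "right_comodule C M \<longleftrightarrow> vspace M \<and> lin_on M (tensor M C) (rcoact M)
    \<and> (\<forall>x\<in>carrier M. \<forall>a b. functional C a \<longrightarrow> functional C b
         \<longrightarrow> rdot C M a (rdot C M b x) = rdot C M (conv C a b) x)
    \<and> (\<forall>x\<in>carrier M. rdot C M (counit C) x = x)"
proof (cases "vspace M \<and> lin_on M (tensor M C) (rcoact M)")
  case True
  then have M: "vspace M" and \<rho>: "lin_on M (tensor M C) (rcoact M)" by auto
  note vC = precoalgD(1)[OF C]
  have "tlift M C (\<lambda>y c. tens M (tensor C C) y (comult C c)) (rcoact M x)
        = tlift M C (\<lambda>y c. tlift M C (\<lambda>y1 c1. tens M (tensor C C) y1 (tens C C c1 c)) (rcoact M y)) (rcoact M x)
      \<longleftrightarrow> (\<forall>a b. functional C a \<longrightarrow> functional C b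
         \<longrightarrow> rdot C M a (rdot C M b x) = rdot C M (conv C a b) x)" (is "?L = ?R \<longleftrightarrow> ?A")
    if x: "x \<in> carrier M" for x
  proof
    note w = lin_onD(1)[OF \<rho> x]
    note t = rcomod_triple[OF C M \<rho> w]
    {
      assume eq: "?L = ?R"
      show ?A
      proof (intro allI impI)
        fix a b assume a: "functional C a" and b: "functional C b"
        show "rdot C M a (rdot C M b x) = rdot C M (conv C a b) x"
        proof (rule functional_separates[OF M])
          show "rdot C M a (rdot C M b x) \<in> carrier M" "rdot C M (conv C a b) x \<in> carrier M"
            using x lin_onD(1)[OF rdot_lin[OF vC M \<rho>]] a b functional_conv[OF C a b] by blast+
          fix \<mu> assume \<mu>: "functional M \<mu>"
          show "\<mu> (rdot C M a (rdot C M b x)) = \<mu> (rdot C M (conv C a b) x)"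
            unfolding rdot_def t(3)[OF \<mu> a b, symmetric] t(4)[OF \<mu> a b, symmetric] eq ..
        qed
      qed
    }
    assume A: ?A
    show "?L = ?R"
    proof (rule lslice_eqI[OF t(1,2) M vspace_tensor])
      fix \<mu> assume \<mu>: "functional M \<mu>"
      note l1 = lin_onD(1)[OF lslice_lin[OF M vspace_tensor \<mu>]]
      show "lslice M (tensor C C) \<mu> ?L = lslice M (tensor C C) \<mu> ?R"
      proof (rule lslice_eqI[OF l1[OF t(1)] l1[OF t(2)] vC vC])
        fix a assume a: "functional C a"
        note l2 = lin_onD(1)[OF lslice_lin[OF vC vC a]]
        show "lslice C C a (lslice M (tensor C C) \<mu> ?L) = lslice C C a (lslice M (tensor C C) \<mu> ?R)"
        proof (rule functional_separates[OF vC l2[OF l1[OF t(1)]] l2[OF l1[OF t(2)]]])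
          fix b assume b: "functional C b"
          show "b (lslice C C a (lslice M (tensor C C) \<mu> ?L)) = b (lslice C C a (lslice M (tensor C C) \<mu> ?R))"
            unfolding t(3)[OF \<mu> a b] t(4)[OF \<mu> a b]
            using A[rule_format, OF a b] by (simp add: rdot_def)
        qed
      qed
    qed
  qed
  then show ?thesis
    using M \<rho> unfolding right_comodule_def rdot_def rslice_def by auto
qed (auto simp: right_comodule_def)

abbreviation lregular :: "('k::field, 'c::ab_group_add) coalg \<Rightarrow> ('k, 'c, 'c) lcomod" where
  "lregular C \<equiv> \<lparr>carrier = carrier C, smul = smul C, lcoact = comult C\<rparr>"

lemma regular_simps [simp]:
  "carrier (regular C L) = L" "smul (regular C L) = smul C" "rcoact (regular C L) = comult C"
  by (auto simp: regular_def)

text \<open>Coassociativity and the left counit law say precisely that \<open>C\<close> is a left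
  comodule over itself; only the right counit law remains to be listed.\<close>

lemma coalgebra_iff:
  "coalgebra C \<longleftrightarrow> precoalg C \<and> left_comodule C (lregular C)
    \<and> (\<forall>c\<in>carrier C. rslice C C (counit C) (comult C c) = c)"
proof -
  have 1: "tlift C (lregular C) = tlift C C" by (rule tlift_space_cong) auto
  have 2: "tens C (lregular C) = tens C C" by (rule tens_cong) auto
  have 3: "tensor C (lregular C) = tensor C C" by (rule tensor_cong) auto
  have 4: "vspace (lregular C) = vspace C" by (simp add: vspace_def)
  have 5: "lin_on (lregular C) X f = lin_on C X f" for X f by (simp add: lin_on_def)
  show ?thesis
    unfolding coalgebra_def precoalg_def left_comodule_def 1 2 3 4 5 rslice_def by auto
qed

lemma coalgebra_right_regular:
  assumes "coalgebra C"
  shows "right_comodule C (regular C (carrier C))"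
proof -
  have 1: "tlift (regular C (carrier C)) C = tlift C C" by (rule tlift_space_cong) auto
  have 2: "tens (regular C (carrier C)) = tens C" by (intro ext, simp add: tens_def)
  have 3: "tensor (regular C (carrier C)) C = tensor C C" by (rule tensor_cong) auto
  have 4: "vspace (regular C (carrier C)) = vspace C" by (simp add: vspace_def)
  have 5: "lin_on (regular C (carrier C)) X f = lin_on C X f" for X f by (simp add: lin_on_def)
  show ?thesis
    using assms unfolding coalgebra_def right_comodule_def 1 2 3 4 5 by auto
qed

lemma coalgebra_precoalg: "coalgebra C \<Longrightarrow> precoalg C"
  by (simp add: coalgebra_iff)

text \<open>The laws for one action are the comodule laws of the left and right regular comodules.
  That the two actions commute is coassociativity sliced by b at the left end and by a at the right
  end.\<close>

lemma hit_laws: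
  assumes C: "coalgebra C" and c: "c \<in> carrier C" and a: "functional C a" and b: "functional C b"
  shows "lhit C b (lhit C a c) = lhit C (conv C a b) c"
    "rhit C a (rhit C b c) = rhit C (conv C a b) c"
    "lhit C b (rhit C a c) = rhit C a (lhit C b c)"
    "lhit C (counit C) c = c" "rhit C (counit C) c = c"
proof -
  note P = coalgebra_precoalg[OF C]
  note vC = precoalgD(1)[OF P] and \<Delta> = precoalgD(2)[OF P]
  have l: "ldot C (lregular C) a = (\<lambda>c. lhit C a c)" for a
    by (simp add: ldot_def[abs_def] lslice_space_cong[of C C "lregular C" C])
  have r: "rdot C (regular C (carrier C)) a = (\<lambda>c. rhit C a c)" for a
    by (simp add: rdot_def[abs_def] rslice_space_cong[of "regular C (carrier C)" C C C])
  show "lhit C b (lhit C a c) = lhit C (conv C a b) c" "lhit C (counit C) c = c"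
    using C[unfolded coalgebra_iff left_comodule_iff[OF P]] a b c by (auto simp: l)
  show "rhit C a (rhit C b c) = rhit C (conv C a b) c" "rhit C (counit C) c = c"
    using coalgebra_right_regular[OF C, unfolded right_comodule_iff[OF P]] a b c by (auto simp: r)
  have w: "comult C c \<in> carrier (tensor C C)" using lin_onD(1)[OF \<Delta> c] .
  have "coact_outer C C (comult C) (comult C c) = comult_outer C C (comult C c)"
    using C c by (simp add: coalgebra_def coact_outer_def comult_outer_def)
  then have "rslice C C a (comult C (lhit C b c)) = rslice C C a (lslice C (tensor C C) b (comult_outer C C (comult C c)))"
    using lslice_coact_outer[OF P vC \<Delta> b w] by simp
  also have "\<dots> = lhit C b (rhit C a c)"
  proof (unfold slice_comult_outer[OF P vC b vC rslice_lin[OF vC vC a] w])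
    have B: "bilin C C C (\<lambda>c y. smul C (a y) (lhit C b c))"
      using bilin_precomp[OF bilin_rslice[OF vC vC a] vC vC lhit_lin[OF P b], of "\<lambda>x. x"] by (simp add: lin_on_def)
    have "tlift C C (\<lambda>c y. rslice C C a (tens C C (lhit C b c) y)) (comult C c)
       = tlift C C (\<lambda>c y. smul C (a y) (lhit C b c)) (comult C c)"
      by (rule tlift_cong[OF B _ w, symmetric])
        (use lin_onD(1)[OF lhit_lin[OF P b]] in \<open>simp add: rslice_tens[OF vC vC a]\<close>)
    also have "\<dots> = tlift C C (\<lambda>c y. lhit C b (smul C (a y) c)) (comult C c)"
      by (rule tlift_cong[OF B _ w]) (simp add: lin_onD(3)[OF lhit_lin[OF P b]])
    also have "\<dots> = lhit C b (rhit C a c)"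
      unfolding rslice_def by (rule tlift_comp[OF bilin_rslice[OF vC vC a] vC lhit_lin[OF P b] w, symmetric])
    finally show "tlift C C (\<lambda>c y. rslice C C a (tens C C (lhit C b c) y)) (comult C c) = lhit C b (rhit C a c)" .
  qed
  finally show "lhit C b (rhit C a c) = rhit C a (lhit C b c)" ..
qed

text \<open>The slices of (id \<otimes> f)(\<rho> x) are the images under f of the slices of \<rho>
  x, and slices separate tensors.\<close>

lemma lcomod_hom_iff:
  assumes C: "vspace C" and M: "vspace M" and N: "vspace N"
    and \<rho>: "lin_on M (tensor C M) (lcoact M)" and \<sigma>: "lin_on N (tensor C N) (lcoact N)"
  shows "lcomod_hom C M N f \<longleftrightarrow> lin_on M N f
     \<and> (\<forall>x\<in>carrier M. \<forall>a. functional C a \<longrightarrow> f (ldot C M a x) = ldot C N a (f x))"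
proof (cases "lin_on M N f")
  case True
  have B: "bilin C M (tensor C N) (\<lambda>c y. tens C N c (f y))"
    using bilin_precomp[OF bilin_tens[OF C N] C M _ True, of "\<lambda>x. x"] by (simp add: lin_on_def)
  have *: "lcoact N (f x) = tlift C M (\<lambda>c y. tens C N c (f y)) (lcoact M x)
      \<longleftrightarrow> (\<forall>a. functional C a \<longrightarrow> f (ldot C M a x) = ldot C N a (f x))" if x: "x \<in> carrier M" for x
  proof -
    note w = lin_onD(1)[OF \<rho> x]
    have eq: "lslice C N a (tlift C M (\<lambda>c y. tens C N c (f y)) (lcoact M x)) = f (ldot C M a x)"
      if a: "functional C a" for a
    proof -
      have "lslice C N a (tlift C M (\<lambda>c y. tens C N c (f y)) (lcoact M x))
          = tlift C M (\<lambda>c y. lslice C N a (tens C N c (f y))) (lcoact M x)"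
        by (rule tlift_comp[OF B N lslice_lin[OF C N a] w])
      also have "\<dots> = tlift C M (\<lambda>c y. f (smul M (a c) y)) (lcoact M x)"
        by (rule tlift_cong[OF bilin_comp[OF B N lslice_lin[OF C N a]] _ w])
          (simp add: lslice_tens[OF C N a] lin_onD[OF True])
      also have "\<dots> = f (ldot C M a x)"
        unfolding ldot_def lslice_def by (rule tlift_comp[OF bilin_lslice[OF C M a] N True w, symmetric])
      finally show ?thesis .
    qed
    show ?thesis
      using lslice_eqI[OF lin_onD(1)[OF \<sigma> lin_onD(1)[OF True x]] lin_onD(1)[OF tlift_lin[OF B] w] C N] eq
      by (metis ldot_def)
  qed
  then show ?thesis using True by (auto simp: lcomod_hom_def)
qed (auto simp: lcomod_hom_def)

lemma rcomod_hom_iff: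
  assumes C: "vspace C" and M: "vspace M" and N: "vspace N"
    and \<rho>: "lin_on M (tensor M C) (rcoact M)" and \<sigma>: "lin_on N (tensor N C) (rcoact N)"
  shows "rcomod_hom C M N f \<longleftrightarrow> lin_on M N f
     \<and> (\<forall>x\<in>carrier M. \<forall>a. functional C a \<longrightarrow> f (rdot C M a x) = rdot C N a (f x))"
proof (cases "lin_on M N f")
  case True
  have B: "bilin M C (tensor N C) (\<lambda>y c. tens N C (f y) c)"
    using bilin_precomp[OF bilin_tens[OF N C] M C True, of "\<lambda>x. x"] by (simp add: lin_on_def)
  have *: "rcoact N (f x) = tlift M C (\<lambda>y c. tens N C (f y) c) (rcoact M x)
      \<longleftrightarrow> (\<forall>a. functional C a \<longrightarrow> f (rdot C M a x) = rdot C N a (f x))" if x: "x \<in> carrier M" for x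
  proof -
    note w = lin_onD(1)[OF \<rho> x]
    have eq: "rslice N C a (tlift M C (\<lambda>y c. tens N C (f y) c) (rcoact M x)) = f (rdot C M a x)"
      if a: "functional C a" for a
    proof -
      have "rslice N C a (tlift M C (\<lambda>y c. tens N C (f y) c) (rcoact M x))
          = tlift M C (\<lambda>y c. rslice N C a (tens N C (f y) c)) (rcoact M x)"
        by (rule tlift_comp[OF B N rslice_lin[OF N C a] w])
      also have "\<dots> = tlift M C (\<lambda>y c. f (smul M (a c) y)) (rcoact M x)"
        by (rule tlift_cong[OF bilin_comp[OF B N rslice_lin[OF N C a]] _ w])
          (simp add: rslice_tens[OF N C a] lin_onD[OF True])
      also have "\<dots> = f (rdot C M a x)"
        unfolding rdot_def rslice_def by (rule tlift_comp[OF bilin_rslice[OF M C a] N True w, symmetric])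
      finally show ?thesis .
    qed
    show ?thesis
      using rslice_eqI[OF lin_onD(1)[OF \<sigma> lin_onD(1)[OF True x]] lin_onD(1)[OF tlift_lin[OF B] w] N C] eq
      by (metis rdot_def)
  qed
  then show ?thesis using True by (auto simp: rcomod_hom_def)
qed (auto simp: rcomod_hom_def)

section \<open>Subcoalgebras\<close>

text \<open>Separated from \<open>fd_subcoalgebras\<close> so that the passage between comodules
  over \<open>L\<close> and over \<open>C\<close> is available for subcoalgebras of any
  dimension.\<close>

definition subcoalg :: "('k::field, 'c::ab_group_add) coalg \<Rightarrow> 'c set \<Rightarrow> bool" where
  "subcoalg C L \<longleftrightarrow> L \<subseteq> carrier C \<and> module.subspace (smul C) L
     \<and> (\<forall>c\<in>L. comult C c \<in> carrier (tensor (sub C L) (sub C L)))"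

lemma fd_subcoalgebras_iff: "L \<in> fd_subcoalgebras C \<longleftrightarrow> subcoalg C L \<and> findim (sub C L)"
  by (auto simp: fd_subcoalgebras_def subcoalg_def)

lemma functional_sub: "functional C a \<Longrightarrow> L \<subseteq> carrier C \<Longrightarrow> functional (sub C L) a"
  by (auto simp: lin_on_def subset_iff)

context
  fixes C :: "('k::field, 'c::ab_group_add) coalg" and L :: "'c set"
  assumes C: "precoalg C" and L: "subcoalg C L"
begin

private lemmas vC2 = precoalgD(1)[OF C] and \<Delta>2 = precoalgD(2)[OF C]

lemma subcoalgD: "L \<subseteq> carrier C" "vspace (sub C L)" "c \<in> L \<Longrightarrow> c \<in> carrier C"
    "c \<in> L \<Longrightarrow> comult C c \<in> carrier (tensor (sub C L) (sub C L))"
  using L vspace_sub[OF vC2] by (auto simp: subcoalg_def)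

lemma functional_extend:
  assumes "functional (sub C L) a"
  obtains a' where "functional C a'" "\<And>x. x \<in> L \<Longrightarrow> a' x = a x"
  using lin_on_extend[OF vC2 _ assms] L by (auto simp: subcoalg_def)

lemma precoalg_sub: "precoalg (sub C L)"
proof -
  have "lin_on (sub C L) (tensor (sub C L) (sub C L)) (comult C)"
    by (rule lin_on_mono[OF \<Delta>2]) (use subcoalgD in auto)
  then show ?thesis
    using subcoalgD functional_sub[OF precoalgD(3)[OF C]] by (simp add: precoalg_def)
qed

lemma lslice_sub:
  assumes "vspace M" "functional C a" "\<And>x. x \<in> L \<Longrightarrow> a' x = a x" "w \<in> carrier (tensor (sub C L) M)"
  shows "lslice (sub C L) M a' w = lslice C M a w"
  by (rule lslice_mono[OF vC2]) (use assms subcoalgD in auto)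

lemma rslice_sub:
  assumes "vspace M" "functional C a" "\<And>x. x \<in> L \<Longrightarrow> a' x = a x" "w \<in> carrier (tensor M (sub C L))"
  shows "rslice M (sub C L) a' w = rslice M C a w"
  by (rule rslice_mono[OF _ vC2]) (use assms subcoalgD in auto)

lemma lhit_sub:
  assumes "functional C a" "\<And>x. x \<in> L \<Longrightarrow> a' x = a x" "c \<in> L"
  shows "lhit (sub C L) a' c = lhit C a c"
proof -
  have "lslice (sub C L) (sub C L) a' (comult C c) = lhit C a c"
    by (rule lslice_mono[OF vC2 vC2 assms(1)]) (use assms subcoalgD in auto)
  then show ?thesis by simp
qed

lemma rhit_sub:
  assumes "functional C a" "\<And>x. x \<in> L \<Longrightarrow> a' x = a x" "c \<in> L"
  shows "rhit (sub C L) a' c = rhit C a c"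
proof -
  have "rslice (sub C L) (sub C L) a' (comult C c) = rhit C a c"
    by (rule rslice_mono[OF vC2 vC2 assms(1)]) (use assms subcoalgD in auto)
  then show ?thesis by simp
qed

lemma hit_in_sub:
  assumes "functional C a" "c \<in> L"
  shows "lhit C a c \<in> L" "rhit C a c \<in> L"
  using lin_onD(1)[OF lhit_lin[OF precoalg_sub functional_sub[OF assms(1) subcoalgD(1)]], of c]
    lin_onD(1)[OF rhit_lin[OF precoalg_sub functional_sub[OF assms(1) subcoalgD(1)]], of c]
    lhit_sub[OF assms(1) _ assms(2), of a] rhit_sub[OF assms(1) _ assms(2), of a] assms(2)
  by auto

lemma conv_sub:
  assumes "functional C a" "\<And>x. x \<in> L \<Longrightarrow> a' x = a x" "functional C b" "\<And>x. x \<in> L \<Longrightarrow> b' x = b x" "c \<in> L"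
  shows "conv (sub C L) a' b' c = conv C a b c"
  using lhit_sub[OF assms(1,2,5)] hit_in_sub(1)[OF assms(1,5)] assms(4) by (simp add: conv_def)

text \<open>Functionals on \<open>C\<close> restrict to \<open>L\<close> and functionals on
  \<open>L\<close> extend to \<open>C\<close>, and both act in the same way through a coaction with
  values in L \<otimes> M. So the module laws over the two dual algebras are the same
  statement.\<close>

lemma left_comodule_sub_iff:
  "left_comodule (sub C L) M \<longleftrightarrow> left_comodule C M \<and> (\<forall>x\<in>carrier M. lcoact M x \<in> carrier (tensor (sub C L) M))"
proof (cases "vspace M \<and> lin_on M (tensor C M) (lcoact M) \<and> (\<forall>x\<in>carrier M. lcoact M x \<in> carrier (tensor (sub C L) M))")
  case True
  then have M: "vspace M" and \<rho>: "lin_on M (tensor C M) (lcoact M)"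
    and \<rho>L: "x \<in> carrier M \<Longrightarrow> lcoact M x \<in> carrier (tensor (sub C L) M)" for x by auto
  have \<rho>': "lin_on M (tensor (sub C L) M) (lcoact M)"
    by (rule lin_on_mono[OF \<rho>]) (use \<rho>L in auto)
  have d: "ldot (sub C L) M a' x = ldot C M a x"
    if "functional C a" "\<And>x. x \<in> L \<Longrightarrow> a' x = a x" "x \<in> carrier M" for a a' x
    unfolding ldot_def using that by (intro lslice_sub[OF M that(1)] \<rho>L)
  have dc: "ldot (sub C L) M (conv (sub C L) a' b') x = ldot C M (conv C a b) x"
    if "functional C a" "\<And>x. x \<in> L \<Longrightarrow> a' x = a x" "functional C b" "\<And>x. x \<in> L \<Longrightarrow> b' x = b x" "x \<in> carrier M"
    for a a' b b' x
    by (rule d[OF functional_conv[OF C that(1,3)] conv_sub[OF that(1-4)] that(5)])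
  have cl: "functional C a \<Longrightarrow> x \<in> carrier M \<Longrightarrow> ldot C M a x \<in> carrier M" for a x
    using lin_onD(1)[OF ldot_lin[OF vC2 M \<rho>]] .
  have "(\<forall>x\<in>carrier M. \<forall>a b. functional (sub C L) a \<longrightarrow> functional (sub C L) b
         \<longrightarrow> ldot (sub C L) M b (ldot (sub C L) M a x) = ldot (sub C L) M (conv (sub C L) a b) x)
     \<longleftrightarrow> (\<forall>x\<in>carrier M. \<forall>a b. functional C a \<longrightarrow> functional C b
         \<longrightarrow> ldot C M b (ldot C M a x) = ldot C M (conv C a b) x)" (is "?A \<longleftrightarrow> ?B")
  proof (intro iffI ballI allI impI)
    fix x a b assume A: ?A and x: "x \<in> carrier M" and a: "functional C a" and b: "functional C b"
    have "ldot (sub C L) M b (ldot (sub C L) M a x) = ldot (sub C L) M (conv (sub C L) a b) x"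
      using A x functional_sub[OF _ subcoalgD(1)] a b by blast
    then show "ldot C M b (ldot C M a x) = ldot C M (conv C a b) x"
      by (simp add: d[OF a _ x] d[OF b _ cl[OF a x]] dc[OF a _ b _ x])
  next
    fix x a b assume B: ?B and x: "x \<in> carrier M" and ab: "functional (sub C L) a" "functional (sub C L) b"
    obtain a' where a: "functional C a'" "\<And>x. x \<in> L \<Longrightarrow> a x = a' x" using functional_extend[OF ab(1)] by metis
    obtain b' where b: "functional C b'" "\<And>x. x \<in> L \<Longrightarrow> b x = b' x" using functional_extend[OF ab(2)] by metis
    show "ldot (sub C L) M b (ldot (sub C L) M a x) = ldot (sub C L) M (conv (sub C L) a b) x"
      using B x a(1) b(1) by (simp add: d[OF a x] d[OF b cl[OF a(1) x]] dc[OF a b x])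
  qed
  moreover have "ldot (sub C L) M (counit C) x = ldot C M (counit C) x" if "x \<in> carrier M" for x
    by (rule d[OF precoalgD(3)[OF C] _ that]) simp
  ultimately show ?thesis
    unfolding left_comodule_iff[OF C] left_comodule_iff[OF precoalg_sub] using M \<rho> \<rho>' \<rho>L by auto
next
  case False
  have "lin_on M (tensor C M) (lcoact M)" if "lin_on M (tensor (sub C L) M) (lcoact M)"
    by (rule lin_onI) (use lin_onD[OF that] subcoalgD(1) tensor_mono[of _ "sub C L" M C M] in auto)
  then show ?thesis
    using False unfolding left_comodule_def by (auto dest: lin_onD(1))
qed

lemma right_comodule_sub_iff:
  "right_comodule (sub C L) M \<longleftrightarrow> right_comodule C M \<and> (\<forall>x\<in>carrier M. rcoact M x \<in> carrier (tensor M (sub C L)))"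
proof (cases "vspace M \<and> lin_on M (tensor M C) (rcoact M) \<and> (\<forall>x\<in>carrier M. rcoact M x \<in> carrier (tensor M (sub C L)))")
  case True
  then have M: "vspace M" and \<rho>: "lin_on M (tensor M C) (rcoact M)"
    and \<rho>L: "x \<in> carrier M \<Longrightarrow> rcoact M x \<in> carrier (tensor M (sub C L))" for x by auto
  have \<rho>': "lin_on M (tensor M (sub C L)) (rcoact M)"
    by (rule lin_on_mono[OF \<rho>]) (use \<rho>L in auto)
  have d: "rdot (sub C L) M a' x = rdot C M a x"
    if "functional C a" "\<And>x. x \<in> L \<Longrightarrow> a' x = a x" "x \<in> carrier M" for a a' x
    unfolding rdot_def using that by (intro rslice_sub[OF M that(1)] \<rho>L)
  have dc: "rdot (sub C L) M (conv (sub C L) a' b') x = rdot C M (conv C a b) x"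
    if "functional C a" "\<And>x. x \<in> L \<Longrightarrow> a' x = a x" "functional C b" "\<And>x. x \<in> L \<Longrightarrow> b' x = b x" "x \<in> carrier M"
    for a a' b b' x
    by (rule d[OF functional_conv[OF C that(1,3)] conv_sub[OF that(1-4)] that(5)])
  have cl: "functional C a \<Longrightarrow> x \<in> carrier M \<Longrightarrow> rdot C M a x \<in> carrier M" for a x
    using lin_onD(1)[OF rdot_lin[OF vC2 M \<rho>]] .
  have "(\<forall>x\<in>carrier M. \<forall>a b. functional (sub C L) a \<longrightarrow> functional (sub C L) b
         \<longrightarrow> rdot (sub C L) M a (rdot (sub C L) M b x) = rdot (sub C L) M (conv (sub C L) a b) x)
     \<longleftrightarrow> (\<forall>x\<in>carrier M. \<forall>a b. functional C a \<longrightarrow> functional C b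
         \<longrightarrow> rdot C M a (rdot C M b x) = rdot C M (conv C a b) x)" (is "?A \<longleftrightarrow> ?B")
  proof (intro iffI ballI allI impI)
    fix x a b assume A: ?A and x: "x \<in> carrier M" and a: "functional C a" and b: "functional C b"
    have "rdot (sub C L) M a (rdot (sub C L) M b x) = rdot (sub C L) M (conv (sub C L) a b) x"
      using A x functional_sub[OF _ subcoalgD(1)] a b by blast
    then show "rdot C M a (rdot C M b x) = rdot C M (conv C a b) x"
      by (simp add: d[OF b _ x] d[OF a _ cl[OF b x]] dc[OF a _ b _ x])
  next
    fix x a b assume B: ?B and x: "x \<in> carrier M" and ab: "functional (sub C L) a" "functional (sub C L) b"
    obtain a' where a: "functional C a'" "\<And>x. x \<in> L \<Longrightarrow> a x = a' x" using functional_extend[OF ab(1)] by metis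
    obtain b' where b: "functional C b'" "\<And>x. x \<in> L \<Longrightarrow> b x = b' x" using functional_extend[OF ab(2)] by metis
    show "rdot (sub C L) M a (rdot (sub C L) M b x) = rdot (sub C L) M (conv (sub C L) a b) x"
      using B x a(1) b(1) by (simp add: d[OF b x] d[OF a cl[OF b(1) x]] dc[OF a b x])
  qed
  moreover have "rdot (sub C L) M (counit C) x = rdot C M (counit C) x" if "x \<in> carrier M" for x
    by (rule d[OF precoalgD(3)[OF C] _ that]) simp
  ultimately show ?thesis
    unfolding right_comodule_iff[OF C] right_comodule_iff[OF precoalg_sub] using M \<rho> \<rho>' \<rho>L by auto
next
  case False
  have "lin_on M (tensor M C) (rcoact M)" if "lin_on M (tensor M (sub C L)) (rcoact M)"
    by (rule lin_onI) (use lin_onD[OF that] subcoalgD(1) tensor_mono[of _ M "sub C L" M C] in auto)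
  then show ?thesis
    using False unfolding right_comodule_def by (auto dest: lin_onD(1))
qed

lemma lcomod_hom_sub_iff:
  assumes M: "vspace M" and N: "vspace N" and \<rho>: "\<And>x. x \<in> carrier M \<Longrightarrow> lcoact M x \<in> carrier (tensor (sub C L) M)"
  shows "lcomod_hom (sub C L) M N f \<longleftrightarrow> lcomod_hom C M N f"
proof (cases "lin_on M N f")
  case True
  have B: "bilin C M (tensor C N) (\<lambda>c y. tens C N c (f y))"
    using bilin_precomp[OF bilin_tens[OF vC2 N] vC2 M _ True, of "\<lambda>x. x"] by (simp add: lin_on_def)
  have "tlift (sub C L) M (\<lambda>c y. tens C N c (f y)) (lcoact M x) = tlift C M (\<lambda>c y. tens C N c (f y)) (lcoact M x)"
    if "x \<in> carrier M" for x
    by (rule tlift_mono[OF B]) (use subcoalgD \<rho>[OF that] M in auto)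
  then show ?thesis by (simp add: lcomod_hom_def)
qed (simp add: lcomod_hom_def)

lemma rcomod_hom_sub_iff:
  assumes M: "vspace M" and N: "vspace N" and \<rho>: "\<And>x. x \<in> carrier M \<Longrightarrow> rcoact M x \<in> carrier (tensor M (sub C L))"
  shows "rcomod_hom (sub C L) M N f \<longleftrightarrow> rcomod_hom C M N f"
proof (cases "lin_on M N f")
  case True
  have B: "bilin M C (tensor N C) (\<lambda>y c. tens N C (f y) c)"
    using bilin_precomp[OF bilin_tens[OF N vC2] M vC2 True, of "\<lambda>x. x"] by (simp add: lin_on_def)
  have "tlift M (sub C L) (\<lambda>y c. tens N C (f y) c) (rcoact M x) = tlift M C (\<lambda>y c. tens N C (f y) c) (rcoact M x)"
    if "x \<in> carrier M" for x
    by (rule tlift_mono[OF B]) (use subcoalgD \<rho>[OF that] M in auto)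
  then show ?thesis by (simp add: rcomod_hom_def)
qed (simp add: rcomod_hom_def)

end

section \<open>Annihilators of subspaces and subcomodules\<close>

lemma lslice_zero:
  assumes X: "vspace X" and Y: "vspace Y" and w: "w \<in> carrier (tensor X Y)"
  shows "lslice X Y (\<lambda>_. 0) w = 0"
proof -
  have z: "functional X (\<lambda>_. 0)" by (simp add: lin_on_def)
  have "lin_on (tensor X Y) Y (\<lambda>_. 0)" by (simp add: lin_on_def vspace_closed[OF Y] vspace_smul[OF Y])
  from tensor_lin_eqI[OF lslice_lin[OF X Y z] this X _ w] show ?thesis
    by (simp add: lslice_tens[OF X Y z] vspace_smul[OF Y])
qed

lemma rslice_zero:
  assumes X: "vspace X" and Y: "vspace Y" and w: "w \<in> carrier (tensor X Y)"
  shows "rslice X Y (\<lambda>_. 0) w = 0"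
proof -
  have z: "functional Y (\<lambda>_. 0)" by (simp add: lin_on_def)
  have "lin_on (tensor X Y) X (\<lambda>_. 0)" by (simp add: lin_on_def vspace_closed[OF X] vspace_smul[OF X])
  from tensor_lin_eqI[OF rslice_lin[OF X Y z] this X _ w] show ?thesis
    by (simp add: rslice_tens[OF X Y z] vspace_smul[OF X])
qed

text \<open>One direction is \<open>tensor_mem_left\<close>; for the other, a functional vanishing
  on \<open>V\<close> slices tensors over \<open>V\<close> in the same way as zero. Applied to a
  coaction, it detects the elements that live over a subcoalgebra by the annihilator of that
  subcoalgebra.\<close>

lemma tensor_left_iff:
  assumes X: "vspace X" and Y: "vspace Y" and X': "vspace (sub X V)" "V \<subseteq> carrier X"
    and w: "w \<in> carrier (tensor X Y)"
  shows "w \<in> carrier (tensor (sub X V) Y) \<longleftrightarrow> (\<forall>a. functional X a \<longrightarrow> (\<forall>x\<in>V. a x = 0) \<longrightarrow> lslice X Y a w = 0)"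
proof (intro iffI allI impI)
  fix a assume w': "w \<in> carrier (tensor (sub X V) Y)" and a: "functional X a" "\<forall>x\<in>V. a x = 0"
  have "lslice (sub X V) Y (\<lambda>_. 0) w = lslice X Y a w"
    by (rule lslice_mono[OF X Y a(1)]) (use a w' X' Y in auto)
  then show "lslice X Y a w = 0" by (simp add: lslice_zero[OF X'(1) Y w'])
next
  assume "\<forall>a. functional X a \<longrightarrow> (\<forall>x\<in>V. a x = 0) \<longrightarrow> lslice X Y a w = 0"
  then show "w \<in> carrier (tensor (sub X V) Y)"
    by (intro tensor_mem_left[OF w X Y]) (use X' in auto)
qed

lemma tensor_right_iff:
  assumes X: "vspace X" and Y: "vspace Y" and Y': "vspace (sub Y V)" "V \<subseteq> carrier Y"
    and w: "w \<in> carrier (tensor X Y)"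
  shows "w \<in> carrier (tensor X (sub Y V)) \<longleftrightarrow> (\<forall>a. functional Y a \<longrightarrow> (\<forall>x\<in>V. a x = 0) \<longrightarrow> rslice X Y a w = 0)"
proof (intro iffI allI impI)
  fix a assume w': "w \<in> carrier (tensor X (sub Y V))" and a: "functional Y a" "\<forall>x\<in>V. a x = 0"
  have "rslice X (sub Y V) (\<lambda>_. 0) w = rslice X Y a w"
    by (rule rslice_mono[OF X Y a(1)]) (use a w' Y' X in auto)
  then show "rslice X Y a w = 0" by (simp add: rslice_zero[OF X Y'(1) w'])
next
  assume "\<forall>a. functional Y a \<longrightarrow> (\<forall>x\<in>V. a x = 0) \<longrightarrow> rslice X Y a w = 0"
  then show "w \<in> carrier (tensor X (sub Y V))"
    by (intro tensor_mem_right'[OF w X Y]) (use Y' in auto)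
qed

lemma left_comoduleD:
  assumes C: "precoalg C" and M: "left_comodule C M"
  shows "vspace M" "lin_on M (tensor C M) (lcoact M)" "x \<in> carrier M \<Longrightarrow> lcoact M x \<in> carrier (tensor C M)"
    "functional C a \<Longrightarrow> lin_on M M (ldot C M a)"
    "functional C a \<Longrightarrow> x \<in> carrier M \<Longrightarrow> ldot C M a x \<in> carrier M"
    "functional C a \<Longrightarrow> functional C b \<Longrightarrow> x \<in> carrier M \<Longrightarrow> ldot C M b (ldot C M a x) = ldot C M (conv C a b) x"
    "x \<in> carrier M \<Longrightarrow> ldot C M (counit C) x = x"
  using M ldot_lin[OF precoalgD(1)[OF C], of M a] unfolding left_comodule_iff[OF C] by (auto dest: lin_onD)

lemma right_comoduleD:
  assumes C: "precoalg C" and M: "right_comodule C M"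
  shows "vspace M" "lin_on M (tensor M C) (rcoact M)" "x \<in> carrier M \<Longrightarrow> rcoact M x \<in> carrier (tensor M C)"
    "functional C a \<Longrightarrow> lin_on M M (rdot C M a)"
    "functional C a \<Longrightarrow> x \<in> carrier M \<Longrightarrow> rdot C M a x \<in> carrier M"
    "functional C a \<Longrightarrow> functional C b \<Longrightarrow> x \<in> carrier M \<Longrightarrow> rdot C M a (rdot C M b x) = rdot C M (conv C a b) x"
    "x \<in> carrier M \<Longrightarrow> rdot C M (counit C) x = x"
  using M rdot_lin[OF precoalgD(1)[OF C], of M a] unfolding right_comodule_iff[OF C] by (auto dest: lin_onD)

text \<open>The values of the action are the slices of the coaction, so stability of
  \<open>N\<close> under the action forces the coaction of \<open>N\<close> into C \<otimes> N by
  \<open>tensor_mem_right\<close>.\<close>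

lemma left_comodule_subset:
  assumes C: "precoalg C" and M: "left_comodule C M"
    and N: "N \<subseteq> carrier M" "vspace (sub M N)" "\<And>x a. x \<in> N \<Longrightarrow> functional C a \<Longrightarrow> ldot C M a x \<in> N"
  shows "left_comodule C (sub M N)" "x \<in> N \<Longrightarrow> lcoact M x \<in> carrier (tensor C (sub M N))"
    "x \<in> N \<Longrightarrow> functional C a \<Longrightarrow> ldot C (sub M N) a x = ldot C M a x"
proof -
  note D = left_comoduleD[OF C M] and vC = precoalgD(1)[OF C]
  show mem: "lcoact M x \<in> carrier (tensor C (sub M N))" if "x \<in> N" for x
    by (rule tensor_mem_right[OF D(3) vC D(1)]) (use N that in \<open>auto simp: ldot_def\<close>)
  show eq: "ldot C (sub M N) a x = ldot C M a x" if "x \<in> N" "functional C a" for x a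
    unfolding ldot_def lcomod.simps space.simps
    by (simp, rule lslice_mono[OF vC D(1) that(2)]) (use N mem[OF that(1)] vC in auto)
  have "lin_on (sub M N) (tensor C (sub M N)) (lcoact M)"
    by (rule lin_on_mono[OF D(2)]) (use N mem in auto)
  then show "left_comodule C (sub M N)"
    unfolding left_comodule_iff[OF C] using N D
    by (auto simp: eq subset_iff functional_conv[OF C] precoalgD(3)[OF C])
qed

lemma right_comodule_subset:
  assumes C: "precoalg C" and M: "right_comodule C M"
    and N: "N \<subseteq> carrier M" "vspace (sub M N)" "\<And>x a. x \<in> N \<Longrightarrow> functional C a \<Longrightarrow> rdot C M a x \<in> N"
  shows "right_comodule C (sub M N)" "x \<in> N \<Longrightarrow> rcoact M x \<in> carrier (tensor (sub M N) C)"
    "x \<in> N \<Longrightarrow> functional C a \<Longrightarrow> rdot C (sub M N) a x = rdot C M a x"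
proof -
  note D = right_comoduleD[OF C M] and vC = precoalgD(1)[OF C]
  show mem: "rcoact M x \<in> carrier (tensor (sub M N) C)" if "x \<in> N" for x
    by (rule tensor_mem_left'[OF D(3) D(1) vC]) (use N that in \<open>auto simp: rdot_def\<close>)
  show eq: "rdot C (sub M N) a x = rdot C M a x" if "x \<in> N" "functional C a" for x a
    unfolding rdot_def
    by (simp, rule rslice_mono[OF D(1) vC that(2)]) (use N mem[OF that(1)] vC in auto)
  have "lin_on (sub M N) (tensor (sub M N) C) (rcoact M)"
    by (rule lin_on_mono[OF D(2)]) (use N mem in auto)
  then show "right_comodule C (sub M N)"
    unfolding right_comodule_iff[OF C] using N D
    by (auto simp: eq subset_iff functional_conv[OF C] precoalgD(3)[OF C])
qed

text \<open>\<open>L\<close> is stable under \<open>lhit\<close>, hence a subcomodule of the left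
  regular comodule; by \<open>coalgebra_iff\<close> only the right counit law is left, and it is one
  of the hit laws.\<close>

lemma coalgebra_sub:
  assumes C: "coalgebra C" and L: "subcoalg C L"
  shows "coalgebra (sub C L)"
proof -
  note P = coalgebra_precoalg[OF C]
  note LD = subcoalgD[OF P L]
  have l: "ldot C (lregular C) a = (\<lambda>c. lhit C a c)" for a
    by (simp add: ldot_def[abs_def] lslice_space_cong[of C C "lregular C" C])
  have "left_comodule C ((lregular C)\<lparr>carrier := L\<rparr>)"
    by (rule left_comodule_subset(1)[OF P])
      (use C LD hit_in_sub[OF P L] in \<open>auto simp: coalgebra_iff l vspace_def\<close>)
  moreover have "tensor (sub C L) (lregular (sub C L)) = tensor (sub C L) (sub C L)"
    by (rule tensor_cong) auto
  ultimately have "left_comodule (sub C L) (lregular (sub C L))"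
    unfolding left_comodule_sub_iff[OF P L] using LD by simp
  moreover have "rslice (sub C L) (sub C L) (counit (sub C L)) (comult (sub C L) c) = c" if "c \<in> L" for c
    using rhit_sub[OF P L precoalgD(3)[OF P] _ that, of "counit C"] hit_laws(5)[OF C LD(3)[OF that] precoalgD(3)[OF P] precoalgD(3)[OF P]]
    by simp
  ultimately show ?thesis
    unfolding coalgebra_iff using precoalg_sub[OF P L] by simp
qed

text \<open>Stability under \<open>lhit\<close> puts \<Delta>(W) into C \<otimes> W through left
  slices; stability under \<open>rhit\<close> then puts it into W \<otimes> W through right slices,
  where a functional on \<open>W\<close> is extended to \<open>C\<close>.\<close>

lemma fd_subcoalgebraI:
  assumes C: "precoalg C" and W: "W \<subseteq> carrier C" "module.subspace (smul C) W" "findim (sub C W)"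
    and hit: "\<And>x a. x \<in> W \<Longrightarrow> functional C a \<Longrightarrow> lhit C a x \<in> W" "\<And>x a. x \<in> W \<Longrightarrow> functional C a \<Longrightarrow> rhit C a x \<in> W"
  shows "W \<in> fd_subcoalgebras C"
proof -
  note vC = precoalgD(1)[OF C]
  note vW = vspace_sub[OF vC W(2)]
  have "comult C x \<in> carrier (tensor (sub C W) (sub C W))" if x: "x \<in> W" for x
  proof (rule tensor_mem_left'[OF _ vC vW])
    have \<Delta>: "comult C x \<in> carrier (tensor C C)"
      using lin_onD(1)[OF precoalgD(2)[OF C]] x W by blast
    show 1: "comult C x \<in> carrier (tensor C (sub C W))"
      by (rule tensor_mem_right[OF \<Delta> vC vC]) (use W vW hit x in auto)
    fix a assume "functional (sub C W) a"
    then obtain a' where a': "functional C a'" "\<And>x. x \<in> W \<Longrightarrow> a' x = a x"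
      using lin_on_extend[OF vC W(2)] by metis
    have "rslice C (sub C W) a (comult C x) = rslice C C a' (comult C x)"
      by (rule rslice_mono[OF vC vC a'(1)]) (use a' W vW vC 1 in auto)
    then show "rslice C (sub C W) a (comult C x) \<in> carrier (sub C W)"
      using hit(2)[OF x a'(1)] by simp
  qed (use W vW in auto)
  then show ?thesis
    using W by (auto simp: fd_subcoalgebras_def)
qed

section \<open>Local finiteness of coalgebras and directedness of the finite-dimensional
  subcoalgebras\<close>

lemma span_sub: "vspace X \<Longrightarrow> S \<subseteq> carrier X \<Longrightarrow> module.span (smul X) S \<subseteq> carrier X"
  using module.span_minimal[OF vspaceD(2)] vspaceD(3) by metis

lemma lin_on_span:
  assumes X: "vspace X" and Y: "vspace Y" and f: "lin_on X Y f" and S: "S \<subseteq> carrier X"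
    and V: "module.subspace (smul Y) V" and x: "x \<in> module.span (smul X) S" and *: "\<And>s. s \<in> S \<Longrightarrow> f s \<in> V"
  shows "f x \<in> V"
proof -
  interpret X: vector_space "smul X" using X by (rule vspaceD)
  interpret Y: vector_space "smul Y" using Y by (rule vspaceD)
  have "x \<in> carrier X \<and> f x \<in> V"
    using x
  proof (induction rule: X.span_induct_alt)
    case base
    then show ?case using lin_on_zero[OF X f] vspace_closed[OF X] Y.subspace_0[OF V] by simp
  next
    case (step c v w)
    then have "f v \<in> V" "v \<in> carrier X" using S * by auto
    then show ?case
      using step Y.subspace_add[OF V] Y.subspace_scale[OF V]
      by (auto simp: lin_onD[OF f] vspace_closed[OF X])
  qed
  then show ?thesis ..
qed

text \<open>The sub-bimodule (for the dual algebra) generated by one element is finite-dimensional.\<close>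

theorem fundamental_theorem_coalgebras:
  assumes C: "coalgebra C" and c: "c \<in> carrier C"
  obtains L where "L \<in> fd_subcoalgebras C" "c \<in> L"
proof -
  note P = coalgebra_precoalg[OF C]
  note vC = precoalgD(1)[OF P] and \<Delta> = precoalgD(2)[OF P] and \<epsilon> = precoalgD(3)[OF P]
  interpret V: vector_space "smul C" using vC by (rule vspaceD)
  \<comment> \<open>Writing \<Delta> x as a sum of pure tensors puts all hits of x into the span of
    the finitely many factors that occur.\<close>
  have "\<exists>F. finite F \<and> F \<subseteq> carrier C \<and> (\<forall>a. functional C a \<longrightarrow> lhit C a x \<in> V.span F \<and> rhit C a x \<in> V.span F)"
    if x: "x \<in> carrier C" for x
  proof -
    obtain ps where ps: "set ps \<subseteq> carrier C \<times> carrier C" "comult C x = (\<Sum>(u, v)\<leftarrow>ps. tens C C u v)"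
      using tensor_rep[OF lin_onD(1)[OF \<Delta> x] vC] .
    let ?F = "fst ` set ps \<union> snd ` set ps"
    have 1: "(\<Sum>(u, v)\<leftarrow>qs. smul C (f u v) (g u v)) \<in> V.span ?F"
      if "\<And>u v. (u, v) \<in> set qs \<Longrightarrow> g u v \<in> ?F" for qs :: "('b \<times> 'b) list" and f g
      using that
    proof (induction qs)
      case (Cons q qs)
      obtain u v where q: "q = (u, v)" by (cases q)
      have "smul C (f u v) (g u v) \<in> V.span ?F"
        by (intro V.span_scale V.span_base Cons.prems) (simp add: q)
      with Cons show ?case by (simp add: q V.span_add)
    qed (simp add: V.span_zero)
    have "lhit C a x \<in> V.span ?F \<and> rhit C a x \<in> V.span ?F" if a: "functional C a" for a
      unfolding ps(2) lslice_def rslice_def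
      unfolding tlift_list[OF bilin_lslice[OF vC vC a] ps(1)] tlift_list[OF bilin_rslice[OF vC vC a] ps(1)]
      by (intro conjI 1) force+
    then show ?thesis using ps(1) by (intro exI[of _ ?F]) auto
  qed
  then have "\<forall>x\<in>carrier C. \<exists>F. finite F \<and> F \<subseteq> carrier C
      \<and> (\<forall>a. functional C a \<longrightarrow> lhit C a x \<in> V.span F \<and> rhit C a x \<in> V.span F)" by blast
  from bchoice[OF this] obtain F where "\<forall>x\<in>carrier C. finite (F x) \<and> F x \<subseteq> carrier C
      \<and> (\<forall>a. functional C a \<longrightarrow> lhit C a x \<in> V.span (F x) \<and> rhit C a x \<in> V.span (F x))" by blast
  then have F: "finite (F x)" "F x \<subseteq> carrier C"
      "functional C a \<Longrightarrow> lhit C a x \<in> V.span (F x)" "functional C a \<Longrightarrow> rhit C a x \<in> V.span (F x)"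
    if "x \<in> carrier C" for x a
    using that by blast+
  \<comment> \<open>All two-sided hits of c; as the actions are associative and commute,
    \<open>G\<close> is stable under both. \<open>K\<close> collects the finite sets belonging to
    the finitely many elements of \<open>F c\<close> and so bounds the span of
    \<open>G\<close>.\<close>
  define G where "G = {rhit C b (lhit C a c) | a b. functional C a \<and> functional C b}"
  define K where "K = \<Union>(F ` F c)"
  have cl: "lhit C a x \<in> carrier C" "rhit C a x \<in> carrier C" if "functional C a" "x \<in> carrier C" for a x
    using lin_onD(1)[OF lhit_lin[OF P that(1)]] lin_onD(1)[OF rhit_lin[OF P that(1)]] that(2) by auto
  have GC: "G \<subseteq> carrier C" using cl c by (auto simp: G_def)
  have "rhit C b (lhit C a c) \<in> V.span K" if "functional C a" "functional C b" for a b
  proof (rule lin_on_span[OF vC vC rhit_lin[OF P that(2)] F(2)[OF c] V.subspace_span F(3)[OF c that(1)]])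
    fix s assume s: "s \<in> F c"
    then have "s \<in> carrier C" using F(2)[OF c] by blast
    from F(4)[OF this that(2)] show "rhit C b s \<in> V.span K"
      using V.span_mono[of "F s" K] s by (auto simp: K_def)
  qed
  then have GK: "V.span G \<subseteq> V.span K"
    by (intro V.span_minimal V.subspace_span) (auto simp: G_def)
  have "finite K" using F(1,2) c by (auto simp: K_def)
  have "V.span G \<in> fd_subcoalgebras C"
  proof (rule fd_subcoalgebraI[OF P])
    show "V.span G \<subseteq> carrier C" using span_sub[OF vC GC] .
    show "findim (sub C (V.span G))"
      by (rule findim_subspace[OF vC V.subspace_span \<open>finite K\<close> GK])
    fix x a assume x: "x \<in> V.span G" and a: "functional C a"
    show "lhit C a x \<in> V.span G"
    proof (rule lin_on_span[OF vC vC lhit_lin[OF P a] GC V.subspace_span x])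
      fix s assume "s \<in> G"
      then obtain a' b where *: "s = rhit C b (lhit C a' c)" "functional C a'" "functional C b"
        by (auto simp: G_def)
      have "lhit C a s = rhit C b (lhit C (conv C a' a) c)"
        unfolding * using hit_laws(3)[OF C cl(1)[OF *(2) c] *(3) a] hit_laws(1)[OF C c *(2) a] by simp
      then show "lhit C a s \<in> V.span G"
        using * functional_conv[OF P *(2) a] by (intro V.span_base) (auto simp: G_def)
    qed
    show "rhit C a x \<in> V.span G"
    proof (rule lin_on_span[OF vC vC rhit_lin[OF P a] GC V.subspace_span x])
      fix s assume "s \<in> G"
      then obtain a' b where *: "s = rhit C b (lhit C a' c)" "functional C a'" "functional C b"
        by (auto simp: G_def)
      have "rhit C a s = rhit C (conv C a b) (lhit C a' c)"
        unfolding * using hit_laws(2)[OF C cl(1)[OF *(2) c] a *(3)] by simp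
      then show "rhit C a s \<in> V.span G"
        using * functional_conv[OF P a *(3)] by (intro V.span_base) (auto simp: G_def)
    qed
  qed (rule V.subspace_span)
  \<comment> \<open>The counit acts as the identity from both sides, so c is itself one of the
    generators.\<close>
  moreover have "c = rhit C (counit C) (lhit C (counit C) c)"
    using hit_laws(4,5)[OF C c \<epsilon> \<epsilon>] by simp
  then have "c \<in> V.span G"
    using \<epsilon> by (intro V.span_base) (auto simp: G_def)
  ultimately show thesis using that by blast
qed

text \<open>Both hit actions preserve each summand, hence the sum, and the two finite spanning sets
  together span it. This is what makes the index sets of the limits directed.\<close>

lemma fd_subcoalgebras_Un:
  assumes C: "coalgebra C" and L: "L \<in> fd_subcoalgebras C" "L' \<in> fd_subcoalgebras C"
  shows "module.span (smul C) (L \<union> L') \<in> fd_subcoalgebras C"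
proof -
  note P = coalgebra_precoalg[OF C]
  note vC = precoalgD(1)[OF P]
  interpret V: vector_space "smul C" using vC by (rule vspaceD)
  have L': "subcoalg C L" "subcoalg C L'" using L by (auto simp: fd_subcoalgebras_iff)
  have LC: "L \<union> L' \<subseteq> carrier C" using L' by (auto simp: subcoalg_def)
  obtain B B' where B: "finite B" "V.span B = L" "finite B'" "V.span B' = L'"
    using L by (auto simp: fd_subcoalgebras_iff findim_def)
  have "V.span (L \<union> L') \<subseteq> V.span (B \<union> B')"
    using B V.span_mono[of B "B \<union> B'"] V.span_mono[of B' "B \<union> B'"] by (intro V.span_minimal V.subspace_span) auto
  with B(1,3) have "findim (sub C (V.span (L \<union> L')))"
    by (intro findim_subspace[OF vC, of _ "B \<union> B'"]) auto
  then show ?thesis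
  proof (intro fd_subcoalgebraI[OF P] span_sub[OF vC LC] V.subspace_span)
    fix x a assume x: "x \<in> V.span (L \<union> L')" and a: "functional C a"
    show "lhit C a x \<in> V.span (L \<union> L')"
      by (rule lin_on_span[OF vC vC lhit_lin[OF P a] LC V.subspace_span x])
        (use hit_in_sub(1)[OF P L'(1) a] hit_in_sub(1)[OF P L'(2) a] in \<open>auto intro: V.span_base\<close>)
    show "rhit C a x \<in> V.span (L \<union> L')"
      by (rule lin_on_span[OF vC vC rhit_lin[OF P a] LC V.subspace_span x])
        (use hit_in_sub(2)[OF P L'(1) a] hit_in_sub(2)[OF P L'(2) a] in \<open>auto intro: V.span_base\<close>)
  qed
qed

lemma fd_subcoalgebra_containing:
  assumes C: "coalgebra C" and L: "L \<in> fd_subcoalgebras C" and S: "finite S" "S \<subseteq> carrier C"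
  obtains L' where "L' \<in> fd_subcoalgebras C" "L \<subseteq> L'" "S \<subseteq> L'"
proof -
  have "\<exists>L'. L' \<in> fd_subcoalgebras C \<and> L \<subseteq> L' \<and> S \<subseteq> L'"
    using S
  proof (induction rule: finite_induct)
    case empty
    then show ?case using L by blast
  next
    case (insert x F)
    then obtain L1 where L1: "L1 \<in> fd_subcoalgebras C" "L \<subseteq> L1" "F \<subseteq> L1" by auto
    obtain L2 where L2: "L2 \<in> fd_subcoalgebras C" "x \<in> L2"
      using fundamental_theorem_coalgebras[OF C, of x] insert by auto
    have "L1 \<union> L2 \<subseteq> module.span (smul C) (L1 \<union> L2)"
      by (rule module.span_superset[OF vspaceD(2)]) (rule precoalgD[OF coalgebra_precoalg[OF C]])
    then show ?case
      using L1 L2 fd_subcoalgebras_Un[OF C L1(1) L2(1)] by blast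
  qed
  then show thesis using that by blast
qed

lemma fd_subcoalgebras_nonempty:
  assumes C: "coalgebra C"
  shows "fd_subcoalgebras C \<noteq> {}"
proof -
  have "0 \<in> carrier C" by (rule vspace_closed(1)[OF precoalgD(1)[OF coalgebra_precoalg[OF C]]])
  then obtain L where "L \<in> fd_subcoalgebras C" by (rule fundamental_theorem_coalgebras[OF C])
  then show ?thesis by blast
qed

lemma fd_subcoalgebras_directed:
  assumes C: "coalgebra C" and L: "L \<in> fd_subcoalgebras C" "L' \<in> fd_subcoalgebras C"
  obtains L'' where "L'' \<in> fd_subcoalgebras C" "L \<subseteq> L''" "L' \<subseteq> L''"
proof -
  have "L \<union> L' \<subseteq> module.span (smul C) (L \<union> L')"
    by (rule module.span_superset[OF vspaceD(2)]) (rule precoalgD[OF coalgebra_precoalg[OF C]])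
  then show thesis by (intro that[OF fd_subcoalgebras_Un[OF C L]]) auto
qed

section \<open>Direct limits of comodules\<close>

context
  fixes C :: "('k::field, 'c::ab_group_add) coalg" and D :: "'i::order set"
    and X :: "'i \<Rightarrow> ('k, 'c, 'x::ab_group_add) lcomod" and t :: "'i \<Rightarrow> 'i \<Rightarrow> 'x \<Rightarrow> 'x"
  assumes C: "precoalg C" and sys: "direct_system C D X t"
begin

private lemmas vC3 = precoalgD(1)[OF C]

lemma direct_systemD:
  "i \<in> D \<Longrightarrow> left_comodule C (X i)" "i \<in> D \<Longrightarrow> vspace (X i)"
  "i \<in> D \<Longrightarrow> j \<in> D \<Longrightarrow> i \<le> j \<Longrightarrow> lcomod_hom C (X i) (X j) (t i j)"
  "i \<in> D \<Longrightarrow> j \<in> D \<Longrightarrow> i \<le> j \<Longrightarrow> lin_on (X i) (X j) (t i j)"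
  using sys by (auto simp: direct_system_def left_comodule_def lcomod_hom_def)

lemma direct_system_directed:
  assumes "i \<in> D" "j \<in> D"
  obtains k where "k \<in> D" "i \<le> k" "j \<le> k"
proof -
  have "\<forall>i\<in>D. \<forall>j\<in>D. \<exists>k\<in>D. i \<le> k \<and> j \<le> k" using sys by (simp add: direct_system_def)
  with assms have "\<exists>k\<in>D. i \<le> k \<and> j \<le> k" by simp
  then show thesis using that by blast
qed

lemma lim_in_add:
  "i \<in> D \<Longrightarrow> x \<in> carrier (X i) \<Longrightarrow> y \<in> carrier (X i) \<Longrightarrow> lim_in D X t i (x + y) = lim_in D X t i x + lim_in D X t i y"
  by (auto simp: lim_in_def fun_eq_iff compatible_def plus_fun_apply dest: lin_onD(2))

lemma lim_in_smul:
  "i \<in> D \<Longrightarrow> x \<in> carrier (X i) \<Longrightarrow> lim_in D X t i (smul (X i) a x) = pw (*) a (lim_in D X t i x)"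
  by (auto simp: lim_in_def fun_eq_iff compatible_def pw_def lin_on_def)

lemma lim_in_trans:
  "i \<in> D \<Longrightarrow> j \<in> D \<Longrightarrow> i \<le> j \<Longrightarrow> x \<in> carrier (X i) \<Longrightarrow> lim_in D X t j (t i j x) = lim_in D X t i x"
  by (auto simp: lim_in_def fun_eq_iff compatible_def)

lemma lim_in_in: "i \<in> D \<Longrightarrow> x \<in> carrier (X i) \<Longrightarrow> lim_in D X t i x \<in> carrier (lim_space D X t)"
  by (auto simp: lim_space_def)

lemma lim_space_smul [simp]: "smul (lim_space D X t) = pw (*)"
  by (simp add: lim_space_def)

lemma lim_space_cases:
  assumes "y \<in> carrier (lim_space D X t)"
  obtains i x where "i \<in> D" "x \<in> carrier (X i)" "y = lim_in D X t i x"
  using assms by (auto simp: lim_space_def)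

text \<open>Directedness moves two classes to a common stage, where their sum can be
  computed.\<close>

lemma lim_space_cases2:
  assumes "y \<in> carrier (lim_space D X t)" "z \<in> carrier (lim_space D X t)"
  obtains i x x' where "i \<in> D" "x \<in> carrier (X i)" "x' \<in> carrier (X i)" "y = lim_in D X t i x" "z = lim_in D X t i x'"
proof -
  obtain i x where i: "i \<in> D" "x \<in> carrier (X i)" "y = lim_in D X t i x" using assms by (rule_tac lim_space_cases)
  obtain j x' where j: "j \<in> D" "x' \<in> carrier (X j)" "z = lim_in D X t j x'" using assms by (rule_tac lim_space_cases)
  obtain k where k: "k \<in> D" "i \<le> k" "j \<le> k" using direct_system_directed[OF i(1) j(1)] .
  show thesis
    using that[OF k(1) lin_onD(1)[OF direct_systemD(4)[OF i(1) k(1,2)] i(2)] lin_onD(1)[OF direct_systemD(4)[OF j(1) k(1,3)] j(2)]]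
      lim_in_trans[OF i(1) k(1,2) i(2)] lim_in_trans[OF j(1) k(1,3) j(2)] i(3) j(3) by simp
qed

lemma lim_in_lin: "i \<in> D \<Longrightarrow> lin_on (X i) (lim_space D X t) (lim_in D X t i)"
  by (simp add: lin_on_def lim_in_in lim_in_add lim_in_smul)

lemma vspace_lim_space: "vspace (lim_space D X t)"
proof -
  have ne: "D \<noteq> {}" using sys by (simp add: direct_system_def)
  have "vspace \<lparr>carrier = carrier (lim_space D X t), smul = pw (*)\<rparr>"
  proof (rule vspace_pwI)
    show "vector_space ((*) :: 'k \<Rightarrow> 'k \<Rightarrow> 'k)" using vspaceD(1)[OF vspace_kspace] by simp
    obtain i where i: "i \<in> D" using ne by blast
    have "lim_in D X t i 0 = 0" by (rule lin_on_zero[OF direct_systemD(2)[OF i] lim_in_lin[OF i]])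
    then show "0 \<in> carrier (lim_space D X t)"
      using lim_in_in[OF i vspace_closed(1)[OF direct_systemD(2)[OF i]]] by simp
    show "y + z \<in> carrier (lim_space D X t)" if "y \<in> carrier (lim_space D X t)" "z \<in> carrier (lim_space D X t)" for y z
      using that by (rule lim_space_cases2) (auto simp flip: lim_in_add intro!: lim_in_in vspace_closed direct_systemD)
    show "pw (*) a y \<in> carrier (lim_space D X t)" if "y \<in> carrier (lim_space D X t)" for a y
      using that by (rule lim_space_cases) (auto simp flip: lim_in_smul intro!: lim_in_in vspace_closed direct_systemD)
  qed
  then show ?thesis by (simp add: lim_space_def)
qed

text \<open>\<open>lim_lift\<close> is a definite description over all representatives of a class.
  Two of them become equal at a later stage by \<open>lim_in_eq_iff\<close>, and compatibility of
  \<open>g\<close> then makes the described value unique.\<close>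

lemma lim_lift_in:
  assumes g: "\<And>i j x. i \<in> D \<Longrightarrow> j \<in> D \<Longrightarrow> i \<le> j \<Longrightarrow> x \<in> carrier (X i) \<Longrightarrow> g j (t i j x) = g i x"
    and i: "i \<in> D" "x \<in> carrier (X i)"
  shows "lim_lift D X t g (lim_in D X t i x) = g i x"
  unfolding lim_lift_def
proof (rule the_equality)
  show "\<exists>j\<in>D. \<exists>y\<in>carrier (X j). lim_in D X t i x = lim_in D X t j y \<and> g i x = g j y"
    using i by blast
  fix z assume "\<exists>j\<in>D. \<exists>y\<in>carrier (X j). lim_in D X t i x = lim_in D X t j y \<and> z = g j y"
  then obtain j y where j: "j \<in> D" "y \<in> carrier (X j)" "lim_in D X t i x = lim_in D X t j y" "z = g j y" by blast
  then obtain k where k: "k \<in> D" "i \<le> k" "j \<le> k" "t i k x = t j k y"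
    using lim_in_eq_iff[OF sys i j(1,2)] by blast
  have "g i x = g k (t i k x)" by (rule g[symmetric]) (use i k in auto)
  also have "\<dots> = g j y" unfolding k(4) by (rule g) (use j k in auto)
  finally show "z = g i x" using j by simp
qed

lemma lim_lift_lin:
  assumes g: "\<And>i j x. i \<in> D \<Longrightarrow> j \<in> D \<Longrightarrow> i \<le> j \<Longrightarrow> x \<in> carrier (X i) \<Longrightarrow> g j (t i j x) = g i x"
    and lin: "\<And>i. i \<in> D \<Longrightarrow> lin_on (X i) Z (g i)"
  shows "lin_on (lim_space D X t) Z (lim_lift D X t g)"
proof (rule lin_onI)
  note v = vspace_closed[OF direct_systemD(2)]
  show "lim_lift D X t g y \<in> carrier Z" if "y \<in> carrier (lim_space D X t)" for y
    using that by (rule lim_space_cases) (simp add: lim_lift_in[of g, OF g] lin_onD[OF lin])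
  show "lim_lift D X t g (y + z) = lim_lift D X t g y + lim_lift D X t g z"
    if "y \<in> carrier (lim_space D X t)" "z \<in> carrier (lim_space D X t)" for y z
    using that by (rule lim_space_cases2) (simp add: lim_lift_in[of g, OF g] lin_onD[OF lin] v flip: lim_in_add)
  show "lim_lift D X t g (smul (lim_space D X t) a y) = smul Z a (lim_lift D X t g y)"
    if "y \<in> carrier (lim_space D X t)" for a y
    using that by (rule lim_space_cases) (simp add: lim_lift_in[of g, OF g] lin_onD[OF lin] v flip: lim_in_smul)
qed

lemma dirlim_simps [simp]:
  "carrier (dirlim C D X t) = carrier (lim_space D X t)" "smul (dirlim C D X t) = pw (*)"
  by (simp_all add: dirlim_def)

lemma vspace_dirlim: "vspace (dirlim C D X t)"
  using vspace_lim_space by (simp add: vspace_def)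

lemma lin_on_dirlim: "lin_on (dirlim C D X t) Z f \<longleftrightarrow> lin_on (lim_space D X t) Z f"
    "lin_on Y (dirlim C D X t) h \<longleftrightarrow> lin_on Y (lim_space D X t) h"
  by (simp_all add: lin_on_def)

lemma tensor_dirlim: "tensor C (dirlim C D X t) = tensor C (lim_space D X t)" "tens C (dirlim C D X t) = tens C (lim_space D X t)"
  by (rule tensor_cong tens_cong; simp)+

text \<open>The transition maps commute with the coactions and become identities in the limit. This
  is the well-definedness of the coaction on \<open>dirlim\<close>.\<close>

lemma dirlim_coact_compat:
  assumes i: "i \<in> D" "j \<in> D" "i \<le> j" "x \<in> carrier (X i)"
  shows "tlift C (X j) (\<lambda>c z. tens C (lim_space D X t) c (lim_in D X t j z)) (lcoact (X j) (t i j x))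
    = tlift C (X i) (\<lambda>c z. tens C (lim_space D X t) c (lim_in D X t i z)) (lcoact (X i) x)"
proof -
  have w: "lcoact (X i) x \<in> carrier (tensor C (X i))" using left_comoduleD(3)[OF C direct_systemD(1)[OF i(1)] i(4)] .
  have B: "bilin C (X j) (tensor C (lim_space D X t)) (\<lambda>c z. tens C (lim_space D X t) c (lim_in D X t j z))" if "j \<in> D" for j
    using bilin_precomp[OF bilin_tens[OF vC3 vspace_lim_space] vC3 direct_systemD(2)[OF that] _ lim_in_lin[OF that], of "\<lambda>x. x"]
    by (simp add: lin_on_def)
  have B': "bilin C (X i) (tensor C (X j)) (\<lambda>c z. tens C (X j) c (t i j z))"
    using bilin_precomp[OF bilin_tens[OF vC3 direct_systemD(2)[OF i(2)]] vC3 direct_systemD(2)[OF i(1)] _ direct_systemD(4)[OF i(1-3)], of "\<lambda>x. x"]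
    by (simp add: lin_on_def)
  have "lcoact (X j) (t i j x) = tlift C (X i) (\<lambda>c z. tens C (X j) c (t i j z)) (lcoact (X i) x)"
    using direct_systemD(3)[OF i(1-3)] i(4) by (simp add: lcomod_hom_def)
  then have "tlift C (X j) (\<lambda>c z. tens C (lim_space D X t) c (lim_in D X t j z)) (lcoact (X j) (t i j x))
     = tlift C (X i) (\<lambda>c y. tlift C (X j) (\<lambda>c z. tens C (lim_space D X t) c (lim_in D X t j z)) (tens C (X j) c (t i j y))) (lcoact (X i) x)"
    using tlift_comp[OF B' vspace_tensor tlift_lin[OF B[OF i(2)]] w] by simp
  also have "\<dots> = tlift C (X i) (\<lambda>c z. tens C (lim_space D X t) c (lim_in D X t i z)) (lcoact (X i) x)"
    by (rule tlift_cong[OF bilin_comp[OF B' vspace_tensor tlift_lin[OF B[OF i(2)]]] _ w])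
      (use i in \<open>simp add: tlift_tens[OF B] lin_onD[OF direct_systemD(4)] lim_in_trans\<close>)
  finally show ?thesis .
qed

lemma lcoact_dirlim:
  "i \<in> D \<Longrightarrow> x \<in> carrier (X i) \<Longrightarrow> lcoact (dirlim C D X t) (lim_in D X t i x)
    = tlift C (X i) (\<lambda>c z. tens C (lim_space D X t) c (lim_in D X t i z)) (lcoact (X i) x)"
  unfolding dirlim_def lcomod.simps by (rule lim_lift_in[OF dirlim_coact_compat])

lemma lcoact_dirlim_lin: "lin_on (dirlim C D X t) (tensor C (dirlim C D X t)) (lcoact (dirlim C D X t))"
  unfolding lin_on_dirlim tensor_dirlim unfolding dirlim_def lcomod.simps
proof (rule lim_lift_lin[OF dirlim_coact_compat])
  fix i assume i: "i \<in> D"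
  have "bilin C (X i) (tensor C (lim_space D X t)) (\<lambda>c z. tens C (lim_space D X t) c (lim_in D X t i z))"
    using bilin_precomp[OF bilin_tens[OF vC3 vspace_lim_space] vC3 direct_systemD(2)[OF i] _ lim_in_lin[OF i], of "\<lambda>x. x"]
    by (simp add: lin_on_def)
  from lin_on_comp[OF left_comoduleD(2)[OF C direct_systemD(1)[OF i]] tlift_lin[OF this]]
  show "lin_on (X i) (tensor C (lim_space D X t))
      (\<lambda>x. tlift C (X i) (\<lambda>c z. tens C (lim_space D X t) c (lim_in D X t i z)) (lcoact (X i) x))" .
qed

lemma lim_in_hom: "i \<in> D \<Longrightarrow> lcomod_hom C (X i) (dirlim C D X t) (lim_in D X t i)"
  by (simp add: lcomod_hom_def lin_on_dirlim lim_in_lin lcoact_dirlim tensor_dirlim)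

text \<open>The action on a class is computed at any stage representing it, so the comodule laws
  pass to the limit in their module form.\<close>

lemma ldot_dirlim:
  assumes "i \<in> D" "x \<in> carrier (X i)" "functional C a"
  shows "ldot C (dirlim C D X t) a (lim_in D X t i x) = lim_in D X t i (ldot C (X i) a x)"
  using lcomod_hom_iff[OF vC3 direct_systemD(2)[OF assms(1)] vspace_dirlim
      left_comoduleD(2)[OF C direct_systemD(1)[OF assms(1)]] lcoact_dirlim_lin, THEN iffD1, OF lim_in_hom[OF assms(1)]]
    assms(2,3) by simp

lemma left_comodule_dirlim: "left_comodule C (dirlim C D X t)"
  unfolding left_comodule_iff[OF C]
proof (intro conjI ballI allI impI vspace_dirlim lcoact_dirlim_lin)
  fix y assume y: "y \<in> carrier (dirlim C D X t)"
  then have "y \<in> carrier (lim_space D X t)" by simp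
  then obtain i x where i: "i \<in> D" "x \<in> carrier (X i)" "y = lim_in D X t i x" by (rule lim_space_cases)
  note d = left_comoduleD[OF C direct_systemD(1)[OF i(1)]]
  show "ldot C (dirlim C D X t) (counit C) y = y"
    using i d by (simp add: ldot_dirlim precoalgD(3)[OF C])
  fix a b assume "functional C a" "functional C b"
  then show "ldot C (dirlim C D X t) b (ldot C (dirlim C D X t) a y) = ldot C (dirlim C D X t) (conv C a b) y"
    using i d by (simp add: ldot_dirlim functional_conv[OF C])
qed

lemma lim_lift_hom:
  assumes N: "left_comodule C N"
    and g: "\<And>i j x. i \<in> D \<Longrightarrow> j \<in> D \<Longrightarrow> i \<le> j \<Longrightarrow> x \<in> carrier (X i) \<Longrightarrow> g j (t i j x) = g i x"
    and hom: "\<And>i. i \<in> D \<Longrightarrow> lcomod_hom C (X i) N (g i)"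
  shows "lcomod_hom C (dirlim C D X t) N (lim_lift D X t g)"
proof -
  note dN = left_comoduleD[OF C N]
  have h: "lin_on (X i) N (g i)" "functional C a \<Longrightarrow> x \<in> carrier (X i) \<Longrightarrow> g i (ldot C (X i) a x) = ldot C N a (g i x)"
    if "i \<in> D" for i a x
    using lcomod_hom_iff[OF vC3 direct_systemD(2)[OF that] dN(1) left_comoduleD(2)[OF C direct_systemD(1)[OF that]] dN(2), of "g i"]
      hom[OF that] by auto
  show ?thesis
    unfolding lcomod_hom_iff[OF vC3 vspace_dirlim dN(1) lcoact_dirlim_lin dN(2)] lin_on_dirlim
  proof (intro conjI ballI allI impI)
    show "lin_on (lim_space D X t) N (lim_lift D X t g)" by (rule lim_lift_lin[OF g h(1)])
    fix y a assume "y \<in> carrier (dirlim C D X t)" and a: "functional C a"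
    then have "y \<in> carrier (lim_space D X t)" by simp
    then obtain i x where i: "i \<in> D" "x \<in> carrier (X i)" "y = lim_in D X t i x" by (rule lim_space_cases)
    show "lim_lift D X t g (ldot C (dirlim C D X t) a y) = ldot C N a (lim_lift D X t g y)"
      using i h(2)[OF i(1) a i(2)] left_comoduleD(5)[OF C direct_systemD(1)[OF i(1)] a i(2)]
      by (simp add: ldot_dirlim a lim_lift_in[of g, OF g])
  qed
qed

lemma lim_in_inj:
  assumes inj: "\<And>j. j \<in> D \<Longrightarrow> i \<le> j \<Longrightarrow> inj_on (t i j) (carrier (X i))" and i: "i \<in> D"
  shows "inj_on (lim_in D X t i) (carrier (X i))"
proof (rule inj_onI)
  fix x y assume x: "x \<in> carrier (X i)" "y \<in> carrier (X i)" and "lim_in D X t i x = lim_in D X t i y"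
  then obtain k where "k \<in> D" "i \<le> k" "t i k x = t i k y"
    using lim_in_eq_iff[OF sys i x(1) i x(2)] by blast
  then show "x = y" using inj x by (auto dest: inj_onD)
qed

end

text \<open>The images of the maps \<kappa> i exhaust \<open>T\<close>. Each law of a direct system
  follows by comparing both sides after the injective map \<kappa> j, which \<open>t\<close>
  respects. The induced map on the limit is injective because two classes have representatives at
  one stage, and onto by \<open>cover\<close>.\<close>

lemma direct_system_of_embeddings:
  fixes X :: "'i::order \<Rightarrow> ('k::field, 'c::ab_group_add, 'x::ab_group_add) lcomod"
    and T :: "('k, 'c, 't::ab_group_add) lcomod"
  assumes C: "precoalg C" and T: "left_comodule C T"
    and D: "D \<noteq> {}" "\<And>i j. i \<in> D \<Longrightarrow> j \<in> D \<Longrightarrow> \<exists>k\<in>D. i \<le> k \<and> j \<le> k"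
    and X: "\<And>i. i \<in> D \<Longrightarrow> left_comodule C (X i)"
    and \<kappa>: "\<And>i. i \<in> D \<Longrightarrow> lcomod_hom C (X i) T (\<kappa> i)" "\<And>i. i \<in> D \<Longrightarrow> inj_on (\<kappa> i) (carrier (X i))"
    and t: "\<And>i j x. i \<in> D \<Longrightarrow> j \<in> D \<Longrightarrow> i \<le> j \<Longrightarrow> x \<in> carrier (X i) \<Longrightarrow> t i j x \<in> carrier (X j)"
      "\<And>i j x. i \<in> D \<Longrightarrow> j \<in> D \<Longrightarrow> i \<le> j \<Longrightarrow> x \<in> carrier (X i) \<Longrightarrow> \<kappa> j (t i j x) = \<kappa> i x"
    and cover: "\<And>y. y \<in> carrier T \<Longrightarrow> \<exists>i\<in>D. y \<in> \<kappa> i ` carrier (X i)"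
  shows "direct_system C D X t"
    "\<exists>\<psi>. lcomod_iso C (dirlim C D X t) T \<psi> \<and> (\<forall>i\<in>D. \<forall>x\<in>carrier (X i). \<psi> (lim_in D X t i x) = \<kappa> i x)"
proof -
  note vC = precoalgD(1)[OF C] and dT = left_comoduleD[OF C T]
  note dX = left_comoduleD[OF C X]
  have h: "lin_on (X i) T (\<kappa> i)" "functional C a \<Longrightarrow> x \<in> carrier (X i) \<Longrightarrow> \<kappa> i (ldot C (X i) a x) = ldot C T a (\<kappa> i x)"
    if "i \<in> D" for i a x
    using lcomod_hom_iff[OF vC dX(1)[OF that] dT(1) dX(2)[OF that] dT(2), of "\<kappa> i"] \<kappa>(1)[OF that] by auto
  have inj: "\<kappa> i x = \<kappa> i y \<longleftrightarrow> x = y" if "i \<in> D" "x \<in> carrier (X i)" "y \<in> carrier (X i)" for i x y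
    using \<kappa>(2)[OF that(1)] that by (auto dest: inj_onD)
  have thom: "lcomod_hom C (X i) (X j) (t i j)" if i: "i \<in> D" "j \<in> D" "i \<le> j" for i j
    unfolding lcomod_hom_iff[OF vC dX(1)[OF i(1)] dX(1)[OF i(2)] dX(2)[OF i(1)] dX(2)[OF i(2)]]
  proof (intro conjI lin_onI ballI allI impI)
    note v = vspace_closed[OF dX(1)[OF i(1)]] vspace_closed[OF dX(1)[OF i(2)]]
    fix x y a assume x: "x \<in> carrier (X i)" 
    show "t i j x \<in> carrier (X j)" using t i x by blast
    show "t i j (smul (X i) a x) = smul (X j) a (t i j x)"
      by (rule inj[OF i(2), THEN iffD1]) (use i x v t in \<open>auto simp: lin_onD[OF h(1)]\<close>)
    show "t i j (x + y) = t i j x + t i j y" if y: "y \<in> carrier (X i)"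
      by (rule inj[OF i(2), THEN iffD1]) (use i x y v t in \<open>auto simp: lin_onD[OF h(1)]\<close>)
  next
    fix x a assume x: "x \<in> carrier (X i)" and a: "functional C a"
    show "t i j (ldot C (X i) a x) = ldot C (X j) a (t i j x)"
      by (rule inj[OF i(2), THEN iffD1]) (use i x a t dX(5) in \<open>auto simp: h(2)\<close>)
  qed
  show sys: "direct_system C D X t"
    unfolding direct_system_def
  proof (intro conjI ballI impI D X thom)
    fix i x assume "i \<in> D" "x \<in> carrier (X i)"
    then show "t i i x = x" using inj[of i "t i i x" x] t by simp
  next
    fix i j k x assume i: "i \<in> D" "j \<in> D" "k \<in> D" "x \<in> carrier (X i)" "i \<le> j" "j \<le> k"
    then have "i \<le> k" by (meson order_trans)
    then show "t j k (t i j x) = t i k x" using inj[OF i(3), of "t j k (t i j x)" "t i k x"] t i by simp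
  qed
  let ?\<psi> = "lim_lift D X t \<kappa>"
  have \<psi>: "?\<psi> (lim_in D X t i x) = \<kappa> i x" if "i \<in> D" "x \<in> carrier (X i)" for i x
    by (rule lim_lift_in[OF C sys t(2) that])
  have "bij_betw ?\<psi> (carrier (dirlim C D X t)) (carrier T)"
    unfolding bij_betw_def dirlim_simps[OF C sys]
  proof (intro conjI inj_onI equalityI subsetI)
    fix y z assume yz: "y \<in> carrier (lim_space D X t)" "z \<in> carrier (lim_space D X t)" "?\<psi> y = ?\<psi> z"
    obtain i x x' where "i \<in> D" "x \<in> carrier (X i)" "x' \<in> carrier (X i)" "y = lim_in D X t i x" "z = lim_in D X t i x'"
      using lim_space_cases2[OF C sys yz(1,2)] .
    then show "y = z" using yz(3) by (simp add: \<psi> inj)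
  next
    fix u assume "u \<in> ?\<psi> ` carrier (lim_space D X t)"
    then show "u \<in> carrier T"
      by (auto elim!: lim_space_cases[OF C sys] simp: \<psi> lin_onD[OF h(1)])
  next
    fix u assume "u \<in> carrier T"
    then obtain i x where "i \<in> D" "x \<in> carrier (X i)" "u = \<kappa> i x" using cover by blast
    then show "u \<in> ?\<psi> ` carrier (lim_space D X t)"
      using \<psi> lim_in_in[OF C sys] by (intro image_eqI[of _ _ "lim_in D X t i x"]) auto
  qed
  then have "lcomod_iso C (dirlim C D X t) T ?\<psi>"
    using left_comodule_dirlim[OF C sys] T lim_lift_hom[OF C sys T t(2) \<kappa>(1)] by (simp add: lcomod_iso_def)
  then show "\<exists>\<psi>. lcomod_iso C (dirlim C D X t) T \<psi> \<and> (\<forall>i\<in>D. \<forall>x\<in>carrier (X i). \<psi> (lim_in D X t i x) = \<kappa> i x)"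
    using \<psi> by blast
qed

section \<open>The functor \<open>*\<close> and the transpose\<close>

lemma res_in [simp]: "x \<in> S \<Longrightarrow> res S f x = f x"
  by (simp add: res_def)

lemma res_out [simp]: "x \<notin> S \<Longrightarrow> res S f x = 0"
  by (simp add: res_def)

lemma res_res [simp]: "res S (res S f) = res S f"
  by (simp add: res_def fun_eq_iff)

lemma res_eq_iff: "res S f = f \<longleftrightarrow> (\<forall>x. x \<notin> S \<longrightarrow> f x = 0)"
  by (auto simp: res_def fun_eq_iff)

lemma res_add: "res S (f + g) = res S f + res S (g :: 'a \<Rightarrow> 'b::monoid_add)"
  by (auto simp: res_def fun_eq_iff plus_fun_apply)

lemma fun_eq_resI:
  assumes "res S f = f" "res S g = g" "\<And>x. x \<in> S \<Longrightarrow> f x = g x"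
  shows "f = g"
proof
  fix x
  show "f x = g x"
  proof (cases "x \<in> S")
    case False
    then show ?thesis using assms(1,2) unfolding res_eq_iff by simp
  qed (rule assms(3))
qed

lemma Dual_simps [simp]: "smul (Dual X) = pw (*)"
  by (simp add: Dual_def)

lemma in_Dual: "p \<in> carrier (Dual X) \<longleftrightarrow> functional X p \<and> res (carrier X) p = p"
  by (simp add: Dual_def)

lemma Dual_resI: "vspace X \<Longrightarrow> functional X p \<Longrightarrow> res (carrier X) p \<in> carrier (Dual X)"
  using lin_on_cong[of X kspace p "res (carrier X) p"] by (simp add: in_Dual)

lemma res_zero [simp]: "res S (\<lambda>_. 0) = (\<lambda>_. 0)" "res S 0 = 0"
  by (auto simp: res_def fun_eq_iff zero_fun_apply)

lemma vspace_Dual: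
  fixes X :: "('k::field, 'a::ab_group_add, 'r) space_scheme"
  assumes X: "vspace X"
  shows "vspace (Dual X)"
  unfolding Dual_def
proof (rule vspace_pwI)
  show "vector_space ((*) :: 'k \<Rightarrow> 'k \<Rightarrow> 'k)" using vspaceD(1)[OF vspace_kspace] by simp
qed (auto simp: lin_on_def plus_fun_apply zero_fun_apply pw_def algebra_simps res_eq_iff)

lemma lslice_lincomb:
  assumes X: "vspace X" and Y: "vspace Y" and B: "finite B" "\<And>b. b \<in> B \<Longrightarrow> functional X (c b)"
    and w: "w \<in> carrier (tensor X Y)"
  shows "lslice X Y (\<lambda>x. \<Sum>b\<in>B. k b * c b x) w = (\<Sum>b\<in>B. smul Y (k b) (lslice X Y (c b) w))"
proof -
  have f: "functional X (\<lambda>x. \<Sum>b\<in>B. k b * c b x)"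
    by (rule lin_onI) (auto simp: lin_onD(2)[OF B(2)] lin_onD(3)[OF B(2)] algebra_simps sum.distrib sum_distrib_left)
  show ?thesis
  proof (rule tensor_lin_eqI[OF lslice_lin[OF X Y f] _ X _ w])
    show "lin_on (tensor X Y) Y (\<lambda>w. \<Sum>b\<in>B. smul Y (k b) (lslice X Y (c b) w))"
      using lin_onD[OF lslice_lin[OF X Y B(2)]]
      by (intro lin_onI) (auto simp: vspace_smul[OF Y] sum.distrib mult.commute intro!: vspace_closed(4,5)[OF Y])
    fix x y assume "x \<in> carrier X" "y \<in> carrier Y"
    interpret vector_space "smul Y" using Y by (rule vspaceD)
    show "lslice X Y (\<lambda>x. \<Sum>b\<in>B. k b * c b x) (tens X Y x y) = (\<Sum>b\<in>B. smul Y (k b) (lslice X Y (c b) (tens X Y x y)))"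
      using \<open>x \<in> carrier X\<close> \<open>y \<in> carrier Y\<close> by (simp add: lslice_tens[OF X Y f] lslice_tens[OF X Y B(2)] scale_sum_left)
  qed
qed

lemma Hom_smul [simp]: "smul (Hom C M N) = pw (smul N)"
  by (simp add: Hom_def)

text \<open>The coordinates on \<open>L\<close> are extended to functionals on all of
  \<open>C\<close>, because the actions are indexed by those. The extension is arbitrary: on
  elements of \<open>L\<close> the hit actions see only the values on \<open>L\<close>.\<close>

lemma fd_dual_basis:
  assumes C: "precoalg C" and L: "L \<in> fd_subcoalgebras C" and V: "vspace (sub C V)" "V \<subseteq> L"
  obtains B c where "finite B" "B \<subseteq> L" "\<And>b. b \<in> B \<Longrightarrow> functional C (c b)"
    "\<And>x. x \<in> L \<Longrightarrow> x = (\<Sum>b\<in>B. smul C (c b x) b)"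
    "\<And>b. b \<in> B \<Longrightarrow> b \<in> V \<or> (\<forall>x\<in>V. c b x = 0)"
proof -
  note vC = precoalgD(1)[OF C]
  have L1: "subcoalg C L" and L2: "findim (sub C L)" using L by (auto simp: fd_subcoalgebras_iff)
  note LD = subcoalgD[OF C L1]
  have V1: "module.subspace (smul (sub C L)) V" "V \<subseteq> carrier (sub C L)"
    using V vspaceD(3)[OF V(1)] by auto
  obtain B c where B: "B \<subseteq> carrier (sub C L)" "\<And>b. b \<in> B \<Longrightarrow> functional (sub C L) (c b)"
    "\<And>x. x \<in> carrier (sub C L) \<Longrightarrow> finite {b \<in> B. c b x \<noteq> 0}"
    "\<And>x. x \<in> carrier (sub C L) \<Longrightarrow> x = (\<Sum>b\<in>{b \<in> B. c b x \<noteq> 0}. smul (sub C L) (c b x) b)"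
    "\<And>b. b \<in> B \<Longrightarrow> b \<in> V \<or> (\<forall>x\<in>V. c b x = 0)"
    "findim (sub C L) \<Longrightarrow> finite B"
    by (rule adapted_basis[OF LD(2) V1]) blast
  have "\<forall>b\<in>B. \<exists>c'. functional C c' \<and> (\<forall>x\<in>L. c' x = c b x)"
  proof
    fix b assume "b \<in> B"
    then obtain c' where "functional C c'" "\<And>x. x \<in> L \<Longrightarrow> c' x = c b x"
      using functional_extend[OF C L1 B(2)] by blast
    then show "\<exists>c'. functional C c' \<and> (\<forall>x\<in>L. c' x = c b x)" by blast
  qed
  from bchoice[OF this] obtain c' where c': "\<And>b. b \<in> B \<Longrightarrow> functional C (c' b)" "\<And>b x. b \<in> B \<Longrightarrow> x \<in> L \<Longrightarrow> c' b x = c b x"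
    by blast
  show thesis
  proof (rule that[of B c'])
    show "finite B" "B \<subseteq> L" using B(1,6) L2 by auto
    show "functional C (c' b)" if "b \<in> B" for b using c' that by blast
    show "b \<in> V \<or> (\<forall>x\<in>V. c' b x = 0)" if "b \<in> B" for b
      using B(5)[OF that] c'(2)[OF that] V(2) by auto
    show "x = (\<Sum>b\<in>B. smul C (c' b x) b)" if x: "x \<in> L" for x
    proof -
      have "x = (\<Sum>b\<in>{b \<in> B. c b x \<noteq> 0}. smul C (c b x) b)" using B(4)[of x] x by simp
      also have "\<dots> = (\<Sum>b\<in>B. smul C (c' b x) b)"
        by (rule sum.mono_neutral_cong_left) (use B(6)[OF L2] c'(2) x in \<open>auto simp: vspace_smul[OF vC]\<close>)
      finally show ?thesis .
    qed
  qed
qed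

section \<open>The comodules D Hom(\<Lambda>, M)\<close>

abbreviation reg_Hom :: "('k::field, 'c::ab_group_add) coalg \<Rightarrow> ('k, 'c, 'm::ab_group_add) rcomod \<Rightarrow> 'c set
    \<Rightarrow> ('k, 'c \<Rightarrow> 'm) space" where
  "reg_Hom C M L \<equiv> Hom C (regular C L) M"

context
  fixes C :: "('k::field, 'c::ab_group_add) coalg" and M :: "('k, 'c, 'm::ab_group_add) rcomod"
  assumes C: "coalgebra C" and M: "right_comodule C M"
begin

private lemmas P4 = coalgebra_precoalg[OF C]
private lemmas vC4 = precoalgD(1)[OF P4] and \<Delta>4 = precoalgD(2)[OF P4]
private lemmas dM4 = right_comoduleD[OF P4 M]

lemma in_Hom_regular:
  assumes L: "subcoalg C L"
  shows "f \<in> carrier (reg_Hom C M L) \<longleftrightarrow> lin_on (sub C L) M f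
    \<and> (\<forall>x\<in>L. \<forall>a. functional C a \<longrightarrow> f (rhit C a x) = rdot C M a (f x)) \<and> res L f = f"
proof -
  note LD = subcoalgD[OF P4 L]
  have v: "vspace (regular C L)" using LD(2) by (simp add: vspace_def)
  have mem: "comult C x \<in> carrier (tensor (regular C L) C)" if "x \<in> L" for x
    by (rule tensor_mono[OF LD(4)[OF that]]) (use LD in auto)
  have lin: "lin_on (regular C L) (tensor (regular C L) C) (comult C)"
    by (rule lin_on_mono[OF \<Delta>4]) (use mem LD(1) in auto)
  have r: "rdot C (regular C L) a x = rhit C a x" if "functional C a" "x \<in> L" for a x
    unfolding rdot_def by simp (rule rslice_mono[OF vC4 vC4 that(1)]; use that LD mem v vC4 in auto)
  have l: "lin_on (regular C L) M f \<longleftrightarrow> lin_on (sub C L) M f" by (simp add: lin_on_def)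
  have "rcomod_hom C (regular C L) M f \<longleftrightarrow> lin_on (sub C L) M f
    \<and> (\<forall>x\<in>L. \<forall>a. functional C a \<longrightarrow> f (rhit C a x) = rdot C M a (f x))"
    using rcomod_hom_iff[OF vC4 v dM4(1) _ dM4(2), of f] lin r l by auto
  then show ?thesis by (auto simp: Hom_def)
qed

lemma Hom_regularD:
  assumes L: "subcoalg C L" and f: "f \<in> carrier (reg_Hom C M L)"
  shows "lin_on (sub C L) M f" "x \<in> L \<Longrightarrow> f x \<in> carrier M" "x \<in> L \<Longrightarrow> y \<in> L \<Longrightarrow> f (x + y) = f x + f y"
    "x \<in> L \<Longrightarrow> f (smul C k x) = smul M k (f x)"
    "x \<in> L \<Longrightarrow> functional C a \<Longrightarrow> f (rhit C a x) = rdot C M a (f x)" "res L f = f"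
proof -
  show l: "lin_on (sub C L) M f" and "x \<in> L \<Longrightarrow> functional C a \<Longrightarrow> f (rhit C a x) = rdot C M a (f x)"
    "res L f = f"
    using f unfolding in_Hom_regular[OF L] by blast+
  show "x \<in> L \<Longrightarrow> f x \<in> carrier M" "x \<in> L \<Longrightarrow> y \<in> L \<Longrightarrow> f (x + y) = f x + f y"
    "x \<in> L \<Longrightarrow> f (smul C k x) = smul M k (f x)"
    using lin_onD[OF l] by simp_all
qed

lemma vspace_Hom_regular:
  assumes L: "subcoalg C L"
  shows "vspace (reg_Hom C M L)"
proof -
  have "vspace \<lparr>carrier = carrier (reg_Hom C M L), smul = pw (smul M)\<rparr>"
  proof (rule vspace_pwI[OF vspaceD(1)[OF dM4(1)]])
    show "0 \<in> carrier (reg_Hom C M L)"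
      unfolding in_Hom_regular[OF L]
      by (auto simp: lin_on_def zero_fun_apply vspace_closed[OF dM4(1)] vspace_smul[OF dM4(1)]
          lin_on_zero[OF dM4(1) dM4(4)])
    show "f + g \<in> carrier (reg_Hom C M L)" if "f \<in> carrier (reg_Hom C M L)" "g \<in> carrier (reg_Hom C M L)" for f g
      using Hom_regularD[OF L that(1)] Hom_regularD[OF L that(2)] lin_onD(2)[OF dM4(4)]
      unfolding in_Hom_regular[OF L]
      by (auto simp: lin_on_def plus_fun_apply vspace_closed[OF dM4(1)] vspace_smul[OF dM4(1)] res_add)
    show "pw (smul M) k f \<in> carrier (reg_Hom C M L)" if "f \<in> carrier (reg_Hom C M L)" for k f
      using Hom_regularD[OF L that] lin_onD(3)[OF dM4(4)]
      unfolding in_Hom_regular[OF L]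
      by (auto simp: lin_on_def pw_def vspace_closed[OF dM4(1)] vspace_smul[OF dM4(1)] mult.commute res_eq_iff)
  qed
  then show ?thesis by (simp add: Hom_def)
qed

text \<open>By linearity of f, the sum of a(x1) f(x2) is f applied to the sum of a(x1) x2. The
  action on homomorphisms is thus precomposition with \<open>lhit\<close>, and its laws reduce to
  the hit laws.\<close>

lemma act_apply:
  assumes L: "subcoalg C L" and f: "f \<in> carrier (reg_Hom C M L)" and a: "functional C a" "\<And>x. x \<in> L \<Longrightarrow> a' x = a x"
  shows "act C M L a' f = res L (\<lambda>x. f (lhit C a x))"
proof
  fix x
  note LD = subcoalgD[OF P4 L]
  have a': "functional (sub C L) a'"
    by (rule lin_on_cong[OF LD(2) functional_sub[OF a(1) LD(1)]]) (use a in auto)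
  note b = bilin_lslice[OF LD(2) LD(2) a']
  show "act C M L a' f x = res L (\<lambda>x. f (lhit C a x)) x"
  proof (cases "x \<in> L")
    case True
    have "f (lhit C a x) = f (lslice (sub C L) (sub C L) a' (comult C x))"
      using lhit_sub[OF P4 L a True] by simp
    also have "\<dots> = tlift (sub C L) (sub C L) (\<lambda>u v. f (smul C (a' u) v)) (comult C x)"
      unfolding lslice_def using tlift_comp[OF b dM4(1) Hom_regularD(1)[OF L f] LD(4)[OF True]] by simp
    also have "\<dots> = tlift (sub C L) (sub C L) (\<lambda>u v. smul M (a' u) (f v)) (comult C x)"
      by (rule tlift_cong[OF bilin_comp[OF b dM4(1) Hom_regularD(1)[OF L f], simplified] _ LD(4)[OF True]])
        (simp add: Hom_regularD[OF L f])
    finally show ?thesis using True by (simp add: act_def)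
  qed (simp add: act_def)
qed

text \<open>Precomposition with \<open>lhit\<close> keeps a map compatible with \<open>rhit\<close>,
  since the two hit actions commute.\<close>

lemma act_in:
  assumes L: "subcoalg C L" and f: "f \<in> carrier (reg_Hom C M L)" and a: "functional C a"
  shows "act C M L a f \<in> carrier (reg_Hom C M L)"
proof -
  note LD = subcoalgD[OF P4 L] and h = hit_in_sub[OF P4 L a] and fD = Hom_regularD[OF L f]
  have hl: "lhit C a (x + y) = lhit C a x + lhit C a y" "lhit C a (smul C k x) = smul C k (lhit C a x)" if "x \<in> L" "y \<in> L" for x y k
    using lin_onD(2,3)[OF lhit_lin[OF P4 a]] that LD by auto
  have "lin_on (sub C L) M (\<lambda>x. f (lhit C a x))"
    by (rule lin_onI) (auto simp: h fD hl)
  then have "lin_on (sub C L) M (res L (\<lambda>x. f (lhit C a x)))"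
    by (rule lin_on_cong[OF LD(2)]) simp
  moreover have "res L (\<lambda>x. f (lhit C a x)) (rhit C b x) = rdot C M b (res L (\<lambda>x. f (lhit C a x)) x)"
    if "x \<in> L" "functional C b" for x b
    using that h hit_in_sub[OF P4 L that(2)] hit_laws(3)[OF C LD(3)[OF that(1)] that(2) a] by (simp add: fD)
  ultimately show ?thesis
    unfolding act_apply[OF L f a refl] in_Hom_regular[OF L] by simp
qed

lemma DHom_simps [simp]: "carrier (DHom C M L) = carrier (Dual (reg_Hom C M L))" "smul (DHom C M L) = pw (*)"
  by (simp_all only: DHom_def Let_def space.simps lcomod.simps Dual_simps)

lemma vspace_DHom: "subcoalg C L \<Longrightarrow> vspace (DHom C M L)"
proof -
  assume "subcoalg C L"
  from vspace_Dual[OF vspace_Hom_regular[OF this]] show ?thesis unfolding vspace_def DHom_simps Dual_simps .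
qed

text \<open>\<open>DHom\<close> describes its coaction as the unique tensor with prescribed slices p
  . a. For a basis b of \<open>L\<close> with coordinates c_b the tensor \<Sum> b \<otimes> (p .
  c_b) has these slices, because a = \<Sum> a(b) c_b on \<open>L\<close>; uniqueness holds because
  slices separate tensors.\<close>

lemma DHom_coact:
  assumes L: "L \<in> fd_subcoalgebras C" and p: "p \<in> carrier (DHom C M L)"
  shows "lcoact (DHom C M L) p \<in> carrier (tensor (sub C L) (DHom C M L))" (is ?A)
    "functional C a \<Longrightarrow> ldot C (DHom C M L) a p = res (carrier (reg_Hom C M L)) (\<lambda>f. p (act C M L a f))"
proof -
  have L1: "subcoalg C L" using L by (auto simp: fd_subcoalgebras_iff)
  note LD = subcoalgD[OF P4 L1]
  define H where "H = reg_Hom C M L"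
  define V where "V = Dual H"
  have vH: "vspace H" using vspace_Hom_regular[OF L1] by (simp add: H_def)
  have vV: "vspace V" using vspace_Dual[OF vH] by (simp add: V_def)
  have "p \<in> carrier V" using p by (simp add: V_def H_def)
  then have p: "functional H p" "res (carrier H) p = p" by (auto simp: V_def in_Dual)
  define da where "da = (\<lambda>a. res (carrier H) (\<lambda>f. p (act C M L a f)))"
  have da_in: "da a \<in> carrier V" if a: "functional C a" for a
  proof -
    have ap: "act C M L a f = res L (\<lambda>x. f (lhit C a x))" if "f \<in> carrier H" for f
      using act_apply[OF L1 _ a refl] that by (simp add: H_def)
    have ai: "act C M L a f \<in> carrier H" if "f \<in> carrier H" for f
      using act_in[OF L1 _ a] that by (simp add: H_def)
    have "lin_on H H (act C M L a)"
    proof (rule lin_onI[OF ai])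
      fix f g k assume f: "f \<in> carrier H" 
      have "pw (smul M) k f \<in> carrier H" using vspace_closed(4)[OF vH f, of k] by (simp add: H_def)
      then show "act C M L a (smul H k f) = smul H k (act C M L a f)"
        using f by (simp add: H_def ap[unfolded H_def] pw_def res_def fun_eq_iff vspace_smul[OF dM4(1)])
      assume g: "g \<in> carrier H"
      then show "act C M L a (f + g) = act C M L a f + act C M L a g"
        using f vspace_closed(2)[OF vH f g] by (simp add: ap plus_fun_apply res_def fun_eq_iff)
    qed
    from Dual_resI[OF vH lin_on_comp[OF this p(1)]] show ?thesis by (simp add: V_def da_def)
  qed
  obtain B c' where B: "finite B" "B \<subseteq> L" and c': "\<And>b. b \<in> B \<Longrightarrow> functional C (c' b)"
    and xs: "\<And>x. x \<in> L \<Longrightarrow> x = (\<Sum>b\<in>B. smul C (c' b x) b)"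
    by (rule fd_dual_basis[OF P4 L LD(2) order_refl]) blast
  define w where "w = (\<Sum>b\<in>B. tens (sub C L) V b (da (c' b)))"
  have w: "w \<in> carrier (tensor (sub C L) V)"
    unfolding w_def using B(2) da_in c' by (intro vspace_closed(5)[OF vspace_tensor] tens_in) auto
  have sl: "lslice (sub C L) V a w = da a" if a: "functional C a" for a
  proof -
    note a' = functional_sub[OF a LD(1)]
    have ax: "a x = (\<Sum>b\<in>B. a b * c' b x)" if x: "x \<in> L" for x
    proof -
      have "a x = a (\<Sum>b\<in>B. smul C (c' b x) b)" using xs[OF x] by simp
      also have "\<dots> = (\<Sum>b\<in>B. a (smul C (c' b x) b))"
        by (rule lin_on_sum[OF vC4 a]) (use B(2) LD in \<open>auto intro!: vspace_closed[OF vC4]\<close>)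
      also have "\<dots> = (\<Sum>b\<in>B. a b * c' b x)"
        by (rule sum.cong) (use B(2) LD lin_onD(3)[OF a] in \<open>auto simp: mult.commute\<close>)
      finally show ?thesis .
    qed
    have "lslice (sub C L) V a w = (\<Sum>b\<in>B. lslice (sub C L) V a (tens (sub C L) V b (da (c' b))))"
      unfolding w_def by (rule lin_on_sum[OF vspace_tensor lslice_lin[OF LD(2) vV a']])
        (use B(2) da_in c' in \<open>auto intro!: tens_in simp del: tens_sub\<close>)
    also have "\<dots> = (\<Sum>b\<in>B. pw (*) (a b) (da (c' b)))"
      by (rule sum.cong[OF refl], subst lslice_tens[OF LD(2) vV a']) (use B(2) da_in c' in \<open>auto simp: V_def\<close>)
    also have "\<dots> = da a"
    proof (rule fun_eq_resI[of "carrier H"])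
      have "(\<Sum>b\<in>B. pw (*) (a b) (da (c' b))) \<in> carrier V"
        using da_in c' vspace_closed(4)[OF vV] by (intro vspace_closed(5)[OF vV]) (simp add: V_def)
      then show "res (carrier H) (\<Sum>b\<in>B. pw (*) (a b) (da (c' b))) = (\<Sum>b\<in>B. pw (*) (a b) (da (c' b)))"
        by (simp add: V_def in_Dual)
      show "res (carrier H) (da a) = da a" by (simp add: da_def)
      fix f assume f: "f \<in> carrier H"
      then have fH: "f \<in> carrier (reg_Hom C M L)" by (simp add: H_def)
      have sf: "sum g B x = (\<Sum>b\<in>B. g b x)" for g :: "'c \<Rightarrow> 'x \<Rightarrow> 'y::ab_group_add" and x
        by (induction B rule: infinite_finite_induct) (auto simp: plus_fun_apply zero_fun_apply)
      have ai: "act C M L (c' b) f \<in> carrier H" if "b \<in> B" for b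
        using act_in[OF L1 fH c'[OF that]] by (simp add: H_def)
      \<comment> \<open>The expansion of a in coordinates on \<open>L\<close> passes through the
        action, by linearity of slices in the functional and by linearity of f.\<close>
      have "act C M L a f = (\<Sum>b\<in>B. pw (smul M) (a b) (act C M L (c' b) f))"
      proof (rule fun_eq_resI[of L])
        have "(\<Sum>b\<in>B. smul H (a b) (act C M L (c' b) f)) \<in> carrier H"
          using ai vspace_closed(4)[OF vH] by (intro vspace_closed(5)[OF vH]) simp
        then show "res L (\<Sum>b\<in>B. pw (smul M) (a b) (act C M L (c' b) f)) = (\<Sum>b\<in>B. pw (smul M) (a b) (act C M L (c' b) f))"
          using Hom_regularD(6)[OF L1] by (simp add: H_def)
        show "res L (act C M L a f) = act C M L a f" by (simp add: act_def)
        fix x assume x: "x \<in> L"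
        have "lhit C a x = lslice (sub C L) (sub C L) (\<lambda>x. \<Sum>b\<in>B. a b * c' b x) (comult C x)"
          using lhit_sub[OF P4 L1 a _ x, of "\<lambda>x. \<Sum>b\<in>B. a b * c' b x"] ax by simp
        also have "\<dots> = (\<Sum>b\<in>B. smul C (a b) (lhit C (c' b) x))"
          using lslice_lincomb[OF LD(2) LD(2) B(1) functional_sub[OF c' LD(1)] LD(4)[OF x], of "\<lambda>b. b" a]
            lhit_sub[OF P4 L1 c' refl x] by simp
        finally have "f (lhit C a x) = f (\<Sum>b\<in>B. smul C (a b) (lhit C (c' b) x))" by simp
        also have "\<dots> = (\<Sum>b\<in>B. f (smul C (a b) (lhit C (c' b) x)))"
          by (rule lin_on_sum[OF LD(2) Hom_regularD(1)[OF L1 fH]])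
            (use hit_in_sub(1)[OF P4 L1 c' x] vspace_closed(4)[OF LD(2)] in simp)
        also have "\<dots> = (\<Sum>b\<in>B. smul M (a b) (f (lhit C (c' b) x)))"
          by (rule sum.cong) (use hit_in_sub(1)[OF P4 L1 c' x] Hom_regularD(4)[OF L1 fH] in auto)
        finally show "act C M L a f x = (\<Sum>b\<in>B. pw (smul M) (a b) (act C M L (c' b) f)) x"
          unfolding sf act_apply[OF L1 fH a refl] using x act_apply[OF L1 fH c' refl] by (simp add: pw_def)
      qed
      then have "p (act C M L a f) = p (\<Sum>b\<in>B. smul H (a b) (act C M L (c' b) f))" by (simp add: H_def)
      also have "\<dots> = (\<Sum>b\<in>B. p (smul H (a b) (act C M L (c' b) f)))"
        by (rule lin_on_sum[OF vH p(1)]) (use ai vspace_closed(4)[OF vH] in auto)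
      also have "\<dots> = (\<Sum>b\<in>B. a b * p (act C M L (c' b) f))"
        by (rule sum.cong) (use lin_onD(3)[OF p(1) ai] in auto)
      finally show "(\<Sum>b\<in>B. pw (*) (a b) (da (c' b))) f = da a f"
        unfolding sf using f by (simp add: pw_def da_def)
    qed
    finally show ?thesis .
  qed
  \<comment> \<open>The description in \<open>DHom\<close> quantifies over functionals on
    \<open>L\<close> alone; each is extended to \<open>C\<close>, and \<open>da\<close> depends only
    on its values on \<open>L\<close>.\<close>
  have sl': "lslice (sub C L) V a w = da a" if fa: "functional (sub C L) a" for a
  proof -
    obtain a' where a': "functional C a'" "\<And>x. x \<in> L \<Longrightarrow> a' x = a x"
      by (rule functional_extend[OF P4 L1 fa]) blast
    have "lslice (sub C L) V a w = lslice (sub C L) V a' w"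
      by (rule lslice_mono[OF LD(2) vV functional_sub[OF a'(1) LD(1)]]) (use a' w LD vV in auto)
    moreover have "act C M L a f = act C M L a' f" if "f \<in> carrier H" for f
      using act_apply[OF L1 _ a'(1) a'(2)[symmetric]] act_apply[OF L1 _ a'(1) refl] that by (simp add: H_def)
    then have "da a = da a'"
      by (intro ext) (simp add: da_def res_def)
    ultimately show ?thesis using sl[OF a'(1)] by simp
  qed
  have lc: "lcoact (DHom C M L) p = (THE w. w \<in> carrier (tensor (sub C L) V)
      \<and> (\<forall>a\<in>carrier (Dual (sub C L)). lslice (sub C L) V a w = da a))"
    by (simp only: DHom_def Let_def lcomod.simps space.simps da_def V_def H_def lslice_def)
  have lc: "lcoact (DHom C M L) p = w"
    unfolding lc
  proof (rule the_equality)
    show "w \<in> carrier (tensor (sub C L) V) \<and> (\<forall>a\<in>carrier (Dual (sub C L)). lslice (sub C L) V a w = da a)"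
      using w sl' by (simp add: in_Dual)
    fix w' assume w': "w' \<in> carrier (tensor (sub C L) V) \<and> (\<forall>a\<in>carrier (Dual (sub C L)). lslice (sub C L) V a w' = da a)"
    show "w' = w"
    proof (rule lslice_eqI[OF _ w LD(2) vV])
      show w1: "w' \<in> carrier (tensor (sub C L) V)" using w' by blast
      fix a assume a: "functional (sub C L) a"
      \<comment> \<open>Members of \<open>Dual\<close> vanish off the carrier, so an arbitrary
        functional on \<open>L\<close> is normalised before the description of w' applies to
        it.\<close>
      have r: "res L a \<in> carrier (Dual (sub C L))" using Dual_resI[OF LD(2) a] by simp
      have c: "lslice (sub C L) V (res L a) v = lslice (sub C L) V a v" if "v \<in> carrier (tensor (sub C L) V)" for v
        by (rule lslice_mono[OF LD(2) vV a]) (use that LD vV in auto)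
      have "lslice (sub C L) V (res L a) w' = da (res L a)" using w' r by blast
      also have "\<dots> = lslice (sub C L) V (res L a) w" using r by (simp add: sl' in_Dual)
      finally show "lslice (sub C L) V a w' = lslice (sub C L) V a w" unfolding c[OF w1] c[OF w] .
    qed
  qed
  have tV: "tensor (sub C L) (DHom C M L) = tensor (sub C L) V"
    by (rule tensor_cong) (auto simp: V_def H_def)
  show ?A using lc w tV by simp
  assume a: "functional C a"
  have "lslice C (DHom C M L) a w = lslice (sub C L) (DHom C M L) a w"
    by (rule lslice_sub[OF P4 L1 vspace_DHom[OF L1] a refl, symmetric]) (simp add: w tV)
  moreover have "lslice (sub C L) (DHom C M L) = lslice (sub C L) V"
    by (rule lslice_space_cong) (auto simp: V_def H_def)
  ultimately have "ldot C (DHom C M L) a p = da a"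
    unfolding ldot_def lc using sl[OF a] by metis
  then show "ldot C (DHom C M L) a p = res (carrier (reg_Hom C M L)) (\<lambda>f. p (act C M L a f))"
    unfolding da_def H_def .
qed

end

lemma lcomod_homD:
  assumes C: "precoalg C" and M: "left_comodule C M" and N: "left_comodule C N" and f: "lcomod_hom C M N f"
  shows "lin_on M N f" "x \<in> carrier M \<Longrightarrow> functional C a \<Longrightarrow> f (ldot C M a x) = ldot C N a (f x)"
  using f lcomod_hom_iff[OF precoalgD(1)[OF C] left_comoduleD(1)[OF C M] left_comoduleD(1)[OF C N]
      left_comoduleD(2)[OF C M] left_comoduleD(2)[OF C N]] by blast+

lemma lcomod_homI:
  assumes C: "precoalg C" and M: "left_comodule C M" and N: "left_comodule C N" and "lin_on M N f"
    "\<And>x a. x \<in> carrier M \<Longrightarrow> functional C a \<Longrightarrow> f (ldot C M a x) = ldot C N a (f x)"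
  shows "lcomod_hom C M N f"
  using assms(4,5) lcomod_hom_iff[OF precoalgD(1)[OF C] left_comoduleD(1)[OF C M] left_comoduleD(1)[OF C N]
      left_comoduleD(2)[OF C M] left_comoduleD(2)[OF C N]] by blast

lemma lcomod_hom_comp:
  assumes C: "precoalg C" and M: "left_comodule C M" and N: "left_comodule C N" and K: "left_comodule C K"
    and f: "lcomod_hom C M N f" and g: "lcomod_hom C N K g"
  shows "lcomod_hom C M K (\<lambda>x. g (f x))"
  using lin_onD(1)[OF lcomod_homD(1)[OF C M N f]]
  by (intro lcomod_homI[OF C M K lin_on_comp[OF lcomod_homD(1)[OF C M N f] lcomod_homD(1)[OF C N K g]]])
    (simp add: lcomod_homD(2)[OF C M N f] lcomod_homD(2)[OF C N K g])

lemma rcomod_homD: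
  assumes C: "precoalg C" and M: "right_comodule C M" and N: "right_comodule C N" and f: "rcomod_hom C M N f"
  shows "lin_on M N f" "x \<in> carrier M \<Longrightarrow> functional C a \<Longrightarrow> f (rdot C M a x) = rdot C N a (f x)"
  using f rcomod_hom_iff[OF precoalgD(1)[OF C] right_comoduleD(1)[OF C M] right_comoduleD(1)[OF C N]
      right_comoduleD(2)[OF C M] right_comoduleD(2)[OF C N]] by blast+

lemma rcomod_homI:
  assumes C: "precoalg C" and M: "right_comodule C M" and N: "right_comodule C N" and "lin_on M N f"
    "\<And>x a. x \<in> carrier M \<Longrightarrow> functional C a \<Longrightarrow> f (rdot C M a x) = rdot C N a (f x)"
  shows "rcomod_hom C M N f"
  using assms(4,5) rcomod_hom_iff[OF precoalgD(1)[OF C] right_comoduleD(1)[OF C M] right_comoduleD(1)[OF C N]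
      right_comoduleD(2)[OF C M] right_comoduleD(2)[OF C N]] by blast

lemma res_cong_on: "(\<And>x. x \<in> S \<Longrightarrow> f x = g x) \<Longrightarrow> res S f = res S g"
  by (auto simp: res_def)

abbreviation star_in :: "('k::field, 'c::ab_group_add) coalg \<Rightarrow> ('k, 'c, 'm::ab_group_add) rcomod \<Rightarrow> 'c set
    \<Rightarrow> (('c \<Rightarrow> 'm) \<Rightarrow> 'k) \<Rightarrow> ('c set \<Rightarrow> (('c \<Rightarrow> 'm) \<Rightarrow> 'k) \<Rightarrow> 'k) \<Rightarrow> 'k" where
  "star_in C M \<equiv> lim_in (fd_subcoalgebras C) (DHom C M) (DHom_trans C M)"

context
  fixes C :: "('k::field, 'c::ab_group_add) coalg" and M :: "('k, 'c, 'm::ab_group_add) rcomod"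
  assumes C: "coalgebra C" and M: "right_comodule C M"
begin

private lemmas P5 = coalgebra_precoalg[OF C]
private lemmas vC5 = precoalgD(1)[OF P5]
private lemmas dM5 = right_comoduleD[OF P5 M]

lemma ldot_DHom:
  assumes L: "L \<in> fd_subcoalgebras C" and p: "p \<in> carrier (DHom C M L)" and a: "functional C a"
  shows "ldot C (DHom C M L) a p = res (carrier (reg_Hom C M L)) (\<lambda>f. p (res L (\<lambda>x. f (lhit C a x))))"
  unfolding DHom_coact(2)[OF C M L p a]
  by (rule res_cong_on) (use act_apply[OF C M _ _ a refl] L in \<open>simp add: fd_subcoalgebras_iff\<close>)

lemma shift_in:
  assumes L: "L \<in> fd_subcoalgebras C" and f: "f \<in> carrier (reg_Hom C M L)" and a: "functional C a"
  shows "res L (\<lambda>x. f (lhit C a x)) \<in> carrier (reg_Hom C M L)"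
  using act_in[OF C M _ f a] act_apply[OF C M _ f a refl] L by (simp add: fd_subcoalgebras_iff)

text \<open>Evaluated at f, the functional (p . a) . b is p at f precomposed with
  \<open>lhit\<close> of b after \<open>lhit\<close> of a, and this composite is \<open>lhit\<close>
  of \<open>conv C a b\<close>. The order of the two actions reverses twice, on Hom and on its
  dual.\<close>

lemma left_comodule_DHom:
  assumes L: "L \<in> fd_subcoalgebras C"
  shows "left_comodule C (DHom C M L)"
proof -
  define H where "H = carrier (reg_Hom C M L)"
  have L1: "subcoalg C L" using L by (simp add: fd_subcoalgebras_iff)
  note LD = subcoalgD[OF P5 L1]
  define DH where "DH = DHom C M L"
  have v: "vspace DH" using vspace_DHom[OF C M L1] by (simp add: DH_def)
  have sm: "smul DH = pw (*)" by (simp add: DH_def DHom_simps[OF C M])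
  have l: "lslice C DH a (lcoact DH p) = res H (\<lambda>f. p (res L (\<lambda>x. f (lhit C a x))))"
    if "p \<in> carrier DH" "functional C a" for p a
    using ldot_DHom[OF L _ that(2), of p] that(1) by (simp add: ldot_def DH_def H_def)
  have mem: "lcoact DH p \<in> carrier (tensor C DH)" if "p \<in> carrier DH" for p
    using tensor_mono[OF DHom_coact(1)[OF C M L], of p C DH] that LD(1) by (simp add: DH_def)
  have lin: "lin_on DH (tensor C DH) (lcoact DH)"
  proof (rule lin_onI[OF mem])
    fix p assume p: "p \<in> carrier DH"
    fix k
    have kp: "smul DH k p \<in> carrier DH" using vspace_closed(4)[OF v p] .
    show "lcoact DH (smul DH k p) = smul (tensor C DH) k (lcoact DH p)"
    proof (rule lslice_eqI[OF mem[OF kp] vspace_closed(4)[OF vspace_tensor mem[OF p]] vC5 v])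
      fix a assume a: "functional C a"
      show "lslice C DH a (lcoact DH (smul DH k p)) = lslice C DH a (smul (tensor C DH) k (lcoact DH p))"
        unfolding lin_onD(3)[OF lslice_lin[OF vC5 v a] mem[OF p]] l[OF p a] l[OF kp a]
        by (auto simp: sm res_def pw_def fun_eq_iff)
    qed
    fix q assume q: "q \<in> carrier DH"
    have pq: "p + q \<in> carrier DH" using vspace_closed(2)[OF v p q] .
    show "lcoact DH (p + q) = lcoact DH p + lcoact DH q"
    proof (rule lslice_eqI[OF mem[OF pq] vspace_closed(2)[OF vspace_tensor mem[OF p] mem[OF q]] vC5 v])
      fix a assume a: "functional C a"
      show "lslice C DH a (lcoact DH (p + q)) = lslice C DH a (lcoact DH p + lcoact DH q)"
        unfolding lin_onD(2)[OF lslice_lin[OF vC5 v a] mem[OF p] mem[OF q]] l[OF p a] l[OF q a] l[OF pq a]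
        by (auto simp: res_def plus_fun_apply fun_eq_iff)
    qed
  qed
  have d: "ldot C DH a p = res H (\<lambda>f. p (res L (\<lambda>x. f (lhit C a x))))" if "p \<in> carrier DH" "functional C a" for p a
    using l[OF that] by (simp add: ldot_def)
  note dc = lin_onD(1)[OF ldot_lin[OF vC5 v lin]]
  have "left_comodule C DH"
    unfolding left_comodule_iff[OF P5]
  proof (intro conjI ballI allI impI v lin)
    fix p assume p: "p \<in> carrier DH"
    have pr: "res H p = p" using p by (simp add: DH_def DHom_simps[OF C M] in_Dual H_def)
    have "res H (\<lambda>f. p (res L (\<lambda>x. f (lhit C (counit C) x)))) = res H p"
    proof (rule res_cong_on)
      fix f assume "f \<in> H"
      then have f: "res L f = f" using Hom_regularD(6)[OF C M L1] by (simp add: H_def)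
      have "res L (\<lambda>x. f (lhit C (counit C) x)) = res L f"
        by (rule res_cong_on) (use hit_laws(4)[OF C LD(3) precoalgD(3)[OF P5] precoalgD(3)[OF P5]] in simp)
      then show "p (res L (\<lambda>x. f (lhit C (counit C) x))) = p f" by (simp add: f)
    qed
    then show "ldot C DH (counit C) p = p" using d[OF p precoalgD(3)[OF P5]] pr by simp
    fix a b assume a: "functional C a" and b: "functional C b"
    have "res H (\<lambda>f. ldot C DH a p (res L (\<lambda>x. f (lhit C b x)))) = res H (\<lambda>f. p (res L (\<lambda>x. f (lhit C (conv C a b) x))))"
    proof (rule res_cong_on)
      fix f assume "f \<in> H"
      then have f: "res L (\<lambda>x. f (lhit C b x)) \<in> H" using shift_in[OF L _ b] by (simp add: H_def)
      have "res L (\<lambda>x. res L (\<lambda>x. f (lhit C b x)) (lhit C a x)) = res L (\<lambda>x. f (lhit C (conv C a b) x))"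
        by (rule res_cong_on) (use hit_laws(1)[OF C LD(3) a b] hit_in_sub(1)[OF P5 L1 a] in simp)
      then show "ldot C DH a p (res L (\<lambda>x. f (lhit C b x))) = p (res L (\<lambda>x. f (lhit C (conv C a b) x)))"
        unfolding d[OF p a] using f by simp
    qed
    then show "ldot C DH b (ldot C DH a p) = ldot C DH (conv C a b) p"
      unfolding d[OF dc[OF a p] b] d[OF p functional_conv[OF P5 a b]] .
  qed
  then show ?thesis by (simp add: DH_def)
qed

lemma res_Hom:
  assumes L: "L \<in> fd_subcoalgebras C" "L' \<in> fd_subcoalgebras C" "L \<subseteq> L'" and f: "f \<in> carrier (reg_Hom C M L')"
  shows "res L f \<in> carrier (reg_Hom C M L)"
proof -
  have L1: "subcoalg C L" "subcoalg C L'" using L by (auto simp: fd_subcoalgebras_iff)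
  have L2: "x \<in> L \<Longrightarrow> x \<in> L'" for x using L(3) by blast
  note fD = Hom_regularD[OF C M L1(2) f]
  note c = vspace_closed[OF subcoalgD(2)[OF P5 L1(1)], simplified]
  show ?thesis
    unfolding in_Hom_regular[OF C M L1(1)]
    using hit_in_sub(2)[OF P5 L1(1)] by (auto intro!: lin_onI simp: fD L2 c)
qed

lemma DHom_in: "p \<in> carrier (DHom C M L) \<longleftrightarrow> functional (reg_Hom C M L) p \<and> res (carrier (reg_Hom C M L)) p = p"
  by (simp add: DHom_simps[OF C M] in_Dual)

lemma DHom_trans_apply:
  "f \<in> carrier (reg_Hom C M L') \<Longrightarrow> DHom_trans C M L L' p f = p (res L f)"
  by (simp add: DHom_trans_def)

lemma DHom_trans_in:
  assumes L: "L \<in> fd_subcoalgebras C" "L' \<in> fd_subcoalgebras C" "L \<subseteq> L'" and p: "p \<in> carrier (DHom C M L)"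
  shows "DHom_trans C M L L' p \<in> carrier (DHom C M L')"
proof -
  have L1: "subcoalg C L" "subcoalg C L'" using L by (auto simp: fd_subcoalgebras_iff)
  have lin: "lin_on (reg_Hom C M L') (reg_Hom C M L) (res L)"
    by (rule lin_onI[OF res_Hom[OF L]])
      (auto simp: res_def plus_fun_apply pw_def fun_eq_iff vspace_smul[OF dM5(1)])
  have "functional (reg_Hom C M L') (\<lambda>f. p (res L f))"
    using lin_on_comp[OF lin, of kspace p] p by (simp add: DHom_in)
  then show ?thesis
    using Dual_resI[OF vspace_Hom_regular[OF C M L1(2)]] by (simp add: DHom_simps[OF C M] DHom_trans_def)
qed

lemma DHom_eqI:
  assumes "p \<in> carrier (DHom C M L)" "q \<in> carrier (DHom C M L)"
    "\<And>f. f \<in> carrier (reg_Hom C M L) \<Longrightarrow> p f = q f"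
  shows "p = q"
  by (rule fun_eq_resI[of "carrier (reg_Hom C M L)"]) (use assms in \<open>auto simp: DHom_in\<close>)

text \<open>Dual to restriction from L' to L, which commutes with precomposition by
  \<open>lhit\<close> because \<open>L\<close> is stable under it.\<close>

lemma DHom_trans_hom:
  assumes L: "L \<in> fd_subcoalgebras C" "L' \<in> fd_subcoalgebras C" "L \<subseteq> L'"
  shows "lcomod_hom C (DHom C M L) (DHom C M L') (DHom_trans C M L L')"
proof -
  have L1: "subcoalg C L" "subcoalg C L'" using L by (auto simp: fd_subcoalgebras_iff)
  note lc = left_comodule_DHom[OF L(1)] left_comodule_DHom[OF L(2)]
  show ?thesis
  proof (rule lcomod_homI[OF P5 lc])
    show "lin_on (DHom C M L) (DHom C M L') (DHom_trans C M L L')"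
      by (rule lin_onI[OF DHom_trans_in[OF L]])
        (auto simp: DHom_trans_def DHom_simps[OF C M] res_def plus_fun_apply pw_def fun_eq_iff)
    fix p a assume p: "p \<in> carrier (DHom C M L)" and a: "functional C a"
    note tp = DHom_trans_in[OF L p]
    show "DHom_trans C M L L' (ldot C (DHom C M L) a p) = ldot C (DHom C M L') a (DHom_trans C M L L' p)"
    proof (rule DHom_eqI)
      show "DHom_trans C M L L' (ldot C (DHom C M L) a p) \<in> carrier (DHom C M L')"
        by (rule DHom_trans_in[OF L left_comoduleD(5)[OF P5 lc(1) a p]])
      show "ldot C (DHom C M L') a (DHom_trans C M L L' p) \<in> carrier (DHom C M L')"
        by (rule left_comoduleD(5)[OF P5 lc(2) a tp])
      fix f assume f: "f \<in> carrier (reg_Hom C M L')"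
      have "res L (\<lambda>x. res L f (lhit C a x)) = res L (res L' (\<lambda>x. f (lhit C a x)))"
        by (rule res_cong_on) (use hit_in_sub(1)[OF P5 L1(1) a] L(3) in auto)
      then show "DHom_trans C M L L' (ldot C (DHom C M L) a p) f = ldot C (DHom C M L') a (DHom_trans C M L L' p) f"
        using f res_Hom[OF L f] shift_in[OF L(2) f a]
        by (simp add: DHom_trans_apply ldot_DHom[OF L(1) p a] ldot_DHom[OF L(2) tp a])
    qed
  qed
qed

lemma direct_system_DHom: "direct_system C (fd_subcoalgebras C) (DHom C M) (DHom_trans C M)"
  unfolding direct_system_def
proof (intro conjI ballI impI left_comodule_DHom DHom_trans_hom fd_subcoalgebras_nonempty[OF C])
  fix L L' assume "L \<in> fd_subcoalgebras C" "L' \<in> fd_subcoalgebras C"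
  then obtain L'' where "L'' \<in> fd_subcoalgebras C" "L \<subseteq> L''" "L' \<subseteq> L''"
    by (rule fd_subcoalgebras_directed[OF C])
  then show "\<exists>L''\<in>fd_subcoalgebras C. L \<subseteq> L'' \<and> L' \<subseteq> L''" by blast
next
  fix L p assume L: "L \<in> fd_subcoalgebras C" and p: "p \<in> carrier (DHom C M L)"
  then have L1: "subcoalg C L" by (auto simp: fd_subcoalgebras_iff)
  show "DHom_trans C M L L p = p"
    by (rule DHom_eqI[OF DHom_trans_in[OF L L order_refl p] p])
      (simp add: DHom_trans_apply Hom_regularD(6)[OF C M L1])
next
  fix L L' L'' p assume L: "L \<in> fd_subcoalgebras C" "L' \<in> fd_subcoalgebras C" "L'' \<in> fd_subcoalgebras C"
    and p: "p \<in> carrier (DHom C M L)" and le: "L \<subseteq> L'" "L' \<subseteq> L''"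
  have le': "L \<subseteq> L''" using le by blast
  show "DHom_trans C M L' L'' (DHom_trans C M L L' p) = DHom_trans C M L L'' p"
  proof (rule DHom_eqI[OF DHom_trans_in[OF L(2,3) le(2) DHom_trans_in[OF L(1,2) le(1) p]] DHom_trans_in[OF L(1,3) le' p]])
    fix f assume f: "f \<in> carrier (reg_Hom C M L'')"
    have "res L (res L' f) = res L f" by (rule res_cong_on) (use le in auto)
    then show "DHom_trans C M L' L'' (DHom_trans C M L L' p) f = DHom_trans C M L L'' p f"
      using f res_Hom[OF L(2,3) le(2) f] by (simp add: DHom_trans_apply)
  qed
qed auto

lemma left_comodule_star: "left_comodule C (star C M)"
  unfolding star_def by (rule left_comodule_dirlim[OF P5 direct_system_DHom])

lemma star_simps: "carrier (star C M) = carrier (lim_space (fd_subcoalgebras C) (DHom C M) (DHom_trans C M))"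
    "smul (star C M) = pw (*)"
  using dirlim_simps[OF P5 direct_system_DHom] by (simp_all add: star_def)

lemma star_in_hom: "L \<in> fd_subcoalgebras C \<Longrightarrow> lcomod_hom C (DHom C M L) (star C M) (star_in C M L)"
  unfolding star_def by (rule lim_in_hom[OF P5 direct_system_DHom])

lemma star_cases:
  assumes "y \<in> carrier (star C M)"
  obtains L p where "L \<in> fd_subcoalgebras C" "p \<in> carrier (DHom C M L)" "y = star_in C M L p"
  using assms unfolding star_simps by (rule lim_space_cases[OF P5 direct_system_DHom])

end

section \<open>Functoriality of the functor * and the transpose as a kernel\<close>

definition DHom_map :: "('k::field, 'c::ab_group_add) coalg \<Rightarrow> ('k, 'c, 'm::ab_group_add) rcomod \<Rightarrow> ('m \<Rightarrow> 'n::ab_group_add)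
    \<Rightarrow> 'c set \<Rightarrow> (('c \<Rightarrow> 'n) \<Rightarrow> 'k) \<Rightarrow> ('c \<Rightarrow> 'm) \<Rightarrow> 'k" where
  "DHom_map C M d L p = res (carrier (reg_Hom C M L)) (\<lambda>g. p (res L (d \<circ> g)))"

context
  fixes C :: "('k::field, 'c::ab_group_add) coalg" and M :: "('k, 'c, 'm::ab_group_add) rcomod"
    and N :: "('k, 'c, 'n::ab_group_add) rcomod" and d :: "'m \<Rightarrow> 'n"
  assumes C: "coalgebra C" and M: "right_comodule C M" and N: "right_comodule C N" and d: "rcomod_hom C M N d"
begin

private lemmas P6 = coalgebra_precoalg[OF C]
private lemmas dD6 = rcomod_homD[OF P6 M N d]

lemma Hom_post:
  assumes L: "L \<in> fd_subcoalgebras C" and g: "g \<in> carrier (reg_Hom C M L)"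
  shows "res L (d \<circ> g) \<in> carrier (reg_Hom C N L)"
proof -
  have L1: "subcoalg C L" using L by (auto simp: fd_subcoalgebras_iff)
  note gD = Hom_regularD[OF C M L1 g]
  note c = vspace_closed[OF subcoalgD(2)[OF P6 L1], simplified]
  show ?thesis
    unfolding in_Hom_regular[OF C N L1]
    using hit_in_sub(2)[OF P6 L1] by (auto intro!: lin_onI simp: gD c lin_onD[OF dD6(1)] dD6(2))
qed

lemma DHom_map_in:
  assumes L: "L \<in> fd_subcoalgebras C" and p: "p \<in> carrier (DHom C N L)"
  shows "DHom_map C M d L p \<in> carrier (DHom C M L)"
proof -
  have L1: "subcoalg C L" using L by (auto simp: fd_subcoalgebras_iff)
  have lin: "lin_on (reg_Hom C M L) (reg_Hom C N L) (\<lambda>g. res L (d \<circ> g))"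
    by (rule lin_onI[OF Hom_post[OF L]])
      (auto simp: res_def plus_fun_apply pw_def fun_eq_iff Hom_regularD(2)[OF C M L1] lin_onD[OF dD6(1)]
          vspace_smul[OF right_comoduleD(1)[OF P6 N]])
  have "functional (reg_Hom C M L) (\<lambda>g. p (res L (d \<circ> g)))"
    using lin_on_comp[OF lin, of kspace p] p by (simp add: DHom_in[OF C N])
  then show ?thesis
    using Dual_resI[OF vspace_Hom_regular[OF C M L1]] by (simp add: DHom_simps[OF C M] DHom_map_def)
qed

lemma DHom_map_hom:
  assumes L: "L \<in> fd_subcoalgebras C"
  shows "lcomod_hom C (DHom C N L) (DHom C M L) (DHom_map C M d L)"
proof -
  have L1: "subcoalg C L" using L by (auto simp: fd_subcoalgebras_iff)
  note lc = left_comodule_DHom[OF C N L] left_comodule_DHom[OF C M L]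
  show ?thesis
  proof (rule lcomod_homI[OF P6 lc])
    show "lin_on (DHom C N L) (DHom C M L) (DHom_map C M d L)"
      by (rule lin_onI[OF DHom_map_in[OF L]])
        (auto simp: DHom_map_def DHom_simps[OF C M] DHom_simps[OF C N] res_def plus_fun_apply pw_def fun_eq_iff)
    fix p a assume p: "p \<in> carrier (DHom C N L)" and a: "functional C a"
    note tp = DHom_map_in[OF L p]
    show "DHom_map C M d L (ldot C (DHom C N L) a p) = ldot C (DHom C M L) a (DHom_map C M d L p)"
    proof (rule DHom_eqI[OF C M])
      show "DHom_map C M d L (ldot C (DHom C N L) a p) \<in> carrier (DHom C M L)"
        by (rule DHom_map_in[OF L left_comoduleD(5)[OF P6 lc(1) a p]])
      show "ldot C (DHom C M L) a (DHom_map C M d L p) \<in> carrier (DHom C M L)"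
        by (rule left_comoduleD(5)[OF P6 lc(2) a tp])
      fix f assume f: "f \<in> carrier (reg_Hom C M L)"
      have "res L (\<lambda>x. res L (d \<circ> f) (lhit C a x)) = res L (d \<circ> res L (\<lambda>x. f (lhit C a x)))"
        by (rule res_cong_on) (use hit_in_sub(1)[OF P6 L1 a] in auto)
      then show "DHom_map C M d L (ldot C (DHom C N L) a p) f = ldot C (DHom C M L) a (DHom_map C M d L p) f"
        using f Hom_post[OF L f] shift_in[OF C M L f a]
        by (simp add: ldot_DHom[OF C N L p a] ldot_DHom[OF C M L tp a]) (simp add: DHom_map_def)
    qed
  qed
qed

text \<open>Restricting a homomorphism to a smaller subcoalgebra commutes with composing it with d.
  This makes \<open>star_map\<close> well defined on classes.\<close>

lemma DHom_map_trans:
  assumes L: "L \<in> fd_subcoalgebras C" "L' \<in> fd_subcoalgebras C" "L \<subseteq> L'" and p: "p \<in> carrier (DHom C N L)"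
  shows "DHom_map C M d L' (DHom_trans C N L L' p) = DHom_trans C M L L' (DHom_map C M d L p)"
proof (rule DHom_eqI[OF C M DHom_map_in[OF L(2) DHom_trans_in[OF C N L p]] DHom_trans_in[OF C M L DHom_map_in[OF L(1) p]]])
  fix f assume f: "f \<in> carrier (reg_Hom C M L')"
  have "res L (res L' (d \<circ> f)) = res L (d \<circ> res L f)"
    by (rule res_cong_on) (use L(3) in auto)
  then show "DHom_map C M d L' (DHom_trans C N L L' p) f = DHom_trans C M L L' (DHom_map C M d L p) f"
    using f res_Hom[OF C M L f] Hom_post[OF L(2) f]
    by (simp add: DHom_map_def DHom_trans_apply[OF C M] DHom_trans_apply[OF C N])
qed

lemma star_map_compat:
  assumes L: "L \<in> fd_subcoalgebras C" "L' \<in> fd_subcoalgebras C" "L \<subseteq> L'" and p: "p \<in> carrier (DHom C N L)"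
  shows "star_in C M L' (DHom_map C M d L' (DHom_trans C N L L' p)) = star_in C M L (DHom_map C M d L p)"
  unfolding DHom_map_trans[OF L p]
  by (rule lim_in_trans[OF P6 direct_system_DHom[OF C M] L DHom_map_in[OF L(1) p]])

lemma star_map_eq: "star_map C M N d = lim_lift (fd_subcoalgebras C) (DHom C N) (DHom_trans C N)
     (\<lambda>L p. star_in C M L (DHom_map C M d L p))"
  by (simp add: star_map_def DHom_map_def)

lemma star_map_in:
  "L \<in> fd_subcoalgebras C \<Longrightarrow> p \<in> carrier (DHom C N L) \<Longrightarrow> star_map C M N d (star_in C N L p) = star_in C M L (DHom_map C M d L p)"
  unfolding star_map_eq by (rule lim_lift_in[where g = "\<lambda>L p. star_in C M L (DHom_map C M d L p)", OF P6 direct_system_DHom[OF C N]])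
    (simp_all add: star_map_compat)

lemma star_map_hom: "lcomod_hom C (star C N) (star C M) (star_map C M N d)"
  unfolding star_map_eq star_def[of C N]
proof (rule lim_lift_hom[OF P6 direct_system_DHom[OF C N] left_comodule_star[OF C M]])
  fix L assume L: "L \<in> fd_subcoalgebras C"
  show "lcomod_hom C (DHom C N L) (star C M) (\<lambda>p. star_in C M L (DHom_map C M d L p))"
    by (rule lcomod_hom_comp[OF P6 left_comodule_DHom[OF C N L] left_comodule_DHom[OF C M L] left_comodule_star[OF C M]
          DHom_map_hom[OF L] star_in_hom[OF C M L]])
qed (rule star_map_compat)

text \<open>The kernel of a comodule map is stable under the action, because the map commutes with
  the action.\<close>

lemma
  shows left_comodule_Tr: "left_comodule C (Tr C M d N)"
    and ldot_Tr: "y \<in> carrier (Tr C M d N) \<Longrightarrow> functional C a \<Longrightarrow> ldot C (Tr C M d N) a y = ldot C (star C N) a y"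
proof -
  note sM = left_comodule_star[OF C M] and sN = left_comodule_star[OF C N]
  note h = lcomod_homD[OF P6 sN sM star_map_hom]
  note dN = left_comoduleD[OF P6 sN] and dM = left_comoduleD[OF P6 sM]
  define K where "K = {y \<in> carrier (star C N). star_map C M N d y = 0}"
  have "module.subspace (smul (star C N)) K"
    by (rule subspaceI[OF dN(1)])
      (auto simp: K_def vspace_closed[OF dN(1)] lin_onD[OF h(1)] lin_on_zero[OF dN(1) h(1)] vspace_smul[OF dM(1)])
  then have K: "K \<subseteq> carrier (star C N)" "vspace (sub (star C N) K)"
    "x \<in> K \<Longrightarrow> functional C a \<Longrightarrow> ldot C (star C N) a x \<in> K" for x a
    using vspace_sub[OF dN(1)] dN(5) lin_on_zero[OF dM(1) dM(4)] by (auto simp: K_def h(2))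
  have Tr: "Tr C M d N = sub (star C N) K" by (simp add: Tr_def K_def)
  note s = left_comodule_subset[OF P6 sN K]
  show "left_comodule C (Tr C M d N)" unfolding Tr by (rule s(1))
  show "y \<in> carrier (Tr C M d N) \<Longrightarrow> functional C a \<Longrightarrow> ldot C (Tr C M d N) a y = ldot C (star C N) a y"
    unfolding Tr using s(3)[of y a] by simp
qed

end

section \<open>Injective comodules\<close>

text \<open>The coaction is id \<otimes> \<Delta>, reassociated to (M \<otimes> C) \<otimes> C. The
  underlying type is the one over which \<open>injective_comodule\<close> lets its test comodules
  range.\<close>

definition cofree :: "('k::field, 'c::ab_group_add) coalg \<Rightarrow> ('k, 'c, 'm::ab_group_add) rcomod
    \<Rightarrow> ('k, 'c, ('m, 'c, 'k) tensor) rcomod" where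
  "cofree C M = \<lparr>carrier = carrier (tensor M C), smul = pw (*),
     rcoact = tlift M C (\<lambda>y c. tlift C C (\<lambda>c1 c2. tens (tensor M C) C (tens M C y c1) c2) (comult C c))\<rparr>"

context
  fixes C :: "('k::field, 'c::ab_group_add) coalg" and M :: "('k, 'c, 'm::ab_group_add) rcomod"
  assumes C: "coalgebra C" and M: "right_comodule C M"
begin

private lemmas P7 = coalgebra_precoalg[OF C]
private lemmas vC7 = precoalgD(1)[OF P7] and \<Delta>7 = precoalgD(2)[OF P7]
private lemmas dM7 = right_comoduleD[OF P7 M]

lemma cofree_simps [simp]: "carrier (cofree C M) = carrier (tensor M C)" "smul (cofree C M) = pw (*)"
  by (simp_all add: cofree_def)

lemma vspace_cofree: "vspace (cofree C M)"
  using vspace_tensor[of M C] by (simp add: vspace_def)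

lemma bilin_cofree_inner:
  assumes y: "y \<in> carrier M"
  shows "bilin C C (tensor (tensor M C) C) (\<lambda>c1 c2. tens (tensor M C) C (tens M C y c1) c2)"
  by (rule bilin_precomp[OF bilin_tens[OF vspace_tensor vC7] vC7 vC7 bilinD(4)[OF bilin_tens[OF dM7(1) vC7] y]])
    (simp add: lin_on_def)

lemma bilin_cofree: "bilin M C (tensor (tensor M C) C)
   (\<lambda>y c. tlift C C (\<lambda>c1 c2. tens (tensor M C) C (tens M C y c1) c2) (comult C c))"
proof (rule bilinI[OF dM7(1) vC7 vspace_tensor])
  fix y assume "y \<in> carrier M"
  from lin_on_comp[OF \<Delta>7 tlift_lin[OF bilin_cofree_inner[OF this]]]
  show "lin_on C (tensor (tensor M C) C) (\<lambda>c. tlift C C (\<lambda>c1 c2. tens (tensor M C) C (tens M C y c1) c2) (comult C c))" .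
next
  fix c assume c: "c \<in> carrier C"
  show "lin_on M (tensor (tensor M C) C) (\<lambda>y. tlift C C (\<lambda>c1 c2. tens (tensor M C) C (tens M C y c1) c2) (comult C c))"
  proof (rule tlift_param_lin[OF bilin_cofree_inner _ lin_onD(1)[OF \<Delta>7 c] dM7(1) vC7])
    fix c1 c2 assume "c1 \<in> carrier C" "c2 \<in> carrier C"
    from lin_on_comp[OF bilinD(5)[OF bilin_tens[OF dM7(1) vC7] this(1)] bilinD(5)[OF bilin_tens[OF vspace_tensor vC7] this(2)]]
    show "lin_on M (tensor (tensor M C) C) (\<lambda>y. tens (tensor M C) C (tens M C y c1) c2)" .
  qed
qed

lemma tensor_cofree: "tensor (cofree C M) C = tensor (tensor M C) C"
  by (rule tensor_cong) simp_all

lemma rcoact_cofree_lin: "lin_on (cofree C M) (tensor (cofree C M) C) (rcoact (cofree C M))"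
  using tlift_lin[OF bilin_cofree] unfolding tensor_cofree by (simp add: lin_on_def cofree_def)

lemma rdot_cofree_lin: "functional C a \<Longrightarrow> lin_on (tensor M C) (tensor M C) (rdot C (cofree C M) a)"
  using rdot_lin[OF vC7 vspace_cofree rcoact_cofree_lin, of a] by (simp add: lin_on_def)

lemma rdot_cofree_tens:
  assumes a: "functional C a" and y: "y \<in> carrier M" and c: "c \<in> carrier C"
  shows "rdot C (cofree C M) a (tens M C y c) = tens M C y (rhit C a c)"
proof -
  have w: "comult C c \<in> carrier (tensor C C)" by (rule lin_onD(1)[OF \<Delta>7 c])
  have s: "rslice (cofree C M) C = rslice (tensor M C) C" by (rule rslice_space_cong) simp_all
  note B = bilin_comp[OF bilin_cofree_inner[OF y] vspace_tensor rslice_lin[OF vspace_tensor vC7 a]]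
  have "rdot C (cofree C M) a (tens M C y c)
      = rslice (tensor M C) C a (tlift C C (\<lambda>c1 c2. tens (tensor M C) C (tens M C y c1) c2) (comult C c))"
    by (simp add: rdot_def s) (simp add: cofree_def tlift_tens[OF bilin_cofree y c])
  also have "\<dots> = tlift C C (\<lambda>c1 c2. rslice (tensor M C) C a (tens (tensor M C) C (tens M C y c1) c2)) (comult C c)"
    by (rule tlift_comp[OF bilin_cofree_inner[OF y] vspace_tensor rslice_lin[OF vspace_tensor vC7 a] w])
  also have "\<dots> = tlift C C (\<lambda>c1 c2. tens M C y (smul C (a c2) c1)) (comult C c)"
    by (rule tlift_cong[OF B _ w]) (use y in \<open>simp add: rslice_tens[OF vspace_tensor vC7 a] tens_in tens_smul\<close>)
  also have "\<dots> = tens M C y (rhit C a c)"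
    unfolding rslice_def
    by (rule tlift_comp[OF bilin_rslice[OF vC7 vC7 a] vspace_tensor bilinD(4)[OF bilin_tens[OF dM7(1) vC7] y] w, symmetric])
  finally show ?thesis .
qed

lemma right_comodule_cofree: "right_comodule C (cofree C M)"
  unfolding right_comodule_iff[OF P7]
proof (intro conjI ballI allI impI vspace_cofree rcoact_cofree_lin)
  fix w assume "w \<in> carrier (cofree C M)"
  then have w: "w \<in> carrier (tensor M C)" by simp
  note \<epsilon> = precoalgD(3)[OF P7]
  show "rdot C (cofree C M) (counit C) w = w"
    by (rule tensor_lin_eqI[OF rdot_cofree_lin[OF \<epsilon>] _ dM7(1) _ w, of "\<lambda>w. w"])
      (simp_all add: lin_on_def rdot_cofree_tens[OF \<epsilon>] hit_laws(5)[OF C _ \<epsilon> \<epsilon>])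
  fix a b assume a: "functional C a" and b: "functional C b"
  note ab = functional_conv[OF P7 a b]
  show "rdot C (cofree C M) a (rdot C (cofree C M) b w) = rdot C (cofree C M) (conv C a b) w"
    by (rule tensor_lin_eqI[OF lin_on_comp[OF rdot_cofree_lin[OF b] rdot_cofree_lin[OF a]] rdot_cofree_lin[OF ab] dM7(1) _ w])
      (simp add: rdot_cofree_tens[OF a] rdot_cofree_tens[OF b] rdot_cofree_tens[OF ab] lin_onD(1)[OF rhit_lin[OF P7 b]]
        hit_laws(2)[OF C _ a b])
qed

text \<open>Coassociativity of \<open>M\<close>, read as the statement that \<rho> : M \<rightarrow>
  M \<otimes> C is a homomorphism into the cofree comodule. The right slice by b of either side is
  the action of \<open>conv C b a\<close> on x.\<close>

lemma rdot_cofree_rcoact: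
  assumes x: "x \<in> carrier M" and a: "functional C a"
  shows "rdot C (cofree C M) a (rcoact M x) = rcoact M (rdot C M a x)"
proof (rule rslice_eqI[OF lin_onD(1)[OF rdot_cofree_lin[OF a] dM7(3)[OF x]] dM7(3)[OF dM7(5)[OF a x]] dM7(1) vC7])
  fix b assume b: "functional C b"
  note ba = functional_conv[OF P7 b a]
  have "rslice M C b (rdot C (cofree C M) a w) = rslice M C (conv C b a) w" if w: "w \<in> carrier (tensor M C)" for w
    by (rule tensor_lin_eqI[OF lin_on_comp[OF rdot_cofree_lin[OF a] rslice_lin[OF dM7(1) vC7 b]] rslice_lin[OF dM7(1) vC7 ba] dM7(1) _ w])
      (simp add: rdot_cofree_tens[OF a] rslice_tens[OF dM7(1) vC7 b] rslice_tens[OF dM7(1) vC7 ba] lin_onD(1)[OF rhit_lin[OF P7 a]]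
        conv_rhit[OF P7 b a])
  from this[OF dM7(3)[OF x]] show "rslice M C b (rdot C (cofree C M) a (rcoact M x)) = rslice M C b (rcoact M (rdot C M a x))"
    using dM7(6)[OF b a x] by (simp add: rdot_def)
qed

end

text \<open>The coaction identifies \<open>I\<close> with a subcomodule \<open>N\<close> of the
  cofree comodule, and id \<otimes> \<epsilon> is the inverse on \<open>N\<close>. Injectivity
  extends this inverse along the inclusion of \<open>N\<close> to the whole cofree comodule.\<close>

lemma injective_retraction:
  fixes I :: "('k::field, 'c::ab_group_add, 'm::ab_group_add) rcomod"
  assumes C: "coalgebra C" and I: "injective_comodule C I"
  obtains r where "rcomod_hom C (cofree C I) I r" "\<And>x. x \<in> carrier I \<Longrightarrow> r (rcoact I x) = x"
proof -
  note P = coalgebra_precoalg[OF C]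
  note vC = precoalgD(1)[OF P] and \<epsilon> = precoalgD(3)[OF P]
  have R: "right_comodule C I" using I by (simp add: injective_comodule_def)
  note d = right_comoduleD[OF P R]
  define F where "F = cofree C I"
  define N where "N = rcoact I ` carrier I"
  have RF: "right_comodule C F" unfolding F_def by (rule right_comodule_cofree[OF C R])
  note dF = right_comoduleD[OF P RF]
  have Fc: "carrier F = carrier (tensor I C)" "smul F = pw (*)" unfolding F_def by (rule cofree_simps[OF C R])+
  have "module.subspace (smul F) N"
  proof (rule subspaceI[OF dF(1)])
    show "0 \<in> N" unfolding N_def using lin_on_zero[OF d(1,2)] vspace_closed(1)[OF d(1)] by (metis imageI)
    show "u + v \<in> N" if "u \<in> N" "v \<in> N" for u v
      using that unfolding N_def by (auto simp flip: lin_onD(2)[OF d(2)] intro!: imageI vspace_closed[OF d(1)])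
    show "smul F k u \<in> N" if "u \<in> N" for k u
    proof -
      obtain x where x: "x \<in> carrier I" "u = rcoact I x" using \<open>u \<in> N\<close> by (auto simp: N_def)
      have "smul F k u = rcoact I (smul I k x)" using lin_onD(3)[OF d(2) x(1)] x(2) by (simp add: Fc)
      then show ?thesis using vspace_closed(4)[OF d(1) x(1)] by (simp add: N_def)
    qed
  qed
  then have N: "N \<subseteq> carrier F" "vspace (sub F N)" "\<And>x a. x \<in> N \<Longrightarrow> functional C a \<Longrightarrow> rdot C F a x \<in> N"
    using vspace_sub[OF dF(1)] rdot_cofree_rcoact[OF C R] d(3,5) by (auto simp: N_def F_def cofree_simps[OF C R])
  have s: "right_comodule C (sub F N)" "\<And>x a. x \<in> N \<Longrightarrow> functional C a \<Longrightarrow> rdot C (sub F N) a x = rdot C F a x"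
    using right_comodule_subset(1,3)[OF P RF N(1,2)] N(3) by blast+
  have u: "rcomod_hom C (sub F N) F (\<lambda>x. x)"
    by (rule rcomod_homI[OF P s(1) RF]) (use N(1) s(2) in \<open>auto simp: lin_on_def\<close>)
  have f0: "rslice I C (counit C) (rcoact I x) = x" if "x \<in> carrier I" for x
    using d(7)[OF that] by (simp add: rdot_def)
  have f: "rcomod_hom C (sub F N) I (rslice I C (counit C))"
  proof (rule rcomod_homI[OF P s(1) R])
    show "lin_on (sub F N) I (rslice I C (counit C))"
      by (rule lin_on_mono[OF rslice_lin[OF d(1) vC \<epsilon>]])
        (use N(1) Fc lin_onD(1)[OF rslice_lin[OF d(1) vC \<epsilon>]] in auto)
    fix x a assume "x \<in> carrier (sub F N)" and a: "functional C a"
    then obtain y where y: "x = rcoact I y" "y \<in> carrier I" "x \<in> N" by (auto simp: N_def)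
    have "rdot C (sub F N) a x = rcoact I (rdot C I a y)"
      using s(2)[OF y(3) a] rdot_cofree_rcoact[OF C R y(2) a] y(1) by (simp add: F_def)
    then show "rslice I C (counit C) (rdot C (sub F N) a x) = rdot C I a (rslice I C (counit C) x)"
      using f0[OF d(5)[OF a y(2)]] f0[OF y(2)] y(1) by simp
  qed
  have "inj_on (\<lambda>x. x) (carrier (sub F N))" by simp
  then obtain g where "rcomod_hom C F I g" "\<forall>x\<in>carrier (sub F N). g x = rslice I C (counit C) x"
    using I s(1) RF u f unfolding injective_comodule_def by blast
  then show thesis
    using f0 by (intro that[of g]) (auto simp: F_def N_def)
qed

section \<open>Homomorphisms from finite-dimensional subcoalgebras to an injective comodule\<close>

context
  fixes C :: "('k::field, 'c::ab_group_add) coalg" and I :: "('k, 'c, 'm::ab_group_add) rcomod"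
  assumes C: "coalgebra C" and I: "injective_comodule C I"
begin

private lemmas P8 = coalgebra_precoalg[OF C]
private lemmas vC8 = precoalgD(1)[OF P8] and \<Delta>8 = precoalgD(2)[OF P8]

lemma injective_right_comodule: "right_comodule C I" using I by (simp add: injective_comodule_def)

private lemmas dI8 = right_comoduleD[OF P8 injective_right_comodule]
private lemmas R3_8 = injective_right_comodule

text \<open>
  With \<open>r\<close> the retraction of the coaction and \<open>F e y = r (e \<otimes> y)\<close>, a homomorphism on a
  subcoalgebra \<open>L\<close> is a combination of the \<open>F e\<close>, twisted by functionals that are coordinates on \<open>L\<close>.
\<close>

lemma injective_Hom_basis:
  obtains F where
    "\<And>L e. L \<in> fd_subcoalgebras C \<Longrightarrow> e \<in> carrier I \<Longrightarrow> res L (F e) \<in> carrier (reg_Hom C I L)"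
    "\<And>L f S c x. L \<in> fd_subcoalgebras C \<Longrightarrow> f \<in> carrier (reg_Hom C I L) \<Longrightarrow> finite S \<Longrightarrow> S \<subseteq> L
      \<Longrightarrow> (\<And>b. b \<in> S \<Longrightarrow> functional C (c b)) \<Longrightarrow> (\<And>y. y \<in> L \<Longrightarrow> y = (\<Sum>b\<in>S. smul C (c b y) b)) \<Longrightarrow> x \<in> L
      \<Longrightarrow> f x = (\<Sum>b\<in>S. F (f b) (lhit C (c b) x))"
    "\<And>y. y \<in> carrier C \<Longrightarrow> F 0 y = 0"
proof -
  obtain r where r: "rcomod_hom C (cofree C I) I r" "\<And>x. x \<in> carrier I \<Longrightarrow> r (rcoact I x) = x"
    by (rule injective_retraction[OF C I]) blast
  note rD = rcomod_homD[OF P8 right_comodule_cofree[OF C R3_8] R3_8 r(1)]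
  have rl: "lin_on (tensor I C) I r"
    using rD(1) cofree_simps[OF C R3_8] by (simp add: lin_on_def)
  define F where "F = (\<lambda>e y. r (tens I C e y))"
  show thesis
  proof (rule that[of F])
    fix L e assume L: "L \<in> fd_subcoalgebras C" and e: "e \<in> carrier I"
    then have L1: "subcoalg C L" by (simp add: fd_subcoalgebras_iff)
    note LD = subcoalgD[OF P8 L1]
    have "lin_on C I (F e)"
      unfolding F_def by (rule lin_on_comp[OF bilinD(4)[OF bilin_tens[OF dI8(1) vC8] e] rl])
    then have "lin_on (sub C L) I (F e)"
      by (rule lin_on_mono) (use LD(1) lin_onD(1)[OF \<open>lin_on C I (F e)\<close>] in auto)
    then have "lin_on (sub C L) I (res L (F e))" by (rule lin_on_cong[OF LD(2)]) simp
    moreover have "F e (rhit C a x) = rdot C I a (F e x)" if "x \<in> L" "functional C a" for x a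
      using rD(2)[of "tens I C e x" a] rdot_cofree_tens[OF C R3_8 that(2) e LD(3)[OF that(1)]] that e LD(3)
      by (simp add: F_def cofree_simps[OF C R3_8] tens_in)
    ultimately show "res L (F e) \<in> carrier (reg_Hom C I L)"
      unfolding in_Hom_regular[OF C R3_8 L1] using hit_in_sub(2)[OF P8 L1] by simp
  next
    fix y assume y: "y \<in> carrier C"
    show "F 0 y = 0"
      unfolding F_def by (rule lin_on_zero[OF dI8(1) lin_on_comp[OF bilinD(5)[OF bilin_tens[OF dI8(1) vC8] y] rl]])
  next
    fix L f S c x
    assume L: "L \<in> fd_subcoalgebras C" and f: "f \<in> carrier (reg_Hom C I L)" and S: "finite S" "S \<subseteq> L"
      and c: "\<And>b. b \<in> S \<Longrightarrow> functional C (c b)" and exp: "\<And>y. y \<in> L \<Longrightarrow> y = (\<Sum>b\<in>S. smul C (c b y) b)" and x: "x \<in> L"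
    have L1: "subcoalg C L" using L by (simp add: fd_subcoalgebras_iff)
    note LD = subcoalgD[OF P8 L1]
    note fD = Hom_regularD[OF C R3_8 L1 f]
    have t: "tens I C (f b) (lhit C (c b) x) \<in> carrier (tensor I C)" if "b \<in> S" for b
      using that S(2) fD(2) lin_onD(1)[OF lhit_lin[OF P8 c]] LD(3)[OF x] by (intro tens_in) auto
    have w: "comult C x \<in> carrier (tensor C C)" using lin_onD(1)[OF \<Delta>8 LD(3)[OF x]] .
    \<comment> \<open>As f is a homomorphism, \<rho>(f x) = (f \<otimes> id)(\<Delta> x), and in
      coordinates \<Delta> x is the sum of b \<otimes> \<open>lhit C (c b) x\<close>. The equation
      is verified on right slices.\<close>
    have "rcoact I (f x) = (\<Sum>b\<in>S. tens I C (f b) (lhit C (c b) x))"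
    proof (rule rslice_eqI[OF dI8(3)[OF fD(2)[OF x]] vspace_closed(5)[OF vspace_tensor t] dI8(1) vC8])
      fix a assume a: "functional C a"
      have h: "rhit C a x \<in> L" using hit_in_sub(2)[OF P8 L1 a x] .
      have "rslice I C a (\<Sum>b\<in>S. tens I C (f b) (lhit C (c b) x)) = (\<Sum>b\<in>S. rslice I C a (tens I C (f b) (lhit C (c b) x)))"
        by (rule lin_on_sum[OF vspace_tensor rslice_lin[OF dI8(1) vC8 a] t])
      also have "\<dots> = (\<Sum>b\<in>S. smul I (c b (rhit C a x)) (f b))"
      proof (rule sum.cong[OF refl])
        fix b assume b: "b \<in> S"
        have "a (lhit C (c b) x) = c b (rhit C a x)" by (rule slice_swap[OF vC8 vC8 c[OF b] a w])
        then show "rslice I C a (tens I C (f b) (lhit C (c b) x)) = smul I (c b (rhit C a x)) (f b)"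
          using rslice_tens[OF dI8(1) vC8 a, of "f b" "lhit C (c b) x"] b S(2) fD(2) lin_onD(1)[OF lhit_lin[OF P8 c[OF b]] LD(3)[OF x]]
          by auto
      qed
      also have "\<dots> = (\<Sum>b\<in>S. f (smul C (c b (rhit C a x)) b))"
        by (rule sum.cong[OF refl], rule fD(4)[symmetric]) (use S(2) in blast)
      also have "\<dots> = f (\<Sum>b\<in>S. smul C (c b (rhit C a x)) b)"
        by (rule lin_on_sum[OF LD(2) fD(1), symmetric]) (use S(2) vspace_closed(4)[OF LD(2)] in auto)
      also have "\<dots> = rdot C I a (f x)" using exp[OF h] fD(5)[OF x a] by simp
      finally show "rslice I C a (rcoact I (f x)) = rslice I C a (\<Sum>b\<in>S. tens I C (f b) (lhit C (c b) x))"
        by (simp add: rdot_def)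
    qed
    then have "f x = r (\<Sum>b\<in>S. tens I C (f b) (lhit C (c b) x))" using r(2)[OF fD(2)[OF x]] by simp
    also have "\<dots> = (\<Sum>b\<in>S. F (f b) (lhit C (c b) x))"
      unfolding F_def by (rule lin_on_sum[OF vspace_tensor rl t])
    finally show "f x = (\<Sum>b\<in>S. F (f b) (lhit C (c b) x))" .
  qed
qed

lemma sum_fun_apply: "sum g B x = (\<Sum>b\<in>B. g b x)" for g :: "'a \<Rightarrow> 'x \<Rightarrow> 'y::ab_group_add"
  by (induction B rule: infinite_finite_induct) (auto simp: plus_fun_apply zero_fun_apply)

text \<open>In the formula of \<open>injective_Hom_basis\<close> for f on \<open>L\<close>, the
  vectors \<open>f b\<close>, the maps \<open>F (f b)\<close> and the functionals \<open>c b\<close>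
  all make sense on L'; read on L', the same sum is a homomorphism extending f.\<close>

lemma Hom_extend:
  assumes L: "L \<in> fd_subcoalgebras C" "L' \<in> fd_subcoalgebras C" "L \<subseteq> L'" and f: "f \<in> carrier (reg_Hom C I L)"
  obtains g where "g \<in> carrier (reg_Hom C I L')" "res L g = f"
proof -
  obtain F where F: "\<And>L e. L \<in> fd_subcoalgebras C \<Longrightarrow> e \<in> carrier I \<Longrightarrow> res L (F e) \<in> carrier (reg_Hom C I L)"
    "\<And>L f S c x. L \<in> fd_subcoalgebras C \<Longrightarrow> f \<in> carrier (reg_Hom C I L) \<Longrightarrow> finite S \<Longrightarrow> S \<subseteq> L
      \<Longrightarrow> (\<And>b. b \<in> S \<Longrightarrow> functional C (c b)) \<Longrightarrow> (\<And>y. y \<in> L \<Longrightarrow> y = (\<Sum>b\<in>S. smul C (c b y) b)) \<Longrightarrow> x \<in> L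
      \<Longrightarrow> f x = (\<Sum>b\<in>S. F (f b) (lhit C (c b) x))"
    by (rule injective_Hom_basis) blast
  have L1: "subcoalg C L" "subcoalg C L'" using L by (auto simp: fd_subcoalgebras_iff)
  note LD = subcoalgD[OF P8 L1(1)] and fD = Hom_regularD[OF C R3_8 L1(1) f]
  obtain B c where B: "finite B" "B \<subseteq> L'" "\<And>b. b \<in> B \<Longrightarrow> functional C (c b)"
    "\<And>x. x \<in> L' \<Longrightarrow> x = (\<Sum>b\<in>B. smul C (c b x) b)"
    "\<And>b. b \<in> B \<Longrightarrow> b \<in> L \<or> (\<forall>x\<in>L. c b x = 0)"
    by (rule fd_dual_basis[OF P8 L(2) LD(2) L(3)]) blast
  define S where "S = B \<inter> L"
  have S: "finite S" "S \<subseteq> L" "\<And>b. b \<in> S \<Longrightarrow> functional C (c b)" using B(1,3) by (auto simp: S_def)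
  \<comment> \<open>The coordinates at basis elements outside \<open>L\<close> vanish on
    \<open>L\<close>, so the basis elements inside \<open>L\<close> suffice for expanding its
    vectors.\<close>
  have exp: "y = (\<Sum>b\<in>S. smul C (c b y) b)" if y: "y \<in> L" for y
  proof -
    have 1: "y = (\<Sum>b\<in>B. smul C (c b y) b)" using B(4) y L(3) by blast
    have "smul C (c b y) b = 0" if "b \<in> B - S" for b
      using B(5)[of b] that y by (auto simp: S_def vspace_smul[OF vC8])
    then have 2: "(\<Sum>b\<in>B. smul C (c b y) b) = (\<Sum>b\<in>S. smul C (c b y) b)"
      by (intro sum.mono_neutral_right) (use B(1) in \<open>auto simp: S_def\<close>)
    from trans[OF 1 2] show ?thesis .
  qed
  define G where "G = (\<lambda>b. res L' (\<lambda>x. res L' (F (f b)) (lhit C (c b) x)))"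
  have G: "G b \<in> carrier (reg_Hom C I L')" if "b \<in> S" for b
    unfolding G_def using S that fD(2) by (intro shift_in[OF C R3_8 L(2) F(1)[OF L(2)]]) auto
  show thesis
  proof (rule that)
    show "(\<Sum>b\<in>S. G b) \<in> carrier (reg_Hom C I L')"
      by (rule vspace_closed(5)[OF vspace_Hom_regular[OF C R3_8 L1(2)] G])
    have "res L (\<Sum>b\<in>S. G b) = res L f"
    proof (rule res_cong_on)
      fix x assume x: "x \<in> L"
      have "G b x = F (f b) (lhit C (c b) x)" if "b \<in> S" for b
        using hit_in_sub(1)[OF P8 L1(2) S(3)[OF that] subsetD[OF L(3) x]] subsetD[OF L(3) x] by (simp add: G_def)
      moreover have "f x = (\<Sum>b\<in>S. F (f b) (lhit C (c b) x))"
        by (rule F(2)[OF L(1) f S exp x])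
      ultimately show "sum G S x = f x"
        unfolding sum_fun_apply by simp
    qed
    then show "res L (\<Sum>b\<in>S. G b) = f" using fD(6) by simp
  qed
qed

text \<open>By \<open>injective_Hom_basis\<close>, f is the sum over b of \<open>F (f b)\<close>
  twisted by \<open>c b\<close>. For b in \<open>L\<close> the vector \<open>f b\<close> is zero.
  For the other b the functional \<open>c b\<close> vanishes on \<open>L\<close>, so p . (c b) = 0
  by hypothesis, and p kills the twist.\<close>

lemma DHom_kernel:
  assumes L: "L \<in> fd_subcoalgebras C" "L' \<in> fd_subcoalgebras C" "L \<subseteq> L'"
    and p: "p \<in> carrier (DHom C I L')"
    and p0: "\<And>a. functional C a \<Longrightarrow> (\<And>x. x \<in> L \<Longrightarrow> a x = 0) \<Longrightarrow> ldot C (DHom C I L') a p = 0"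
    and f: "f \<in> carrier (reg_Hom C I L')" and f0: "\<And>x. x \<in> L \<Longrightarrow> f x = 0"
  shows "p f = 0"
proof -
  obtain F where F: "\<And>L e. L \<in> fd_subcoalgebras C \<Longrightarrow> e \<in> carrier I \<Longrightarrow> res L (F e) \<in> carrier (reg_Hom C I L)"
    "\<And>L f S c x. L \<in> fd_subcoalgebras C \<Longrightarrow> f \<in> carrier (reg_Hom C I L) \<Longrightarrow> finite S \<Longrightarrow> S \<subseteq> L
      \<Longrightarrow> (\<And>b. b \<in> S \<Longrightarrow> functional C (c b)) \<Longrightarrow> (\<And>y. y \<in> L \<Longrightarrow> y = (\<Sum>b\<in>S. smul C (c b y) b)) \<Longrightarrow> x \<in> L
      \<Longrightarrow> f x = (\<Sum>b\<in>S. F (f b) (lhit C (c b) x))"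
    "\<And>y. y \<in> carrier C \<Longrightarrow> F 0 y = 0"
    by (rule injective_Hom_basis) blast
  have L1: "subcoalg C L" "subcoalg C L'" using L by (auto simp: fd_subcoalgebras_iff)
  note LD = subcoalgD[OF P8 L1(1)] and LD' = subcoalgD[OF P8 L1(2)] and fD = Hom_regularD[OF C R3_8 L1(2) f]
  note vH = vspace_Hom_regular[OF C R3_8 L1(2)]
  have pl: "functional (reg_Hom C I L') p" using p by (simp add: DHom_in[OF C R3_8])
  obtain B c where B: "finite B" "B \<subseteq> L'" "\<And>b. b \<in> B \<Longrightarrow> functional C (c b)"
    "\<And>x. x \<in> L' \<Longrightarrow> x = (\<Sum>b\<in>B. smul C (c b x) b)"
    "\<And>b. b \<in> B \<Longrightarrow> b \<in> L \<or> (\<forall>x\<in>L. c b x = 0)"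
    by (rule fd_dual_basis[OF P8 L(2) LD(2) L(3)]) blast
  define G where "G = (\<lambda>b. res L' (\<lambda>x. res L' (F (f b)) (lhit C (c b) x)))"
  have Fin: "res L' (F (f b)) \<in> carrier (reg_Hom C I L')" if "b \<in> B" for b
    using B(2) that fD(2) by (intro F(1)[OF L(2)]) auto
  have G: "G b \<in> carrier (reg_Hom C I L')" if "b \<in> B" for b
    unfolding G_def by (rule shift_in[OF C R3_8 L(2) Fin[OF that] B(3)[OF that]])
  have "f = (\<Sum>b\<in>B. G b)"
  proof (rule fun_eq_resI[of L'])
    show "res L' (\<Sum>b\<in>B. G b) = (\<Sum>b\<in>B. G b)"
      by (rule Hom_regularD(6)[OF C R3_8 L1(2) vspace_closed(5)[OF vH G]])
    fix x assume x: "x \<in> L'"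
    have "G b x = F (f b) (lhit C (c b) x)" if "b \<in> B" for b
      using hit_in_sub(1)[OF P8 L1(2) B(3)[OF that] x] x by (auto simp: G_def)
    moreover have "f x = (\<Sum>b\<in>B. F (f b) (lhit C (c b) x))"
      by (rule F(2)[OF L(2) f B(1-4) x])
    ultimately show "f x = sum G B x"
      unfolding sum_fun_apply by simp
  qed (rule fD(6))
  then have "p f = (\<Sum>b\<in>B. p (G b))" using lin_on_sum[OF vH pl G] by simp
  also have "\<dots> = 0"
  proof (rule sum.neutral, rule ballI)
    fix b assume b: "b \<in> B"
    show "p (G b) = 0"
    proof (cases "b \<in> L")
      case True
      have "F 0 (lhit C (c b) x) = 0" if "x \<in> L'" for x
        using F(3)[OF lin_onD(1)[OF lhit_lin[OF P8 B(3)[OF b]] LD'(3)[OF that]]] .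
      then have "G b = 0"
        using f0[OF True] by (auto simp: G_def res_def fun_eq_iff zero_fun_apply)
      then show ?thesis using lin_on_zero[OF vH pl] by simp
    next
      case False
      then have "ldot C (DHom C I L') (c b) p = 0" using p0[OF B(3)[OF b]] B(5)[OF b] by blast
      then have "res (carrier (reg_Hom C I L')) (\<lambda>f. p (res L' (\<lambda>x. f (lhit C (c b) x)))) (res L' (F (f b))) = 0"
        unfolding ldot_DHom[OF C R3_8 L(2) p B(3)[OF b]] by (simp add: zero_fun_apply)
      then show ?thesis using Fin[OF b] by (simp add: G_def)
    qed
  qed
  finally show ?thesis .
qed

text \<open>Since homomorphisms extend from \<open>L\<close> to L', restriction is onto and the
  transition map dual to it is injective. By \<open>lim_in_inj\<close> this carries over to the
  limit.\<close>

lemma star_in_inj: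
  assumes L: "L \<in> fd_subcoalgebras C"
  shows "inj_on (star_in C I L) (carrier (DHom C I L))"
proof (rule lim_in_inj[OF P8 direct_system_DHom[OF C R3_8] _ L])
  fix L' assume L': "L' \<in> fd_subcoalgebras C" "L \<subseteq> L'"
  show "inj_on (DHom_trans C I L L') (carrier (DHom C I L))"
  proof (rule inj_onI)
    fix p q assume p: "p \<in> carrier (DHom C I L)" "q \<in> carrier (DHom C I L)"
      and eq: "DHom_trans C I L L' p = DHom_trans C I L L' q"
    show "p = q"
    proof (rule DHom_eqI[OF C R3_8 p])
      fix f assume "f \<in> carrier (reg_Hom C I L)"
      then obtain g where g: "g \<in> carrier (reg_Hom C I L')" "res L g = f"
        by (rule Hom_extend[OF L L'])
      show "p f = q f"
        using DHom_trans_apply[OF C R3_8 g(1), of L p] DHom_trans_apply[OF C R3_8 g(1), of L q] eq g(2) by simp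
    qed
  qed
qed

text \<open>The coaction of \<open>DHom C I L\<close> has its left factors in
  \<open>L\<close>.\<close>

lemma DHom_annihilator:
  assumes L: "L \<in> fd_subcoalgebras C" and p: "p \<in> carrier (DHom C I L)" and a: "functional C a" "\<And>x. x \<in> L \<Longrightarrow> a x = 0"
  shows "ldot C (DHom C I L) a p = 0"
proof -
  have L1: "subcoalg C L" using L by (auto simp: fd_subcoalgebras_iff)
  note LD = subcoalgD[OF P8 L1]
  note d = left_comoduleD[OF P8 left_comodule_DHom[OF C R3_8 L]]
  show ?thesis
    unfolding ldot_def
    using tensor_left_iff[OF vC8 d(1) LD(2,1) d(3)[OF p]] DHom_coact(1)[OF C R3_8 L p] a by blast
qed

text \<open>A representative p of y is taken at a stage L' containing \<open>L\<close>. By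
  \<open>DHom_kernel\<close> the value of p at a homomorphism depends only on its restriction to
  \<open>L\<close>, so p descends to a functional on Hom(L, I).\<close>

lemma star_in_image:
  assumes L: "L \<in> fd_subcoalgebras C" and y: "y \<in> carrier (star C I)"
    and y0: "\<And>a. functional C a \<Longrightarrow> (\<And>x. x \<in> L \<Longrightarrow> a x = 0) \<Longrightarrow> ldot C (star C I) a y = 0"
  obtains q where "q \<in> carrier (DHom C I L)" "y = star_in C I L q"
proof -
  obtain L0 p0 where p0: "L0 \<in> fd_subcoalgebras C" "p0 \<in> carrier (DHom C I L0)" "y = star_in C I L0 p0"
    by (rule star_cases[OF C R3_8 y])
  obtain L' where L': "L' \<in> fd_subcoalgebras C" "L0 \<subseteq> L'" "L \<subseteq> L'"
    by (rule fd_subcoalgebras_directed[OF C p0(1) L])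
  define p where "p = DHom_trans C I L0 L' p0"
  have p: "p \<in> carrier (DHom C I L')" unfolding p_def by (rule DHom_trans_in[OF C R3_8 p0(1) L'(1,2) p0(2)])
  have yp: "y = star_in C I L' p"
    unfolding p_def p0(3) by (rule lim_in_trans[OF P8 direct_system_DHom[OF C R3_8] p0(1) L'(1,2) p0(2), symmetric])
  note lD = left_comodule_DHom[OF C R3_8 L'(1)] and lS = left_comodule_star[OF C R3_8]
  note h = lcomod_homD[OF P8 lD lS star_in_hom[OF C R3_8 L'(1)]]
  have L1: "subcoalg C L" "subcoalg C L'" using L L' by (auto simp: fd_subcoalgebras_iff)
  note vH' = vspace_Hom_regular[OF C R3_8 L1(2)] and vH = vspace_Hom_regular[OF C R3_8 L1(1)]
  have pl: "functional (reg_Hom C I L') p" using p by (simp add: DHom_in[OF C R3_8])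
  \<comment> \<open>The vanishing is given in the limit only; injectivity of \<open>star_in\<close>
    at the stage L' brings it back to p.\<close>
  have ann: "ldot C (DHom C I L') a p = 0" if a: "functional C a" "\<And>x. x \<in> L \<Longrightarrow> a x = 0" for a
  proof (rule inj_onD[OF star_in_inj[OF L'(1)]])
    show "star_in C I L' (ldot C (DHom C I L') a p) = star_in C I L' 0"
      using h(2)[OF p a(1)] y0[OF a] yp lin_on_zero[OF left_comoduleD(1)[OF P8 lD] h(1)] by simp
  qed (use left_comoduleD(5)[OF P8 lD a(1) p] vspace_closed(1)[OF left_comoduleD(1)[OF P8 lD]] in auto)
  note ker = DHom_kernel[OF L L'(1,3) p ann]
  have same: "p f = p g" if fg: "f \<in> carrier (reg_Hom C I L')" "g \<in> carrier (reg_Hom C I L')" "res L f = res L g" for f g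
  proof -
    have "p (f - g) = 0"
    proof (rule ker)
      show "f - g \<in> carrier (reg_Hom C I L')" by (rule vspace_closed(3)[OF vH' fg(1,2)])
      show "(f - g) x = 0" if "x \<in> L" for x using fun_cong[OF fg(3), of x] that by simp
    qed
    then show ?thesis using lin_on_diff[OF vH' pl fg(1,2)] by simp
  qed
  \<comment> \<open>A choice of extensions need not be linear in f. Its composite with p is linear,
    because by \<open>same\<close> the value of p does not depend on the extension.\<close>
  define ext where "ext = (\<lambda>f. SOME g. g \<in> carrier (reg_Hom C I L') \<and> res L g = f)"
  have ext: "ext f \<in> carrier (reg_Hom C I L')" "res L (ext f) = f" if "f \<in> carrier (reg_Hom C I L)" for f
  proof -
    have "\<exists>g. g \<in> carrier (reg_Hom C I L') \<and> res L g = f"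
      by (rule Hom_extend[OF L L'(1,3) that]) blast
    from someI_ex[OF this] show "ext f \<in> carrier (reg_Hom C I L')" "res L (ext f) = f"
      by (simp_all add: ext_def)
  qed
  have "functional (reg_Hom C I L) (\<lambda>f. p (ext f))"
  proof (rule lin_onI)
    fix f k assume f: "f \<in> carrier (reg_Hom C I L)"
    have kf: "pw (smul I) k (ext f) \<in> carrier (reg_Hom C I L')"
      using vspace_closed(4)[OF vH' ext(1)[OF f], of k] by simp
    have kf': "pw (smul I) k f \<in> carrier (reg_Hom C I L)"
      using vspace_closed(4)[OF vH f, of k] by simp
    have "res L (pw (smul I) k (ext f)) = pw (smul I) k (res L (ext f))"
      by (auto simp: res_def pw_def fun_eq_iff vspace_smul[OF dI8(1)])
    then have "p (ext (pw (smul I) k f)) = p (pw (smul I) k (ext f))"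
      by (intro same ext(1)[OF kf'] kf) (simp add: ext(2)[OF kf'] ext(2)[OF f])
    then show "p (ext (smul (reg_Hom C I L) k f)) = smul kspace k (p (ext f))"
      using lin_onD(3)[OF pl ext(1)[OF f], of k] by simp
    fix g assume g: "g \<in> carrier (reg_Hom C I L)"
    note fg = vspace_closed(2)[OF vH f g]
    have "p (ext (f + g)) = p (ext f + ext g)"
      by (rule same[OF ext(1)[OF fg] vspace_closed(2)[OF vH' ext(1)[OF f] ext(1)[OF g]]])
        (simp add: res_add ext(2)[OF f] ext(2)[OF g] ext(2)[OF fg])
    then show "p (ext (f + g)) = p (ext f) + p (ext g)"
      using lin_onD(2)[OF pl ext(1)[OF f] ext(1)[OF g]] by simp
  qed simp
  from Dual_resI[OF vH this] have q: "res (carrier (reg_Hom C I L)) (\<lambda>f. p (ext f)) \<in> carrier (DHom C I L)" (is "?q \<in> _")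
    by (simp add: DHom_simps[OF C R3_8])
  have "DHom_trans C I L L' ?q = p"
  proof (rule DHom_eqI[OF C R3_8 DHom_trans_in[OF C R3_8 L L'(1,3) q] p])
    fix f assume f: "f \<in> carrier (reg_Hom C I L')"
    note rf = res_Hom[OF C R3_8 L L'(1,3) f]
    show "DHom_trans C I L L' ?q f = p f"
      using same[OF ext(1)[OF rf] f ext(2)[OF rf]] rf by (simp add: DHom_trans_apply[OF C R3_8 f])
  qed
  then have "y = star_in C I L ?q"
    unfolding yp using lim_in_trans[OF P8 direct_system_DHom[OF C R3_8] L L'(1,3) q] by simp
  then show thesis using that q by blast
qed

end

section \<open>Cotensor products and the transpose over a subcoalgebra\<close>

text \<open>\<open>N\<close> is not assumed to be a comodule: a linear bijection compatible with the
  two coactions carries the laws over. This is needed for \<open>cotensor\<close>, which is given by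
  a formula for its coaction only.\<close>

lemma lcomod_iso_transport:
  assumes C: "precoalg C" and M: "left_comodule C M" and N: "vspace N" and f: "lin_on M N f"
    and bij: "bij_betw f (carrier M) (carrier N)"
    and hom: "\<And>x. x \<in> carrier M \<Longrightarrow> lcoact N (f x) = tlift C M (\<lambda>c y. tens C N c (f y)) (lcoact M x)"
  shows "lcomod_iso C M N f"
proof -
  note vC = precoalgD(1)[OF C] and d = left_comoduleD[OF C M]
  have B: "bilin C M (tensor C N) (\<lambda>c y. tens C N c (f y))"
    using bilin_precomp[OF bilin_tens[OF vC N] vC d(1) _ f, of "\<lambda>x. x"] by (simp add: lin_on_def)
  note lin = lin_on_comp[OF d(2) tlift_lin[OF B]]
  have cov: "\<exists>x\<in>carrier M. n = f x" if "n \<in> carrier N" for n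
    using bij that by (auto simp: bij_betw_def)
  note c = vspace_closed[OF d(1)]
  have \<rho>: "lin_on N (tensor C N) (lcoact N)"
  proof (rule lin_onI)
    fix n k assume "n \<in> carrier N"
    then obtain x where x: "x \<in> carrier M" "n = f x" using cov by blast
    show "lcoact N n \<in> carrier (tensor C N)" using x lin_onD(1)[OF lin] by (simp add: hom)
    have "smul N k n = f (smul M k x)" using x lin_onD(3)[OF f] by simp
    then show "lcoact N (smul N k n) = smul (tensor C N) k (lcoact N n)"
      using x lin_onD(3)[OF lin] c by (simp add: hom)
    fix n' assume "n' \<in> carrier N"
    then obtain x' where x': "x' \<in> carrier M" "n' = f x'" using cov by blast
    have "n + n' = f (x + x')" using x x' lin_onD(2)[OF f] by simp
    then show "lcoact N (n + n') = lcoact N n + lcoact N n'"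
      using x x' lin_onD(2)[OF lin] c by (simp add: hom)
  qed
  have h: "lcomod_hom C M N f" using f hom by (simp add: lcomod_hom_def)
  then have dot: "f (ldot C M a x) = ldot C N a (f x)" if "functional C a" "x \<in> carrier M" for a x
    using lcomod_hom_iff[OF vC d(1) N d(2) \<rho>] that by blast
  have "left_comodule C N"
    unfolding left_comodule_iff[OF C]
  proof (intro conjI ballI allI impI N \<rho>)
    fix n assume "n \<in> carrier N"
    then obtain x where x: "x \<in> carrier M" "n = f x" using cov by blast
    show "ldot C N (counit C) n = n"
      using dot[OF precoalgD(3)[OF C] x(1)] d(7)[OF x(1)] x(2) by simp
    fix a b assume ab: "functional C a" "functional C b"
    show "ldot C N b (ldot C N a n) = ldot C N (conv C a b) n"
      using dot[OF ab(1) x(1)] dot[OF ab(2) d(5)[OF ab(1) x(1)]] dot[OF functional_conv[OF C ab] x(1)] d(6)[OF ab x(1)] x(2)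
      by simp
  qed
  then show ?thesis using M h bij by (simp add: lcomod_iso_def)
qed

lemma lcomod_iso_comp:
  assumes C: "precoalg C" and f: "lcomod_iso C M N f" and g: "lcomod_iso C N K g"
  shows "lcomod_iso C M K (\<lambda>x. g (f x))"
  using f g lcomod_hom_comp[OF C, of M N K f g] bij_betw_trans[of f _ _ g]
  by (auto simp: lcomod_iso_def comp_def)

lemma lcomod_iso_inv:
  assumes C: "precoalg C" and f: "lcomod_iso C M N f"
  shows "lcomod_iso C N M (inv_into (carrier M) f)"
proof -
  have M: "left_comodule C M" and N: "left_comodule C N" and h: "lcomod_hom C M N f"
    and bij: "bij_betw f (carrier M) (carrier N)" using f by (auto simp: lcomod_iso_def)
  note d = left_comoduleD[OF C M] and hD = lcomod_homD[OF C M N h]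
  let ?g = "inv_into (carrier M) f"
  have g: "?g (f x) = x" if "x \<in> carrier M" for x
    using bij that by (simp add: bij_betw_def)
  have cov: "\<exists>x\<in>carrier M. n = f x" if "n \<in> carrier N" for n
    using bij that by (auto simp: bij_betw_def)
  have "lcomod_hom C N M ?g"
  proof (rule lcomod_homI[OF C N M])
    show "lin_on N M ?g"
    proof (rule lin_onI)
      fix n k assume "n \<in> carrier N"
      then obtain x where x: "x \<in> carrier M" "n = f x" using cov by blast
      show "?g n \<in> carrier M" using x g by simp
      have "smul N k n = f (smul M k x)" using x lin_onD(3)[OF hD(1)] by simp
      then show "?g (smul N k n) = smul M k (?g n)" using x g vspace_closed(4)[OF d(1) x(1)] by simp
      fix n' assume "n' \<in> carrier N"
      then obtain x' where x': "x' \<in> carrier M" "n' = f x'" using cov by blast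
      have "n + n' = f (x + x')" using x x' lin_onD(2)[OF hD(1)] by simp
      then show "?g (n + n') = ?g n + ?g n'" using x x' g vspace_closed(2)[OF d(1) x(1) x'(1)] by simp
    qed
    fix n a assume "n \<in> carrier N" and a: "functional C a"
    then obtain x where x: "x \<in> carrier M" "n = f x" using cov by blast
    show "?g (ldot C N a n) = ldot C M a (?g n)"
      unfolding x(2) g[OF x(1)] hD(2)[OF x(1) a, symmetric] by (rule g[OF d(5)[OF a x(1)]])
  qed
  then show ?thesis using M N bij_betw_inv_into[OF bij] by (simp add: lcomod_iso_def)
qed

section \<open>The largest left comodule over \<Lambda> and the cotensor product\<close>

definition lpart :: "('k::field, 'c::ab_group_add) coalg \<Rightarrow> 'c set \<Rightarrow> ('k, 'c, 't::ab_group_add) lcomod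
    \<Rightarrow> ('k, 'c, 't) lcomod" where
  "lpart C L T = sub T {y \<in> carrier T. lcoact T y \<in> carrier (tensor (sub C L) T)}"

lemma lpart_simps [simp]: "smul (lpart C L T) = smul T" "lcoact (lpart C L T) = lcoact T"
  "carrier (lpart C L T) = {y \<in> carrier T. lcoact T y \<in> carrier (tensor (sub C L) T)}"
  by (simp_all add: lpart_def)

context
  fixes C :: "('k::field, 'c::ab_group_add) coalg" and L :: "'c set" and T :: "('k, 'c, 't::ab_group_add) lcomod"
  assumes C: "coalgebra C" and L: "subcoalg C L" and T: "left_comodule C T"
begin

private lemmas P9 = coalgebra_precoalg[OF C]
private lemmas vC9 = precoalgD(1)[OF P9] and \<epsilon>9 = precoalgD(3)[OF P9]
private lemmas dT9 = left_comoduleD[OF P9 T] and LD9 = subcoalgD[OF P9 L]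

text \<open>\<open>tensor_left_iff\<close> for the coaction of y. In this form closure under sums
  and under the action can be checked directly.\<close>

lemma in_lpart_iff:
  "y \<in> carrier (lpart C L T) \<longleftrightarrow> y \<in> carrier T \<and> (\<forall>a. functional C a \<longrightarrow> (\<forall>x\<in>L. a x = 0) \<longrightarrow> ldot C T a y = 0)"
  using tensor_left_iff[OF vC9 dT9(1) LD9(2,1) dT9(3)] by (auto simp: ldot_def)

text \<open>If b vanishes on \<open>L\<close>, so does \<open>conv C a b\<close>, because
  \<open>L\<close> is stable under \<open>lhit\<close>. Hence the action by a preserves the set of
  elements killed by the annihilator of \<open>L\<close>.\<close>

lemma lpart_subcomodule:
  shows left_comodule_lpart: "left_comodule C (lpart C L T)"
    and left_comodule_sub_lpart: "left_comodule (sub C L) (lpart C L T)"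
    and lcoact_lpart: "y \<in> carrier (lpart C L T) \<Longrightarrow> lcoact T y \<in> carrier (tensor (sub C L) (lpart C L T))"
proof -
  define N where "N = carrier (lpart C L T)"
  have N: "N \<subseteq> carrier T" by (auto simp: N_def)
  have ann: "ldot C T a y = 0" if "y \<in> N" "functional C a" "\<And>x. x \<in> L \<Longrightarrow> a x = 0" for a y
    using that in_lpart_iff unfolding N_def by blast
  have "module.subspace (smul T) N"
  proof (rule subspaceI[OF dT9(1)])
    show "0 \<in> N" unfolding N_def in_lpart_iff using vspace_closed(1)[OF dT9(1)] lin_on_zero[OF dT9(1) dT9(4)] by blast
    show "y + z \<in> N" if y: "y \<in> N" "z \<in> N" for y z
      unfolding N_def in_lpart_iff
      using vspace_closed(2)[OF dT9(1)] y N lin_onD(2)[OF dT9(4)] ann[OF y(1)] ann[OF y(2)] by (auto simp: subset_iff)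
    show "smul T k y \<in> N" if y: "y \<in> N" for k y
      unfolding N_def in_lpart_iff
      using vspace_closed(4)[OF dT9(1)] y N lin_onD(3)[OF dT9(4)] ann[OF y] by (auto simp: subset_iff vspace_smul[OF dT9(1)])
  qed
  then have vN: "vspace (sub T N)" by (rule vspace_sub[OF dT9(1)])
  have cl: "ldot C T a y \<in> N" if y: "y \<in> N" and a: "functional C a" for a y
    unfolding N_def in_lpart_iff
  proof (intro conjI allI impI)
    have yT: "y \<in> carrier T" using y N by blast
    show "ldot C T a y \<in> carrier T" by (rule dT9(5)[OF a yT])
    fix b assume b: "functional C b" "\<forall>x\<in>L. b x = 0"
    have "conv C a b x = 0" if "x \<in> L" for x
      using b(2) hit_in_sub(1)[OF P9 L a that] by (simp add: conv_def)
    then show "ldot C T b (ldot C T a y) = 0"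
      using dT9(6)[OF a b(1) yT] ann[OF y functional_conv[OF P9 a b(1)]] by simp
  qed
  have lp: "lpart C L T = sub T N" by (simp add: lpart_def N_def)
  have s: "left_comodule C (sub T N)" "\<And>y. y \<in> N \<Longrightarrow> lcoact T y \<in> carrier (tensor C (sub T N))"
    "\<And>y a. y \<in> N \<Longrightarrow> functional C a \<Longrightarrow> ldot C (sub T N) a y = ldot C T a y"
    using left_comodule_subset[OF P9 T N vN] cl by blast+
  show l: "left_comodule C (lpart C L T)" unfolding lp by (rule s(1))
  show m: "lcoact T y \<in> carrier (tensor (sub C L) (lpart C L T))" if y: "y \<in> carrier (lpart C L T)" for y
  proof -
    have yN: "y \<in> N" using y by (simp only: N_def)
    show ?thesis
      unfolding lp tensor_left_iff[OF vC9 vN LD9(2,1) s(2)[OF yN]]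
      using ann[OF yN] s(3)[OF yN] by (auto simp: ldot_def)
  qed
  show "left_comodule (sub C L) (lpart C L T)"
    unfolding left_comodule_sub_iff[OF P9 L] using l m by simp
qed

text \<open>For w in the cotensor product put y = (\<epsilon> \<otimes> id)(w). Slicing the defining
  equation by \<epsilon> turns one side into \<rho>(y) and the other into w. Conversely \<rho>(y)
  satisfies the equation by coassociativity.\<close>

lemma carrier_cotensor: "carrier (cotensor C L T) = lcoact T ` carrier (lpart C L T)"
    and lcoact_cotensor: "w \<in> carrier (tensor (sub C L) T) \<Longrightarrow> lcoact (cotensor C L T) w = comult_outer C T w"
    and cotensor_to_lcoact: "y \<in> carrier (lpart C L T) \<Longrightarrow> cotensor_to C L T (lcoact T y) = y"
proof -
  have 1: "tlift (sub C L) T (\<lambda>c y. tlift C C (\<lambda>c1 c2. tens C (tensor C T) c1 (tens C T c2 y)) (comult C c)) w = comult_outer C T w"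
    if "w \<in> carrier (tensor (sub C L) T)" for w
    unfolding comult_outer_def by (rule tlift_mono[OF bilin_comult_outer[OF P9 dT9(1)]]) (use LD9 dT9(1) that in auto)
  have 2: "tlift (sub C L) T (\<lambda>c y. tens C (tensor C T) c (lcoact T y)) w = coact_outer C T (lcoact T) w"
    if "w \<in> carrier (tensor (sub C L) T)" for w
    unfolding coact_outer_def by (rule tlift_mono[OF bilin_coact_outer[OF P9 dT9(1,2)]]) (use LD9 dT9(1) that in auto)
  have 3: "cotensor_to C L T w = lslice C T (counit C) w" if "w \<in> carrier (tensor (sub C L) T)" for w
    using lslice_sub[OF P9 L dT9(1) \<epsilon>9 refl that] by (simp add: cotensor_to_def lslice_def)
  show "lcoact (cotensor C L T) w = comult_outer C T w" if "w \<in> carrier (tensor (sub C L) T)"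
    using 1[OF that] by (simp add: cotensor_def)
  show "cotensor_to C L T (lcoact T y) = y" if "y \<in> carrier (lpart C L T)"
    using that dT9(7) by (simp add: 3 ldot_def)
  have c: "carrier (cotensor C L T) = {w \<in> carrier (tensor (sub C L) T). comult_outer C T w = coact_outer C T (lcoact T) w}"
    using 1 2 by (auto simp: cotensor_def)
  show "carrier (cotensor C L T) = lcoact T ` carrier (lpart C L T)"
  proof (intro equalityI subsetI)
    fix w assume "w \<in> carrier (cotensor C L T)"
    then have w: "w \<in> carrier (tensor (sub C L) T)" and eq: "comult_outer C T w = coact_outer C T (lcoact T) w"
      unfolding c by auto
    have wC: "w \<in> carrier (tensor C T)" by (rule tensor_mono[OF w]) (use LD9 in auto)
    let ?y = "lslice C T (counit C) w"
    have "lcoact T ?y = lslice C (tensor C T) (counit C) (comult_outer C T w)"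
      unfolding eq by (rule lslice_coact_outer[OF P9 dT9(1,2) \<epsilon>9 wC, symmetric])
    also have "\<dots> = tlift C T (\<lambda>c y. tens C T (lhit C (counit C) c) y) w"
      by (rule slice_comult_outer[OF P9 dT9(1) \<epsilon>9 vspace_tensor _ wC, of C T "\<lambda>x. x"]) (simp add: lin_on_def)
    also have "\<dots> = tlift C T (tens C T) w"
      by (rule tlift_cong[OF bilin_tens[OF vC9 dT9(1)] _ wC, symmetric]) (simp add: hit_laws(4)[OF C _ \<epsilon>9 \<epsilon>9])
    also have "\<dots> = w"
      by (rule tensor_lin_eqI[OF tlift_lin[OF bilin_tens[OF vC9 dT9(1)]] _ vC9 _ wC, of "\<lambda>x. x"])
        (simp_all add: lin_on_def tlift_tens[OF bilin_tens[OF vC9 dT9(1)]])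
    finally have "lcoact T ?y = w" .
    moreover have "?y \<in> carrier T" using lin_onD(1)[OF lslice_lin[OF vC9 dT9(1) \<epsilon>9] wC] .
    ultimately show "w \<in> lcoact T ` carrier (lpart C L T)" using w by (intro image_eqI[of _ _ ?y]) auto
  next
    fix w assume "w \<in> lcoact T ` carrier (lpart C L T)"
    then obtain y where y: "w = lcoact T y" "y \<in> carrier T" "w \<in> carrier (tensor (sub C L) T)" by auto
    have "coact_outer C T (lcoact T) w = comult_outer C T w"
      using T y by (auto simp: left_comodule_def coact_outer_def comult_outer_def)
    then show "w \<in> carrier (cotensor C L T)" unfolding c using y by simp
  qed
qed

text \<open>The inverse of the coaction is \<open>cotensor_to\<close>. Compatibility with the
  coactions is coassociativity once more, since \<open>lcoact\<close> of the cotensor product is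
  \<Delta> \<otimes> id.\<close>

lemma cotensor_iso: "lcomod_iso (sub C L) (lpart C L T) (cotensor C L T) (lcoact T)"
proof (rule lcomod_iso_transport[OF precoalg_sub[OF P9 L] left_comodule_sub_lpart])
  note dl = left_comoduleD[OF P9 left_comodule_lpart]
  have sm: "smul (cotensor C L T) = pw (*)" by (simp add: cotensor_def)
  have in_T: "x \<in> carrier T" if "x \<in> carrier (lpart C L T)" for x using that by simp
  show lin: "lin_on (lpart C L T) (cotensor C L T) (lcoact T)"
    by (rule lin_onI) (use lin_onD(2,3)[OF dT9(2)] in \<open>auto simp: carrier_cotensor sm simp del: lpart_simps(3) dest!: in_T\<close>)
  have "module.subspace (smul (tensor C T)) (carrier (cotensor C L T))"
  proof (rule subspaceI[OF vspace_tensor])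
    note cl = vspace_closed[OF dl(1)]
    show "0 \<in> carrier (cotensor C L T)"
      using lin_onD(1)[OF lin cl(1)] lin_on_zero[OF dl(1) lin] by simp
    fix v w k assume "v \<in> carrier (cotensor C L T)"
    then obtain x where x: "x \<in> carrier (lpart C L T)" "v = lcoact T x" unfolding carrier_cotensor by blast
    show "smul (tensor C T) k v \<in> carrier (cotensor C L T)"
      using lin_onD(1)[OF lin cl(4)[OF x(1), of k]] lin_onD(3)[OF lin x(1), of k] x(2) by (simp add: sm)
    assume "w \<in> carrier (cotensor C L T)"
    then obtain y where y: "y \<in> carrier (lpart C L T)" "w = lcoact T y" unfolding carrier_cotensor by blast
    show "v + w \<in> carrier (cotensor C L T)"
      using lin_onD(1)[OF lin cl(2)[OF x(1) y(1)]] lin_onD(2)[OF lin x(1) y(1)] x(2) y(2) by simp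
  qed
  then have "vspace (sub (tensor C T) (carrier (cotensor C L T)))" by (rule vspace_sub[OF vspace_tensor])
  then show "vspace (cotensor C L T)" by (simp add: vspace_def sm)
  show "bij_betw (lcoact T) (carrier (lpart C L T)) (carrier (cotensor C L T))"
    unfolding carrier_cotensor bij_betw_def
    by (intro conjI refl inj_on_inverseI[of _ "cotensor_to C L T"]) (rule cotensor_to_lcoact)
  fix y assume y: "y \<in> carrier (lpart C L T)"
  have w: "lcoact T y \<in> carrier (tensor (sub C L) T)" using y by simp
  have "lcoact (cotensor C L T) (lcoact T y) = coact_outer C T (lcoact T) (lcoact T y)"
    unfolding lcoact_cotensor[OF w] using T in_T[OF y] by (simp add: left_comodule_def coact_outer_def comult_outer_def)
  also have "\<dots> = tlift (sub C L) (lpart C L T) (\<lambda>c y. tens C (tensor C T) c (lcoact T y)) (lcoact T y)"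
    unfolding coact_outer_def
    by (rule tlift_mono[OF bilin_coact_outer[OF P9 dT9(1,2)], symmetric])
      (use LD9 lcoact_lpart[OF y] left_comoduleD(1)[OF P9 left_comodule_lpart] in auto)
  also have "tens C (tensor C T) = tens (sub C L) (cotensor C L T)"
    by (rule tens_cong) (simp_all add: sm)
  finally show "lcoact (cotensor C L T) (lcoact T y)
      = tlift (sub C L) (lpart C L T) (\<lambda>c y. tens (sub C L) (cotensor C L T) c (lcoact T y)) (lcoact (lpart C L T) y)"
    by simp
qed

end

text \<open>The kernel of D Hom(L, d) taken at the single stage \<open>L\<close>, before any limit
  is formed.\<close>

definition Tr_stage :: "('k::field, 'c::ab_group_add) coalg \<Rightarrow> ('k, 'c, 'i0::ab_group_add) rcomod
    \<Rightarrow> ('k, 'c, 'i1::ab_group_add) rcomod \<Rightarrow> ('i0 \<Rightarrow> 'i1) \<Rightarrow> 'c set \<Rightarrow> ('k, 'c, ('c \<Rightarrow> 'i1) \<Rightarrow> 'k) lcomod" where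
  "Tr_stage C I0 I1 d L = sub (DHom C I1 L) {p \<in> carrier (DHom C I1 L). DHom_map C I0 d L p = 0}"

context
  fixes C :: "('k::field, 'c::ab_group_add) coalg" and I0 :: "('k, 'c, 'i0::ab_group_add) rcomod"
    and I1 :: "('k, 'c, 'i1::ab_group_add) rcomod" and d :: "'i0 \<Rightarrow> 'i1"
  assumes C: "coalgebra C" and I0: "injective_comodule C I0" and I1: "injective_comodule C I1"
    and d: "rcomod_hom C I0 I1 d"
begin

private lemmas P10 = coalgebra_precoalg[OF C]
private lemmas R0_10 = injective_right_comodule[OF C I0] and R1_10 = injective_right_comodule[OF C I1]

text \<open>By \<open>star_in_inj\<close> and \<open>star_in_image\<close> for \<open>I1\<close>, D
  Hom(L, I1) is the part of the comodule I1* killed by the annihilator of \<open>L\<close>; the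
  kernels on both sides correspond as well.\<close>

lemma Tr_stage_iso:
  assumes L: "L \<in> fd_subcoalgebras C"
  shows "lcomod_iso (sub C L) (Tr_stage C I0 I1 d L) (lpart C L (Tr C I0 d I1)) (star_in C I1 L)"
proof -
  define T where "T = Tr C I0 d I1"
  have T: "left_comodule C T" unfolding T_def by (rule left_comodule_Tr[OF C R0_10 R1_10 d])
  have L1: "subcoalg C L" using L by (simp add: fd_subcoalgebras_iff)
  note LD = subcoalgD[OF P10 L1] and PL = precoalg_sub[OF P10 L1]
  note D0 = left_comodule_DHom[OF C R0_10 L] and D1 = left_comodule_DHom[OF C R1_10 L]
  note S1 = left_comodule_star[OF C R1_10] and S0 = left_comodule_star[OF C R0_10]
  note dD1 = left_comoduleD[OF P10 D1] and dT = left_comoduleD[OF P10 T]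
  note hm = lcomod_homD[OF P10 D1 D0 DHom_map_hom[OF C R0_10 R1_10 d L]]
  note h1 = lcomod_homD[OF P10 D1 S1 star_in_hom[OF C R1_10 L]]
  note h0 = lcomod_homD[OF P10 D0 S0 star_in_hom[OF C R0_10 L]]
  \<comment> \<open>Injectivity of \<open>I0\<close> enters here: D Hom(L, I0) embeds into I0*, so
    an image that is zero in the limit is already zero at the stage \<open>L\<close>.\<close>
  have ker: "star_map C I0 I1 d (star_in C I1 L p) = 0 \<longleftrightarrow> DHom_map C I0 d L p = 0" if p: "p \<in> carrier (DHom C I1 L)" for p
  proof -
    have "star_in C I0 L 0 = 0" by (rule lin_on_zero[OF left_comoduleD(1)[OF P10 D0] h0(1)])
    moreover have "star_in C I0 L (DHom_map C I0 d L p) = star_in C I0 L 0 \<longleftrightarrow> DHom_map C I0 d L p = 0"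
      by (rule inj_on_eq_iff[OF star_in_inj[OF C I0 L] lin_onD(1)[OF hm(1) p] vspace_closed(1)[OF left_comoduleD(1)[OF P10 D0]]])
    ultimately show ?thesis unfolding star_map_in[OF C R0_10 R1_10 d L p] by simp
  qed
  define K where "K = {p \<in> carrier (DHom C I1 L). DHom_map C I0 d L p = 0}"
  have K: "K \<subseteq> carrier (DHom C I1 L)" by (auto simp: K_def)
  have "module.subspace (smul (DHom C I1 L)) K"
    by (rule subspaceI[OF dD1(1)])
      (auto simp: K_def vspace_closed[OF dD1(1)] lin_onD[OF hm(1)] lin_on_zero[OF dD1(1) hm(1)]
        vspace_smul[OF left_comoduleD(1)[OF P10 D0]])
  then have vK: "vspace (sub (DHom C I1 L) K)" by (rule vspace_sub[OF dD1(1)])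
  have stage: "Tr_stage C I0 I1 d L = sub (DHom C I1 L) K" by (simp add: Tr_stage_def K_def)
  have clK: "ldot C (DHom C I1 L) a p \<in> K" if "p \<in> K" "functional C a" for p a
    using that dD1(5) hm(2)[of p a] lin_on_zero[OF left_comoduleD(1)[OF P10 D0] left_comoduleD(4)[OF P10 D0 that(2)]]
    by (auto simp: K_def)
  have sK: "left_comodule C (Tr_stage C I0 I1 d L)" "\<And>p. p \<in> K \<Longrightarrow> lcoact (DHom C I1 L) p \<in> carrier (tensor C (sub (DHom C I1 L) K))"
    "\<And>p a. p \<in> K \<Longrightarrow> functional C a \<Longrightarrow> ldot C (Tr_stage C I0 I1 d L) a p = ldot C (DHom C I1 L) a p"
    unfolding stage using left_comodule_subset[OF P10 D1 K vK] clK by blast+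
  have "lcoact (DHom C I1 L) p \<in> carrier (tensor (sub C L) (sub (DHom C I1 L) K))" if p: "p \<in> K" for p
    unfolding tensor_left_iff[OF precoalgD(1)[OF P10] vK LD(2,1) sK(2)[OF p]]
    using DHom_annihilator[OF C I1 L] K p sK(3)[OF p] by (auto simp: ldot_def stage)
  then have sL: "left_comodule (sub C L) (Tr_stage C I0 I1 d L)"
    unfolding left_comodule_sub_iff[OF P10 L1] using sK(1) by (simp add: stage)
  have mem: "lcoact (Tr_stage C I0 I1 d L) p \<in> carrier (tensor (sub C L) (Tr_stage C I0 I1 d L))" if "p \<in> carrier (Tr_stage C I0 I1 d L)" for p
    using sL that left_comoduleD(3)[OF PL sL] by blast
  have Tc: "carrier T = {y \<in> carrier (star C I1). star_map C I0 I1 d y = 0}" "smul T = smul (star C I1)"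
    by (simp_all add: T_def Tr_def)
  have dotT: "ldot C T a y = ldot C (star C I1) a y" if "y \<in> carrier T" "functional C a" for y a
    using ldot_Tr[OF C R0_10 R1_10 d, of y a] that by (simp add: T_def)
  have lT: "left_comodule C (lpart C L T)" "left_comodule (sub C L) (lpart C L T)"
    by (rule lpart_subcomodule[OF C L1 T])+
  have in_T: "star_in C I1 L p \<in> carrier T" if p: "p \<in> K" for p
    using lin_onD(1)[OF h1(1)] ker p by (auto simp: Tc K_def)
  have in_lp: "star_in C I1 L p \<in> carrier (lpart C L T)" if p: "p \<in> K" for p
    unfolding in_lpart_iff[OF C L1 T]
  proof (intro conjI allI impI in_T[OF p])
    fix a assume a: "functional C a" "\<forall>x\<in>L. a x = 0"
    have pD: "p \<in> carrier (DHom C I1 L)" using p K by blast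
    show "ldot C T a (star_in C I1 L p) = 0"
      using dotT[OF in_T[OF p] a(1)] h1(2)[OF pD a(1)] DHom_annihilator[OF C I1 L pD a(1)] a(2)
        lin_on_zero[OF dD1(1) h1(1)] by simp
  qed
  have "lcomod_hom C (Tr_stage C I0 I1 d L) (lpart C L T) (star_in C I1 L)"
  proof (rule lcomod_homI[OF P10 sK(1) lT(1)])
    show "lin_on (Tr_stage C I0 I1 d L) (lpart C L T) (star_in C I1 L)"
      by (rule lin_on_mono[OF h1(1)]) (use K in_lp in \<open>auto simp: stage Tc simp del: lpart_simps(3)\<close>)
    fix p a assume "p \<in> carrier (Tr_stage C I0 I1 d L)" and a: "functional C a"
    then have p: "p \<in> K" "p \<in> carrier (DHom C I1 L)" using K by (auto simp: stage)
    have eq: "ldot C (lpart C L T) a y = ldot C T a y" if y: "y \<in> carrier (lpart C L T)" for y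
      unfolding ldot_def lpart_simps
      by (rule lslice_mono[OF precoalgD(1)[OF P10] dT(1) a])
        (use left_comoduleD(1,3)[OF P10 lT(1)] y precoalgD(1)[OF P10] in auto)
    show "star_in C I1 L (ldot C (Tr_stage C I0 I1 d L) a p) = ldot C (lpart C L T) a (star_in C I1 L p)"
      unfolding eq[OF in_lp[OF p(1)]] dotT[OF in_T[OF p(1)] a] sK(3)[OF p(1) a] by (rule h1(2)[OF p(2) a])
  qed
  then have "lcomod_hom (sub C L) (Tr_stage C I0 I1 d L) (lpart C L T) (star_in C I1 L)"
    using lcomod_hom_sub_iff[OF P10 L1 left_comoduleD(1)[OF P10 sK(1)] left_comoduleD(1)[OF P10 lT(1)] mem] by blast
  moreover have "bij_betw (star_in C I1 L) K (carrier (lpart C L T))"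
    unfolding bij_betw_def
  proof (intro conjI equalityI subsetI)
    show "inj_on (star_in C I1 L) K" by (rule inj_on_subset[OF star_in_inj[OF C I1 L] K])
    fix y assume "y \<in> carrier (lpart C L T)"
    then have y: "y \<in> carrier T" "\<And>a. functional C a \<Longrightarrow> (\<And>x. x \<in> L \<Longrightarrow> a x = 0) \<Longrightarrow> ldot C (star C I1) a y = 0"
      unfolding in_lpart_iff[OF C L1 T] using dotT by auto
    have "y \<in> carrier (star C I1)" using y(1) by (simp add: Tc)
    then obtain q where q: "q \<in> carrier (DHom C I1 L)" "y = star_in C I1 L q"
      by (rule star_in_image[OF C I1 L _ y(2)]) 
    then have "q \<in> K" using y(1) ker[OF q(1)] by (simp add: K_def Tc)
    then show "y \<in> star_in C I1 L ` K" using q by blast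
  qed (use in_lp in blast)
  then have "bij_betw (star_in C I1 L) (carrier (Tr_stage C I0 I1 d L)) (carrier (lpart C L T))" by (simp add: stage)
  ultimately show ?thesis
    using sL lT(2) unfolding lcomod_iso_def T_def[symmetric] by blast
qed

end

section \<open>Restriction to a finite-dimensional subcoalgebra\<close>

lemma rpart_simps [simp]: "smul (rpart C L M) = smul M" "rcoact (rpart C L M) = rcoact M"
  "carrier (rpart C L M) = {x \<in> carrier M. rcoact M x \<in> carrier (tensor M (sub C L))}"
  by (simp_all add: rpart_def)

lemma regular_sub [simp]: "regular (sub C L) K = regular C K"
  by (simp add: regular_def)

context
  fixes C :: "('k::field, 'c::ab_group_add) coalg" and L :: "'c set"
  assumes C: "coalgebra C" and L: "subcoalg C L"
begin

private lemmas P11 = coalgebra_precoalg[OF C]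
private lemmas vC11 = precoalgD(1)[OF P11] and LD11 = subcoalgD[OF P11 L]

lemma in_rpart_iff:
  assumes M: "right_comodule C M"
  shows "x \<in> carrier (rpart C L M) \<longleftrightarrow> x \<in> carrier M \<and> (\<forall>a. functional C a \<longrightarrow> (\<forall>x\<in>L. a x = 0) \<longrightarrow> rdot C M a x = 0)"
  using tensor_right_iff[OF right_comoduleD(1)[OF P11 M] vC11 LD11(2,1) right_comoduleD(3)[OF P11 M]] by (auto simp: rdot_def)

text \<open>The mirror image of \<open>lpart_subcomodule\<close>: if b vanishes on \<open>L\<close>,
  so does \<open>conv C b a\<close>, by stability of \<open>L\<close> under
  \<open>rhit\<close>.\<close>

lemma
  assumes M: "right_comodule C M"
  shows right_comodule_rpart: "right_comodule C (rpart C L M)"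
    and right_comodule_sub_rpart: "right_comodule (sub C L) (rpart C L M)"
    and rdot_rpart: "x \<in> carrier (rpart C L M) \<Longrightarrow> functional C a \<Longrightarrow> rdot C (rpart C L M) a x = rdot C M a x"
proof -
  note dM = right_comoduleD[OF P11 M]
  define N where "N = carrier (rpart C L M)"
  have N: "N \<subseteq> carrier M" by (auto simp: N_def)
  have ann: "rdot C M a y = 0" if "y \<in> N" "functional C a" "\<And>x. x \<in> L \<Longrightarrow> a x = 0" for a y
    using that in_rpart_iff[OF M] unfolding N_def by blast
  have "module.subspace (smul M) N"
  proof (rule subspaceI[OF dM(1)])
    show "0 \<in> N" unfolding N_def in_rpart_iff[OF M] using vspace_closed(1)[OF dM(1)] lin_on_zero[OF dM(1) dM(4)] by blast
    show "y + z \<in> N" if y: "y \<in> N" "z \<in> N" for y z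
      unfolding N_def in_rpart_iff[OF M]
      using vspace_closed(2)[OF dM(1)] y N lin_onD(2)[OF dM(4)] ann[OF y(1)] ann[OF y(2)] by (auto simp: subset_iff)
    show "smul M k y \<in> N" if y: "y \<in> N" for k y
      unfolding N_def in_rpart_iff[OF M]
      using vspace_closed(4)[OF dM(1)] y N lin_onD(3)[OF dM(4)] ann[OF y] by (auto simp: subset_iff vspace_smul[OF dM(1)])
  qed
  then have vN: "vspace (sub M N)" by (rule vspace_sub[OF dM(1)])
  have cl: "rdot C M a y \<in> N" if y: "y \<in> N" and a: "functional C a" for a y
    unfolding N_def in_rpart_iff[OF M]
  proof (intro conjI allI impI)
    have yT: "y \<in> carrier M" using y N by blast
    show "rdot C M a y \<in> carrier M" by (rule dM(5)[OF a yT])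
    fix b assume b: "functional C b" "\<forall>x\<in>L. b x = 0"
    have "conv C b a x = 0" if "x \<in> L" for x
      using b(2) hit_in_sub(2)[OF P11 L a that] conv_rhit[OF P11 b(1) a LD11(3)[OF that]] by simp
    then show "rdot C M b (rdot C M a y) = 0"
      using dM(6)[OF b(1) a yT] ann[OF y functional_conv[OF P11 b(1) a]] by simp
  qed
  have rp: "rpart C L M = sub M N" by (simp add: rpart_def N_def)
  have s: "right_comodule C (sub M N)" "\<And>y. y \<in> N \<Longrightarrow> rcoact M y \<in> carrier (tensor (sub M N) C)"
    "\<And>y a. y \<in> N \<Longrightarrow> functional C a \<Longrightarrow> rdot C (sub M N) a y = rdot C M a y"
    using right_comodule_subset[OF P11 M N vN] cl by blast+
  show l: "right_comodule C (rpart C L M)" unfolding rp by (rule s(1))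
  show "x \<in> carrier (rpart C L M) \<Longrightarrow> functional C a \<Longrightarrow> rdot C (rpart C L M) a x = rdot C M a x"
    unfolding rp using s(3)[of x a] by simp
  have "rcoact M y \<in> carrier (tensor (sub M N) (sub C L))" if y: "y \<in> N" for y
    unfolding tensor_right_iff[OF vN vC11 LD11(2,1) s(2)[OF y]]
    using ann[OF y] s(3)[OF y] by (auto simp: rdot_def)
  then show "right_comodule (sub C L) (rpart C L M)"
    unfolding right_comodule_sub_iff[OF P11 L] using l by (simp add: rp)
qed

text \<open>A comodule over \<open>L\<close> is killed by the functionals vanishing on
  \<open>L\<close>, hence so is its image, which therefore lies in \<open>rpart C L M\<close>. In
  other words, \<open>rpart\<close> is right adjoint to the inclusion of comodules over
  \<open>L\<close>.\<close>

lemma rcomod_hom_rpart_iff: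
  assumes M: "right_comodule C M" and N: "right_comodule (sub C L) N"
  shows "rcomod_hom (sub C L) N (rpart C L M) f \<longleftrightarrow> rcomod_hom C N M f"
proof -
  have N': "right_comodule C N" "\<And>x. x \<in> carrier N \<Longrightarrow> rcoact N x \<in> carrier (tensor N (sub C L))"
    using N unfolding right_comodule_sub_iff[OF P11 L] by auto
  note dN = right_comoduleD[OF P11 N'(1)]
  note dr = right_comoduleD[OF P11 right_comodule_rpart[OF M]]
  have t: "tens (rpart C L M) C = tens M C" by (rule tens_cong) simp_all
  have "lin_on N (rpart C L M) f" if f: "rcomod_hom C N M f"
  proof (rule lin_on_mono)
    note fD = rcomod_homD[OF P11 N'(1) M f]
    show "lin_on N M f" by (rule fD(1))
    fix x assume x: "x \<in> carrier N"
    have "rdot C N a x = 0" if "functional C a" "\<And>x. x \<in> L \<Longrightarrow> a x = 0" for a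
      using tensor_right_iff[OF dN(1) vC11 LD11(2,1) dN(3)[OF x]] N'(2)[OF x] that by (auto simp: rdot_def)
    then show "f x \<in> carrier (rpart C L M)"
      unfolding in_rpart_iff[OF M] using lin_onD(1)[OF fD(1) x] by (auto simp: lin_on_zero[OF dN(1) fD(1)] simp flip: fD(2)[OF x])
  qed simp_all
  moreover have "lin_on N M f" if "lin_on N (rpart C L M) f"
    by (rule lin_onI) (use lin_onD[OF that] in auto)
  ultimately have "rcomod_hom C N (rpart C L M) f \<longleftrightarrow> rcomod_hom C N M f"
    unfolding rcomod_hom_def t rpart_simps by (auto simp: rcomod_hom_def)
  then show ?thesis
    using rcomod_hom_sub_iff[OF P11 L dN(1) dr(1) N'(2)] by blast
qed

text \<open>A literal equality of spaces of maps. It makes the stage \<open>L\<close> formed over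
  \<open>sub C L\<close> coincide with the one formed over \<open>C\<close>.\<close>

lemma Hom_rpart:
  assumes M: "right_comodule C M" and N: "right_comodule (sub C L) N"
  shows "Hom (sub C L) N (rpart C L M) = Hom C N M"
  by (simp add: Hom_def rcomod_hom_rpart_iff[OF M N])

lemma quasifinite_rpart:
  assumes M: "right_comodule C M" and q: "quasifinite C M"
  shows "quasifinite (sub C L) (rpart C L M)"
  unfolding quasifinite_def
proof (intro allI impI)
  fix F :: "('k, 'c, nat \<Rightarrow> 'k) rcomod"
  assume F: "right_comodule (sub C L) F \<and> findim F"
  then have "right_comodule C F" unfolding right_comodule_sub_iff[OF P11 L] by blast
  then show "findim (Hom (sub C L) F (rpart C L M))"
    using F q unfolding quasifinite_def by (simp add: Hom_rpart[OF M])
qed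

text \<open>An extension problem over \<open>L\<close> is one over \<open>C\<close>, and by
  \<open>rcomod_hom_rpart_iff\<close> its solution takes values in
  \<open>rpart C L I\<close>.\<close>

lemma injective_rpart:
  assumes I: "injective_comodule C I"
  shows "injective_comodule (sub C L) (rpart C L I)"
  unfolding injective_comodule_def
proof (intro conjI allI impI)
  have R: "right_comodule C I" by (rule injective_right_comodule[OF C I])
  show "right_comodule (sub C L) (rpart C L I)" by (rule right_comodule_sub_rpart[OF R])
  fix N N' :: "('k, 'c, ('a, 'c, 'k) tensor) rcomod" and u f
  assume *: "right_comodule (sub C L) N \<and> right_comodule (sub C L) N' \<and> rcomod_hom (sub C L) N N' u
    \<and> inj_on u (carrier N) \<and> rcomod_hom (sub C L) N (rpart C L I) f"
  then have N: "right_comodule (sub C L) N" and N': "right_comodule (sub C L) N'" by auto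
  then have N1: "right_comodule C N" "\<And>x. x \<in> carrier N \<Longrightarrow> rcoact N x \<in> carrier (tensor N (sub C L))" "right_comodule C N'"
    unfolding right_comodule_sub_iff[OF P11 L] by auto
  have "rcomod_hom C N N' u"
    using rcomod_hom_sub_iff[OF P11 L right_comoduleD(1)[OF P11 N1(1)] right_comoduleD(1)[OF P11 N1(3)] N1(2)] * by blast
  moreover have "rcomod_hom C N I f" using rcomod_hom_rpart_iff[OF R N] * by blast
  ultimately obtain g where "rcomod_hom C N' I g" "\<forall>x\<in>carrier N. g (u x) = f x"
    using I * N1(1,3) unfolding injective_comodule_def by blast
  then show "\<exists>g. rcomod_hom (sub C L) N' (rpart C L I) g \<and> (\<forall>x\<in>carrier N. g (u x) = f x)"
    using rcomod_hom_rpart_iff[OF R N'] by blast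
qed

lemma rcomod_hom_rpart:
  assumes M: "right_comodule C M" and N: "right_comodule C N" and f: "rcomod_hom C M N f"
  shows "rcomod_hom (sub C L) (rpart C L M) (rpart C L N) f"
  unfolding rcomod_hom_rpart_iff[OF N right_comodule_sub_rpart[OF M]]
proof (rule rcomod_homI[OF P11 right_comodule_rpart[OF M] N])
  note fD = rcomod_homD[OF P11 M N f]
  show "lin_on (rpart C L M) N f" by (rule lin_on_mono[OF fD(1)]) (use lin_onD(1)[OF fD(1)] in auto)
  fix x a assume x: "x \<in> carrier (rpart C L M)" and a: "functional C a"
  show "f (rdot C (rpart C L M) a x) = rdot C N a (f x)"
    unfolding rdot_rpart[OF M x a] using fD(2)[OF _ a] x by simp
qed

text \<open>As \<open>L\<close> contains \<open>cf C M\<close>, \<open>M\<close> is a comodule over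
  \<open>L\<close> and e maps into \<open>rpart C L I0\<close>; the kernel of d there is then the
  same image of e.\<close>

lemma qf_inj_copresentation_rpart:
  assumes q: "qf_inj_copresentation C M e I0 d I1" and cf: "cf C M \<subseteq> L"
  shows "qf_inj_copresentation (sub C L) M e (rpart C L I0) d (rpart C L I1)"
proof -
  from q have M: "right_comodule C M" and I: "quasifinite C I0" "injective_comodule C I0" "quasifinite C I1" "injective_comodule C I1"
    and e: "rcomod_hom C M I0 e" and d: "rcomod_hom C I0 I1 d" and ex: "inj_on e (carrier M)" "e ` carrier M = {x \<in> carrier I0. d x = 0}"
    unfolding qf_inj_copresentation_def by auto
  note R0 = injective_right_comodule[OF C I(2)] and R1 = injective_right_comodule[OF C I(4)]
  note dM = right_comoduleD[OF P11 M]
  have "rcoact M x \<in> carrier (tensor M (sub C L))" if x: "x \<in> carrier M" for x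
  proof (rule tensor_mem_right[OF dM(3)[OF x] dM(1) vC11])
    fix a assume a: "functional M a"
    \<comment> \<open>\<open>cf C M\<close> is an intersection of subspaces, each of which contains
      all slices of the coaction. Working slice by slice avoids having to intersect the tensor
      products.\<close>
    have "lslice M C a (rcoact M x) \<in> cf C M"
      unfolding cf_def
    proof (rule InterI)
      fix V assume "V \<in> {V. V \<subseteq> carrier C \<and> module.subspace (smul C) V \<and> (\<forall>x\<in>carrier M. rcoact M x \<in> carrier (tensor M (sub C V)))}"
      then have V: "V \<subseteq> carrier C" "vspace (sub C V)" "rcoact M x \<in> carrier (tensor M (sub C V))"
        using x vspace_sub[OF vC11] by auto
      have "lslice M (sub C V) a (rcoact M x) = lslice M C a (rcoact M x)"
        by (rule lslice_mono[OF dM(1) vC11 a]) (use V dM(1) in auto)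
      then show "lslice M C a (rcoact M x) \<in> V"
        using lin_onD(1)[OF lslice_lin[OF dM(1) V(2) a] V(3)] by simp
    qed
    then show "lslice M C a (rcoact M x) \<in> carrier (sub C L)" using cf by auto
  qed (use LD11 in auto)
  then have RL: "right_comodule (sub C L) M" unfolding right_comodule_sub_iff[OF P11 L] using M by blast
  have e': "rcomod_hom (sub C L) M (rpart C L I0) e" using rcomod_hom_rpart_iff[OF R0 RL] e by blast
  then have "e ` carrier M \<subseteq> carrier (rpart C L I0)" by (auto simp: rcomod_hom_def dest: lin_onD(1))
  then have "e ` carrier M = {x \<in> carrier (rpart C L I0). d x = 0}" using ex(2) by auto
  then show ?thesis
    unfolding qf_inj_copresentation_def
    by (intro conjI RL e' ex(1) quasifinite_rpart R0 R1 I injective_rpart rcomod_hom_rpart d)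
qed

end

context
  fixes C :: "('k::field, 'c::ab_group_add) coalg" and I0 :: "('k, 'c, 'i0::ab_group_add) rcomod"
    and I1 :: "('k, 'c, 'i1::ab_group_add) rcomod" and d :: "'i0 \<Rightarrow> 'i1" and L :: "'c set"
  assumes C: "coalgebra C" and I0: "injective_comodule C I0" and I1: "injective_comodule C I1"
    and d: "rcomod_hom C I0 I1 d" and fdL: "L \<in> fd_subcoalgebras C"
begin

private lemmas P12 = coalgebra_precoalg[OF C]

text \<open>Over the finite-dimensional coalgebra \<open>sub C L\<close>, \<open>L\<close> is itself
  a stage, and the part living over \<open>L\<close> is the whole transpose. So
  \<open>Tr_stage_iso\<close> over \<open>sub C L\<close> identifies that transpose with its stage,
  which equals the stage over \<open>C\<close>; \<open>Tr_stage_iso\<close> over \<open>C\<close>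
  and the coaction lead on to the cotensor product.\<close>

lemma Tr_rpart_iso: "\<exists>\<phi>. lcomod_iso (sub C L) (Tr (sub C L) (rpart C L I0) d (rpart C L I1)) (cotensor C L (Tr C I0 d I1)) \<phi>"
proof -
  have L: "subcoalg C L" using fdL by (simp add: fd_subcoalgebras_iff)
  note CL = coalgebra_sub[OF C L] and PL = precoalg_sub[OF P12 L]
  note R0 = injective_right_comodule[OF C I0] and R1 = injective_right_comodule[OF C I1]
  have LL: "L \<in> fd_subcoalgebras (sub C L)"
    using fdL by (auto simp: fd_subcoalgebras_def)
  have reg: "right_comodule (sub C L) (regular C L)" using coalgebra_right_regular[OF CL] by simp
  have act: "act (sub C L) (rpart C L I1) L = act C I1 L" by (simp add: act_def fun_eq_iff)
  have DH: "DHom (sub C L) (rpart C L I1) L = DHom C I1 L"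
    by (simp add: DHom_def Hom_rpart[OF C L R1 reg] act)
  have st: "Tr_stage (sub C L) (rpart C L I0) (rpart C L I1) d L = Tr_stage C I0 I1 d L"
    unfolding Tr_stage_def DHom_map_def DH by (simp add: Hom_rpart[OF C L R0 reg])
  let ?T = "Tr (sub C L) (rpart C L I0) d (rpart C L I1)"
  have T: "left_comodule (sub C L) ?T"
    by (rule left_comodule_Tr[OF CL right_comodule_sub_rpart[OF C L R0] right_comodule_sub_rpart[OF C L R1] rcomod_hom_rpart[OF C L R0 R1 d]])
  have "carrier (lpart (sub C L) L ?T) = carrier ?T" using left_comoduleD(3)[OF PL T] by auto
  then have "lpart (sub C L) L ?T = ?T" by (simp add: lpart_def)
  then have 1: "lcomod_iso (sub C L) (Tr_stage C I0 I1 d L) ?T (star_in (sub C L) (rpart C L I1) L)"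
    using Tr_stage_iso[OF CL injective_rpart[OF C L I0] injective_rpart[OF C L I1] rcomod_hom_rpart[OF C L R0 R1 d] LL]
    by (simp add: st)
  show ?thesis
    using lcomod_iso_comp[OF PL lcomod_iso_comp[OF PL lcomod_iso_inv[OF PL 1] Tr_stage_iso[OF C I0 I1 d fdL]]
        cotensor_iso[OF C L left_comodule_Tr[OF C R0 R1 d]]] by blast
qed

end

section \<open>Exhaustion of the transpose and the direct limit\<close>

lemma subcoalgebras_over_nonempty:
  assumes C: "coalgebra C" and M: "right_comodule C M" and fd: "findim M"
  shows "subcoalgebras_over C M \<noteq> {}"
proof -
  note P = coalgebra_precoalg[OF C]
  note dM = right_comoduleD[OF P M]
  interpret V: vector_space "smul M" using dM(1) by (rule vspaceD)
  obtain B where B: "finite B" "V.span B = carrier M" using fd by (auto simp: findim_def)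
  have BM: "B \<subseteq> carrier M" using B(2) V.span_superset by blast
  \<comment> \<open>Each element of a finite spanning set of \<open>M\<close> involves finitely many
    elements of \<open>C\<close> in its coaction; a finite-dimensional subcoalgebra containing all
    of them contains \<open>cf C M\<close>.\<close>
  have "\<exists>S. finite S \<and> S \<subseteq> carrier C \<and> (\<forall>L. vspace (sub C L) \<longrightarrow> S \<subseteq> L \<longrightarrow> rcoact M b \<in> carrier (tensor M (sub C L)))" if b: "b \<in> B" for b
  proof -
    obtain ps where ps: "set ps \<subseteq> carrier M \<times> carrier C" "rcoact M b = (\<Sum>(x, y)\<leftarrow>ps. tens M C x y)"
      using tensor_rep[OF dM(3) dM(1)] b BM by blast
    have "(\<Sum>(x, y)\<leftarrow>ps. tens M C x y) \<in> carrier (tensor M (sub C L))" if "snd ` set ps \<subseteq> L" for L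
      using ps(1) that
    proof (induction ps)
      case Nil
      then show ?case by (simp add: vspace_closed(1)[OF vspace_tensor])
    next
      case (Cons q ps)
      then show ?case
        using tens_in[of "fst q" M "snd q" "sub C L"] by (cases q) (auto intro!: vspace_closed(2)[OF vspace_tensor])
    qed
    then show ?thesis using ps by (intro exI[of _ "snd ` set ps"]) auto
  qed
  then have "\<forall>b\<in>B. \<exists>S. finite S \<and> S \<subseteq> carrier C \<and> (\<forall>L. vspace (sub C L) \<longrightarrow> S \<subseteq> L \<longrightarrow> rcoact M b \<in> carrier (tensor M (sub C L)))" by blast
  from bchoice[OF this] obtain S where S: "\<forall>b\<in>B. finite (S b) \<and> S b \<subseteq> carrier C
      \<and> (\<forall>L. vspace (sub C L) \<longrightarrow> S b \<subseteq> L \<longrightarrow> rcoact M b \<in> carrier (tensor M (sub C L)))" by blast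
  obtain L0 where L0: "L0 \<in> fd_subcoalgebras C" using fd_subcoalgebras_nonempty[OF C] by blast
  obtain L where L: "L \<in> fd_subcoalgebras C" "(\<Union>b\<in>B. S b) \<subseteq> L"
    by (rule fd_subcoalgebra_containing[OF C L0, of "\<Union>b\<in>B. S b"]) (use S B(1) in auto)
  have L1: "subcoalg C L" using L(1) by (simp add: fd_subcoalgebras_iff)
  note LD = subcoalgD[OF P L1]
  have *: "rcoact M x \<in> carrier (tensor M (sub C L))" if x: "x \<in> carrier M" for x
  proof (rule lin_on_span[OF dM(1) vspace_tensor dM(2) BM])
    show "module.subspace (smul (tensor M C)) (carrier (tensor M (sub C L)))"
      using vspaceD(3)[OF vspace_tensor[of M "sub C L"]] by simp
    show "x \<in> V.span B" using x B(2) by simp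
    show "rcoact M s \<in> carrier (tensor M (sub C L))" if "s \<in> B" for s
      using S that LD(2) L(2) by blast
  qed
  have "cf C M \<subseteq> L"
    unfolding cf_def using * L1 by (intro Inter_lower) (auto simp: subcoalg_def)
  then show ?thesis using L(1) by (auto simp: subcoalgebras_over_def)
qed

lemma ldot_lpart:
  assumes C: "coalgebra C" and L: "subcoalg C L" and T: "left_comodule C T" and y: "y \<in> carrier (lpart C L T)" and a: "functional C a"
  shows "ldot C (lpart C L T) a y = ldot C T a y"
proof -
  note P = coalgebra_precoalg[OF C]
  note d = left_comoduleD[OF P left_comodule_lpart[OF C L T]]
  show ?thesis
    unfolding ldot_def lpart_simps
    by (rule lslice_mono[OF precoalgD(1)[OF P] left_comoduleD(1)[OF P T] a]) (use d(1,3) y precoalgD(1)[OF P] in auto)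
qed

lemma lpart_mono: "L \<subseteq> L' \<Longrightarrow> carrier (lpart C L T) \<subseteq> carrier (lpart C L' T)"
  using tensor_mono[of _ "sub C L" T "sub C L'" T] by auto

text \<open>The coaction of y involves finitely many elements of \<open>C\<close>, which fit into a
  finite-dimensional subcoalgebra. It is chosen to contain \<open>L0\<close>, so that it stays in
  the index set of the limit.\<close>

lemma lpart_cover:
  assumes C: "coalgebra C" and T: "left_comodule C T" and L0: "L0 \<in> fd_subcoalgebras C" and y: "y \<in> carrier T"
  obtains L where "L \<in> fd_subcoalgebras C" "L0 \<subseteq> L" "y \<in> carrier (lpart C L T)"
proof -
  note P = coalgebra_precoalg[OF C]
  note vC = precoalgD(1)[OF P] and dT = left_comoduleD[OF P T]
  obtain ps where ps: "set ps \<subseteq> carrier C \<times> carrier T" "lcoact T y = (\<Sum>(c, z)\<leftarrow>ps. tens C T c z)"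
    using tensor_rep[OF dT(3)[OF y] vC] by blast
  obtain L where L: "L \<in> fd_subcoalgebras C" "L0 \<subseteq> L" "fst ` set ps \<subseteq> L"
    by (rule fd_subcoalgebra_containing[OF C L0, of "fst ` set ps"]) (use ps(1) in auto)
  have "(\<Sum>(c, z)\<leftarrow>ps. tens C T c z) \<in> carrier (tensor (sub C L) T)"
    using ps(1) L(3)
  proof (induction ps)
    case Nil
    then show ?case by (simp add: vspace_closed(1)[OF vspace_tensor])
  next
    case (Cons q ps)
    then show ?case
      using tens_in[of "fst q" "sub C L" "snd q" T] by (cases q) (auto intro!: vspace_closed(2)[OF vspace_tensor])
  qed
  then show thesis using that[OF L(1,2)] y ps(2) by simp
qed

text \<open>Composing \<phi> L with the inverse of the coaction embeds \<open>X L\<close> into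
  \<open>T\<close> with image \<open>lpart C L T\<close>. Under these embeddings the connecting maps
  become inclusions, for every choice of the identifications, and
  \<open>direct_system_of_embeddings\<close> applies.\<close>

lemma dirlim_cotensor:
  fixes C :: "('k::field, 'c::ab_group_add) coalg" and T :: "('k, 'c, 't::ab_group_add) lcomod"
    and X :: "'c set \<Rightarrow> ('k, 'c, 'x::ab_group_add) lcomod"
  assumes C: "coalgebra C" and T: "left_comodule C T" and M: "right_comodule C M" "findim M"
    and \<phi>: "\<And>L. L \<in> subcoalgebras_over C M \<Longrightarrow> lcomod_iso (sub C L) (X L) (cotensor C L T) (\<phi> L)"
  shows "direct_system C (subcoalgebras_over C M) X (connecting X \<phi>)"
    "\<exists>\<psi>. lcomod_iso C (dirlim C (subcoalgebras_over C M) X (connecting X \<phi>)) T \<psi>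
       \<and> (\<forall>L\<in>subcoalgebras_over C M. \<forall>x\<in>carrier (X L).
            \<psi> (lim_in (subcoalgebras_over C M) X (connecting X \<phi>) L x) = cotensor_to C L T (\<phi> L x))"
proof -
  note P = coalgebra_precoalg[OF C]
  define D where "D = subcoalgebras_over C M"
  define \<kappa> where "\<kappa> = (\<lambda>L x. inv_into (carrier (lpart C L T)) (lcoact T) (\<phi> L x))"
  have D: "L \<in> fd_subcoalgebras C" "subcoalg C L" "cf C M \<subseteq> L" if "L \<in> D" for L
    using that by (auto simp: D_def subcoalgebras_over_def fd_subcoalgebras_iff)
  have DI: "L \<in> D" if "L \<in> fd_subcoalgebras C" "L' \<in> D" "L' \<subseteq> L" for L L'
    using that by (auto simp: D_def subcoalgebras_over_def)
  have \<phi>L: "lcomod_iso (sub C L) (X L) (cotensor C L T) (\<phi> L)" if "L \<in> D" for L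
    using \<phi> that by (simp add: D_def)
  have \<phi>b: "bij_betw (\<phi> L) (carrier (X L)) (carrier (cotensor C L T))" if "L \<in> D" for L
    using \<phi>L[OF that] by (simp add: lcomod_iso_def)
  have X: "left_comodule C (X L)" "x \<in> carrier (X L) \<Longrightarrow> lcoact (X L) x \<in> carrier (tensor (sub C L) (X L))" if "L \<in> D" for L x
    using \<phi>L[OF that] left_comodule_sub_iff[OF P D(2)[OF that], of "X L"] by (auto simp: lcomod_iso_def)
  have iso: "lcomod_iso (sub C L) (X L) (lpart C L T) (\<kappa> L)" if L: "L \<in> D" for L
    unfolding \<kappa>_def
    by (rule lcomod_iso_comp[OF precoalg_sub[OF P D(2)[OF L]] \<phi>L[OF L]
          lcomod_iso_inv[OF precoalg_sub[OF P D(2)[OF L]] cotensor_iso[OF C D(2)[OF L] T]]])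
  have \<kappa>b: "bij_betw (\<kappa> L) (carrier (X L)) (carrier (lpart C L T))" if "L \<in> D" for L
    using iso[OF that] by (simp add: lcomod_iso_def)
  have inj: "inj_on (lcoact T) (carrier (lpart C L T))" if "L \<in> D" for L
    by (rule inj_on_inverseI[of _ "cotensor_to C L T"]) (rule cotensor_to_lcoact[OF C D(2)[OF that] T])
  have \<kappa>: "\<kappa> L x \<in> carrier (lpart C L T)" "lcoact T (\<kappa> L x) = \<phi> L x" "\<kappa> L x = cotensor_to C L T (\<phi> L x)"
    if L: "L \<in> D" and x: "x \<in> carrier (X L)" for L x
  proof -
    have "\<phi> L x \<in> lcoact T ` carrier (lpart C L T)"
      using bij_betw_apply[OF \<phi>b[OF L] x] unfolding carrier_cotensor[OF C D(2)[OF L] T] .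
    then show 1: "\<kappa> L x \<in> carrier (lpart C L T)" "lcoact T (\<kappa> L x) = \<phi> L x"
      unfolding \<kappa>_def by (rule inv_into_into, rule f_inv_into_f)
    show "\<kappa> L x = cotensor_to C L T (\<phi> L x)"
      using cotensor_to_lcoact[OF C D(2)[OF L] T 1(1)] 1(2) by simp
  qed
  have hom: "lcomod_hom C (X L) T (\<kappa> L)" if L: "L \<in> D" for L
  proof (rule lcomod_homI[OF P X(1)[OF L] T])
    note lT = left_comodule_lpart[OF C D(2)[OF L] T]
    have "lcomod_hom C (X L) (lpart C L T) (\<kappa> L)"
      using iso[OF L] lcomod_hom_sub_iff[OF P D(2)[OF L] left_comoduleD(1)[OF P X(1)[OF L]] left_comoduleD(1)[OF P lT] X(2)[OF L]]
      by (simp add: lcomod_iso_def)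
    note h = lcomod_homD[OF P X(1)[OF L] lT this]
    show "lin_on (X L) T (\<kappa> L)" by (rule lin_onI) (use lin_onD[OF h(1)] in auto)
    fix x a assume x: "x \<in> carrier (X L)" and a: "functional C a"
    show "\<kappa> L (ldot C (X L) a x) = ldot C T a (\<kappa> L x)"
      using h(2)[OF x a] ldot_lpart[OF C D(2)[OF L] T \<kappa>(1)[OF L x] a] by simp
  qed
  have t: "connecting X \<phi> L L' x \<in> carrier (X L')" "\<kappa> L' (connecting X \<phi> L L' x) = \<kappa> L x"
    if L: "L \<in> D" "L' \<in> D" "L \<le> L'" and x: "x \<in> carrier (X L)" for L L' x
  proof -
    have \<kappa>L': "\<kappa> L x \<in> carrier (lpart C L' T)" using \<kappa>(1)[OF L(1) x] lpart_mono[OF L(3), of C T] by blast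
    then have "lcoact T (\<kappa> L x) \<in> carrier (cotensor C L' T)" unfolding carrier_cotensor[OF C D(2)[OF L(2)] T] by (rule imageI)
    \<comment> \<open>\<open>connecting\<close> is defined by \<open>inv_into\<close>, which is
      meaningful only on the image of \<phi> L'; the membership expresses the inclusion of the
      cotensor products for L \<le> L'.\<close>
    then have "\<phi> L x \<in> \<phi> L' ` carrier (X L')"
      using \<phi>b[OF L(2)] \<kappa>(2)[OF L(1) x] by (simp add: bij_betw_def)
    then show 1: "connecting X \<phi> L L' x \<in> carrier (X L')"
      and "\<kappa> L' (connecting X \<phi> L L' x) = \<kappa> L x"
    proof -
      assume *: "\<phi> L x \<in> \<phi> L' ` carrier (X L')"
      show 1: "connecting X \<phi> L L' x \<in> carrier (X L')"
        unfolding connecting_def by (rule inv_into_into[OF *])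
      have 2: "\<phi> L' (connecting X \<phi> L L' x) = \<phi> L x"
        unfolding connecting_def by (rule f_inv_into_f[OF *])
      show "\<kappa> L' (connecting X \<phi> L L' x) = \<kappa> L x"
        by (rule inj_onD[OF inj[OF L(2)] _ \<kappa>(1)[OF L(2) 1] \<kappa>L'])
          (simp add: \<kappa>(2)[OF L(2) 1] \<kappa>(2)[OF L(1) x] 2)
    qed
  qed
  have ne: "D \<noteq> {}" unfolding D_def by (rule subcoalgebras_over_nonempty[OF C M])
  have dir: "\<exists>L''\<in>D. L \<le> L'' \<and> L' \<le> L''" if L: "L \<in> D" "L' \<in> D" for L L'
    by (rule fd_subcoalgebras_directed[OF C D(1)[OF L(1)] D(1)[OF L(2)]]) (use DI L in blast)
  have cover: "\<exists>L\<in>D. y \<in> \<kappa> L ` carrier (X L)" if y: "y \<in> carrier T" for y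
  proof -
    obtain L0 where L0: "L0 \<in> D" using ne by blast
    obtain L where L: "L \<in> fd_subcoalgebras C" "L0 \<subseteq> L" "y \<in> carrier (lpart C L T)"
      by (rule lpart_cover[OF C T D(1)[OF L0] y])
    then have "L \<in> D" using DI L0 by blast
    moreover from this have "y \<in> \<kappa> L ` carrier (X L)"
      using bij_betw_imp_surj_on[OF \<kappa>b] L(3) by blast
    ultimately show ?thesis by blast
  qed
  have \<kappa>i: "inj_on (\<kappa> L) (carrier (X L))" if "L \<in> D" for L
    using \<kappa>b[OF that] by (simp add: bij_betw_def)
  note fin = direct_system_of_embeddings[OF P T ne dir X(1) hom \<kappa>i t cover]
  show "direct_system C (subcoalgebras_over C M) X (connecting X \<phi>)"
    using fin(1) unfolding D_def .
  show "\<exists>\<psi>. lcomod_iso C (dirlim C (subcoalgebras_over C M) X (connecting X \<phi>)) T \<psi>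
       \<and> (\<forall>L\<in>subcoalgebras_over C M. \<forall>x\<in>carrier (X L).
            \<psi> (lim_in (subcoalgebras_over C M) X (connecting X \<phi>) L x) = cotensor_to C L T (\<phi> L x))"
    using fin(2) \<kappa>(3) unfolding D_def[symmetric] by auto
qed

text \<open>The first conjunct provides copresentations and identifications over every \<Lambda>, so
  the premise of the second can be met. The second covers every choice of them and determines the
  isomorphism by its values on the stages, namely the canonical map from the cotensor product, so
  that the limit is reached through the inclusions and not by an abstract isomorphism.\<close>

theorem proposition1:
  fixes \<Gamma> :: "('k::field, 'c::ab_group_add) coalg"
    and M :: "('k, 'c, 'm::ab_group_add) rcomod"
    and I0 :: "('k, 'c, 'i0::ab_group_add) rcomod"
    and I1 :: "('k, 'c, 'i1::ab_group_add) rcomod"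
    and J0 :: "'c set \<Rightarrow> ('k, 'c, 'j0::ab_group_add) rcomod"
    and J1 :: "'c set \<Rightarrow> ('k, 'c, 'j1::ab_group_add) rcomod"
  assumes "coalgebra \<Gamma>"
    and "qf_inj_copresentation \<Gamma> M e I0 d I1"
    and "findim M" and "indecomposable \<Gamma> M" and "\<not> injective_comodule \<Gamma> M"
  defines "\<L> \<equiv> subcoalgebras_over \<Gamma> M"
    and "TrM \<equiv> Tr \<Gamma> I0 d I1"
  shows
    "(\<forall>\<Lambda>\<in>\<L>. qf_inj_copresentation (sub \<Gamma> \<Lambda>) M e (rpart \<Gamma> \<Lambda> I0) d (rpart \<Gamma> \<Lambda> I1)
        \<and> (\<exists>\<phi>. lcomod_iso (sub \<Gamma> \<Lambda>) (Tr (sub \<Gamma> \<Lambda>) (rpart \<Gamma> \<Lambda> I0) d (rpart \<Gamma> \<Lambda> I1))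
                 (cotensor \<Gamma> \<Lambda> TrM) \<phi>))
   \<and> (\<forall>f g \<phi>.
        (\<forall>\<Lambda>\<in>\<L>. qf_inj_copresentation (sub \<Gamma> \<Lambda>) M (f \<Lambda>) (J0 \<Lambda>) (g \<Lambda>) (J1 \<Lambda>)
           \<and> lcomod_iso (sub \<Gamma> \<Lambda>) (Tr (sub \<Gamma> \<Lambda>) (J0 \<Lambda>) (g \<Lambda>) (J1 \<Lambda>)) (cotensor \<Gamma> \<Lambda> TrM) (\<phi> \<Lambda>))
        \<longrightarrow> (let X = (\<lambda>\<Lambda>. Tr (sub \<Gamma> \<Lambda>) (J0 \<Lambda>) (g \<Lambda>) (J1 \<Lambda>)); t = connecting X \<phi>
             in direct_system \<Gamma> \<L> X t
              \<and> (\<exists>\<psi>. lcomod_iso \<Gamma> (dirlim \<Gamma> \<L> X t) TrM \<psi>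
                   \<and> (\<forall>\<Lambda>\<in>\<L>. \<forall>x\<in>carrier (X \<Lambda>).
                        \<psi> (lim_in \<L> X t \<Lambda> x) = cotensor_to \<Gamma> \<Lambda> TrM (\<phi> \<Lambda> x)))))"
proof -
  have M: "right_comodule \<Gamma> M" and I: "injective_comodule \<Gamma> I0" "injective_comodule \<Gamma> I1" and d: "rcomod_hom \<Gamma> I0 I1 d"
    using assms(2) by (auto simp: qf_inj_copresentation_def)
  have T: "left_comodule \<Gamma> TrM"
    unfolding TrM_def
    by (rule left_comodule_Tr[OF assms(1) injective_right_comodule[OF assms(1) I(1)] injective_right_comodule[OF assms(1) I(2)] d])
  have L: "\<Lambda> \<in> fd_subcoalgebras \<Gamma>" "subcoalg \<Gamma> \<Lambda>" "cf \<Gamma> M \<subseteq> \<Lambda>" if "\<Lambda> \<in> \<L>" for \<Lambda>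
    using that by (auto simp: \<L>_def subcoalgebras_over_def fd_subcoalgebras_iff)
  show ?thesis
  proof (intro conjI ballI allI impI)
    fix \<Lambda> assume "\<Lambda> \<in> \<L>"
    note L = L[OF this]
    show "qf_inj_copresentation (sub \<Gamma> \<Lambda>) M e (rpart \<Gamma> \<Lambda> I0) d (rpart \<Gamma> \<Lambda> I1)"
      by (rule qf_inj_copresentation_rpart[OF assms(1) L(2) assms(2) L(3)])
    show "\<exists>\<phi>. lcomod_iso (sub \<Gamma> \<Lambda>) (Tr (sub \<Gamma> \<Lambda>) (rpart \<Gamma> \<Lambda> I0) d (rpart \<Gamma> \<Lambda> I1)) (cotensor \<Gamma> \<Lambda> TrM) \<phi>"
      unfolding TrM_def by (rule Tr_rpart_iso[OF assms(1) I d L(1)])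
  next
    fix f g \<phi>
    assume "\<forall>\<Lambda>\<in>\<L>. qf_inj_copresentation (sub \<Gamma> \<Lambda>) M (f \<Lambda>) (J0 \<Lambda>) (g \<Lambda>) (J1 \<Lambda>)
           \<and> lcomod_iso (sub \<Gamma> \<Lambda>) (Tr (sub \<Gamma> \<Lambda>) (J0 \<Lambda>) (g \<Lambda>) (J1 \<Lambda>)) (cotensor \<Gamma> \<Lambda> TrM) (\<phi> \<Lambda>)"
    then have "lcomod_iso (sub \<Gamma> \<Lambda>) (Tr (sub \<Gamma> \<Lambda>) (J0 \<Lambda>) (g \<Lambda>) (J1 \<Lambda>)) (cotensor \<Gamma> \<Lambda> TrM) (\<phi> \<Lambda>)"
      if "\<Lambda> \<in> subcoalgebras_over \<Gamma> M" for \<Lambda> using that by (simp add: \<L>_def)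
    from dirlim_cotensor[OF assms(1) T M assms(3) this]
    show "let X = (\<lambda>\<Lambda>. Tr (sub \<Gamma> \<Lambda>) (J0 \<Lambda>) (g \<Lambda>) (J1 \<Lambda>)); t = connecting X \<phi>
             in direct_system \<Gamma> \<L> X t
              \<and> (\<exists>\<psi>. lcomod_iso \<Gamma> (dirlim \<Gamma> \<L> X t) TrM \<psi>
                   \<and> (\<forall>\<Lambda>\<in>\<L>. \<forall>x\<in>carrier (X \<Lambda>).
                        \<psi> (lim_in \<L> X t \<Lambda> x) = cotensor_to \<Gamma> \<Lambda> TrM (\<phi> \<Lambda> x)))"
      unfolding Let_def \<L>_def by blast
  qed
qed

end
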